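(* Up to similarity (i.e. up to isometries of $\mathbb{R}^4$ and scaling by a positive real factor), the number of $n$-element $2$-distance sets in $\mathbb{R}^4$ is $33$ for $n=7$, $20$ for $n=8$, and $5$ for $n=9$.
   Context: A $2$-distance set in $\mathbb{R}^d$ is a finite set $\mathcal{X}\subset\mathbb{R}^d$ of distinct vectors such that the set $\{\|x-y\| : x,y\in\mathcal{X},\ x\neq y\}$ of mutual Euclidean distances has cardinality exactly $2$. An $n$-element $2$-distance set is one with $|\mathcal{X}|=n$. Two subsets $\mathcal{X},\mathcal{Y}$ of $\mathbb{R}^4$ are similar if there exist a real number $c>0$ and an isometry $T$ of $\mathbb{R}^4$ with $\mathcal{Y}=T(c\mathcal{X})$; the counts are counts of similarity classes. Sets are not required to span $\mathbb{R}^4$. *)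

theory Defs
  imports "HOL-Analysis.Analysis"
begin

definition distances :: "'a::metric_space set \<Rightarrow> real set" where
  "distances X = {dist x y | x y. x \<in> X \<and> y \<in> X \<and> x \<noteq> y}"

definition two_distance_set :: "'a::metric_space set \<Rightarrow> bool" where
  "two_distance_set X \<longleftrightarrow> finite X \<and> card (distances X) = 2"

(* Surjectivity need not be demanded: on a Euclidean space it follows, see isometry_bij. *)
definition isometry :: "('a::metric_space \<Rightarrow> 'a) \<Rightarrow> bool" where
  "isometry T \<longleftrightarrow> (\<forall>x y. dist (T x) (T y) = dist x y)"

definition similar :: "'a::euclidean_space set \<Rightarrow> 'a set \<Rightarrow> bool" where
  "similar X Y \<longleftrightarrow> (\<exists>c>0. \<exists>T. isometry T \<and> Y = T ` ((\<lambda>x. c *\<^sub>R x) ` X))"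

definition similarity :: "('a::euclidean_space set \<times> 'a set) set" where
  "similarity = {(X, Y). similar X Y}"

lemma isometry_bij:
  fixes T :: "'a::euclidean_space \<Rightarrow> 'a"
  assumes "isometry T"
  shows "bij T"
proof -
  have "orthogonal_transformation (\<lambda>x. T x - T 0)"
    using assms unfolding orthogonal_transformation_isometry isometry_def
    by (simp add: dist_norm)
  then have s: "surj (\<lambda>x. T x - T 0)"
    by (rule orthogonal_transformation_surj)
  have "surj T"
  proof -
    have "\<exists>x. y = T x" for y
      using surjD[OF s, of "y - T 0"] by simp
    then show ?thesis by (rule surj_def[THEN iffD2, OF allI])
  qed
  moreover have "inj T"
    using assms unfolding isometry_def by (metis dist_eq_0_iff injI)
  ultimately show ?thesis by (rule bijI[rotated])
qed

lemma dist_scaleR_both: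
  fixes x y :: "'a::real_normed_vector"
  shows "dist (k *\<^sub>R x) (k *\<^sub>R y) = \<bar>k\<bar> * dist x y"
  by (metis dist_norm norm_scaleR scaleR_diff_right)

lemma equiv_similarity: "equiv UNIV (similarity :: ('a::euclidean_space set \<times> 'a set) set)"
proof (rule equivI)
  show "(similarity :: ('a set \<times> 'a set) set) \<subseteq> UNIV \<times> UNIV" by simp
  have "similar X X" for X :: "'a set"
    unfolding similar_def by (rule exI[of _ 1]) (auto simp: isometry_def intro!: exI[of _ id])
  then show "refl (similarity :: ('a set \<times> 'a set) set)"
    by (auto simp: refl_on_def similarity_def)
  have "similar Y X" if XY: "similar X Y" for X Y :: "'a set"
  proof -
    obtain c T where c: "c > 0" and T: "isometry T" and Y: "Y = T ` ((\<lambda>x. c *\<^sub>R x) ` X)"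
      using XY unfolding similar_def by blast
    note b = isometry_bij[OF T]
    define S where "S = (\<lambda>z. (1/c) *\<^sub>R inv T (c *\<^sub>R z))"
    have inv_iso: "dist (inv T x) (inv T y) = dist x y" for x y
      using T b unfolding isometry_def by (metis bij_inv_eq_iff)
    have "isometry S"
      unfolding isometry_def S_def using c by (simp add: dist_scaleR_both inv_iso)
    moreover have "S ` ((\<lambda>x. (1/c) *\<^sub>R x) ` Y) = X"
      unfolding Y image_image S_def using c b by (simp add: bij_is_inj)
    ultimately show ?thesis
      unfolding similar_def using c by (metis zero_less_divide_1_iff)
  qed
  then show "sym (similarity :: ('a set \<times> 'a set) set)"
    by (auto simp: sym_def similarity_def)
  have "similar X Z" if XY: "similar X Y" and YZ: "similar Y Z" for X Y Z :: "'a set"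
  proof -
    obtain c T where c: "c > 0" and T: "isometry T" and Y: "Y = T ` ((\<lambda>x. c *\<^sub>R x) ` X)"
      using XY unfolding similar_def by blast
    obtain d U where d: "d > 0" and U: "isometry U" and Z: "Z = U ` ((\<lambda>x. d *\<^sub>R x) ` Y)"
      using YZ unfolding similar_def by blast
    define S where "S = (\<lambda>z. U (d *\<^sub>R T ((1/d) *\<^sub>R z)))"
    have "isometry S"
      using T U d unfolding isometry_def S_def by (simp add: dist_scaleR_both)
    moreover have "Z = S ` ((\<lambda>x. (d * c) *\<^sub>R x) ` X)"
      unfolding Z Y image_image S_def using d by simp
    ultimately show ?thesis
      unfolding similar_def using c d by (metis mult_pos_pos)
  qed
  then show "trans (similarity :: ('a set \<times> 'a set) set)"
    unfolding trans_def similarity_def by blast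
qed

definition two_distance_classes :: "nat \<Rightarrow> 'a::euclidean_space set set set" where
  "two_distance_classes n = {X. two_distance_set X \<and> card X = n} // similarity"

end

theory Submission
  imports Defs
begin

text \<open>
  Scale a two-distance set so that the squares of its distances are \<open>s\<close> and \<open>s + 1\<close>, where \<open>s >
  0\<close>, and let \<open>A\<close> be the adjacency matrix of the graph that joins the points at the larger
  distance. For coefficients with \<open>\<Sum> c\<^sub>i = 0\<close> one has \<open>2 \<parallel>\<Sum> c\<^sub>i x\<^sub>i\<parallel>\<^sup>2 = s \<parallel>c\<parallel>\<^sup>2 - c \<bullet> A c\<close>
  (lemma \<open>realizes_energy\<close>). So the form on the right is positive semidefinite on the hyperplane
  \<open>\<Sum> c\<^sub>i = 0\<close>, and it vanishes exactly at the affine dependences of the points. Six points of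
  \<open>\<real>\<^sup>4\<close> are affinely dependent; therefore, for six or more points, \<open>s\<close> is the largest eigenvalue
  \<open>\<theta>(A)\<close> of the form \<open>c \<bullet> A c\<close> on the hyperplane. In particular the graph determines \<open>s\<close>
  (\<open>realizes_scale_unique\<close>), and then it determines the set up to isometry
  (\<open>realizes_congruent\<close>). Counting similarity classes is counting isomorphism classes of graphs
  that occur (\<open>card_two_distance_classes\<close>).

  Moreover all six-point subsets of such a set have the same \<open>\<theta>\<close>, namely \<open>s\<close>. This makes a
  classification by adding one point at a time feasible. All 156 graphs on six vertices are
  produced, each with a rational interval that contains its \<open>\<theta>\<close>: the lower end comes from one
  integer vector, the upper end from an elimination showing that a form is positive semidefinite
  (\<open>valid_range_sound\<close>). The new point can be taken to have maximal degree. If its row of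
  adjacencies extends the graph in such a way that \<open>\<theta>\<close> grows, then an integer vector close to the
  top eigenvector of the extended graph violates the upper bound; a few such vectors per graph
  remove all but a handful of rows (\<open>half_space_sound\<close>). The remaining rows give either a graph
  of the next list or a graph with a six-vertex subgraph whose interval is disjoint from the
  current one (\<open>covers_Suc\<close>). So the whole search uses integers only, although \<open>\<theta>\<close> is an
  algebraic number of degree up to five, and it ends with 33, 20 and 5 graphs on 7, 8 and 9
  vertices.

  Conversely all these graphs occur. Only four values of \<open>s\<close> are left. For \<open>s = 1\<close> and \<open>s = (\<surd>5 -
  1) / 2\<close> the maximal ones among the graphs are given by points with coordinates in \<open>\<rat>(\<surd>5)\<close>, up
  to one positive factor for each coordinate axis; the two others belong to orbits of seven
  points under a rotation of order seven. The graphs within one list are pairwise not isomorphic,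
  because the sums over all vertices \<open>x\<close> of \<open>(\<Sum>\<^bsub>y \<sim> x\<^esub> (deg y)\<^sup>2)\<^sup>2\<close> differ.
\<close>

section \<open>Labelled graphs and their realizations\<close>

text \<open>
  Every computation below recurses on the newest vertex, which is therefore the head: in \<open>b # G\<close>
  the row \<open>b\<close> tells to which of the older vertices, newest first, the new one is adjacent.
\<close>

type_synonym graph = "bool list list"

fun adj :: "graph \<Rightarrow> nat \<Rightarrow> nat \<Rightarrow> bool" where
  "adj [] i j = False"
| "adj (b # G) 0 0 = False"
| "adj (b # G) 0 (Suc j) = b ! j"
| "adj (b # G) (Suc i) 0 = b ! i"
| "adj (b # G) (Suc i) (Suc j) = adj G i j"

primrec relabel :: "graph \<Rightarrow> nat list \<Rightarrow> graph" where
  "relabel G [] = []"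
| "relabel G (i # p) = map (adj G i) p # relabel G p"

text \<open>
  Points at the larger distance are adjacent. Since the squares of the two distances are
  normalised to differ by \<open>1\<close>, the remaining parameter \<open>s\<close> fixes the scale as well as the ratio
  of the distances.
\<close>

fun realizes :: "real \<Rightarrow> graph \<Rightarrow> 'a::metric_space list \<Rightarrow> bool" where
  "realizes s [] [] \<longleftrightarrow> True"
| "realizes s (b # G) (x # xs) \<longleftrightarrow>
     list_all2 (\<lambda>e y. (dist x y)\<^sup>2 = s + of_bool e) b xs \<and> realizes s G xs"
| "realizes s _ _ \<longleftrightarrow> False"

lemma realizes_length: "realizes s G xs \<Longrightarrow> length G = length xs"
  by (induction s G xs rule: realizes.induct) auto

lemma realizes_distinct: "realizes s G xs \<Longrightarrow> s > 0 \<Longrightarrow> distinct xs"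
proof (induction s G xs rule: realizes.induct)
  case (2 s b G x xs)
  have "x \<notin> set xs"
  proof
    assume "x \<in> set xs"
    then obtain i where i: "i < length xs" "xs ! i = x" by (auto simp: in_set_conv_nth)
    with 2(2) have "(dist x (xs ! i))\<^sup>2 = s + of_bool (b ! i)"
      by (auto simp: list_all2_conv_all_nth)
    moreover have "(dist x (xs ! i))\<^sup>2 = 0" using i by simp
    moreover have "0 \<le> (of_bool (b ! i) :: real)" by simp
    ultimately show False using \<open>s > 0\<close> by linarith
  qed
  with 2 show ?case by auto
qed auto

lemma realizes_adj:
  assumes "realizes s G xs" "i < length xs" "j < length xs" "i \<noteq> j"
  shows "(dist (xs ! i) (xs ! j))\<^sup>2 = s + of_bool (adj G i j)"
  using assms
proof (induction s G xs arbitrary: i j rule: realizes.induct)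
  case (2 s b G x xs)
  show ?case
    using 2 by (cases i; cases j) (auto simp: list_all2_conv_all_nth dist_commute)
qed auto

lemma realizes_relabel:
  assumes "realizes s G xs" "distinct p" "\<forall>i\<in>set p. i < length xs"
  shows "realizes s (relabel G p) (map ((!) xs) p)"
  using assms(2,3)
proof (induction p)
  case (Cons i p)
  then have "list_all2 (\<lambda>e y. (dist (xs ! i) y)\<^sup>2 = s + of_bool e)
      (map (adj G i) p) (map ((!) xs) p)"
    unfolding list_all2_conv_all_nth
    using realizes_adj[OF assms(1), of i]
      by (metis (no_types, lifting) distinct.simps(2) length_map list.set_intros nth_map nth_mem)
  with Cons show ?case by auto
qed auto

lemma realizes_isometry:
  assumes "realizes s G xs" "\<And>x y. dist (f x) (f y) = dist x y"
  shows "realizes s G (map f xs)"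
  using assms(1)
    by (induction s G xs rule: realizes.induct) (auto simp: assms(2) list_all2_conv_all_nth)

section \<open>The energy identity and affine dependences\<close>

fun select_sum :: "bool list \<Rightarrow> 'a::comm_ring_1 list \<Rightarrow> 'a" where
  "select_sum (e # b) (x # xs) = (if e then x + select_sum b xs else select_sum b xs)"
| "select_sum _ _ = 0"

fun adj_form :: "graph \<Rightarrow> 'a::comm_ring_1 list \<Rightarrow> 'a" where
  "adj_form (b # G) (x # xs) = 2 * (x * select_sum b xs) + adj_form G xs"
| "adj_form _ _ = 0"

primrec sum_squares :: "'a::comm_ring_1 list \<Rightarrow> 'a" where
  "sum_squares [] = 0"
| "sum_squares (x # xs) = x * x + sum_squares xs"

fun lincomb :: "real list \<Rightarrow> 'a::real_vector list \<Rightarrow> 'a" where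
  "lincomb (c # cs) (x # xs) = c *\<^sub>R x + lincomb cs xs"
| "lincomb _ _ = 0"

fun moment :: "real list \<Rightarrow> 'a::real_inner list \<Rightarrow> real" where
  "moment (c # cs) (x # xs) = c * (x \<bullet> x) + moment cs xs"
| "moment _ _ = 0"

lemma row_energy:
  fixes x :: "'a::real_inner"
  assumes "list_all2 (\<lambda>e y. (dist x y)\<^sup>2 = s + of_bool e) b xs" "length cs = length xs"
  shows "select_sum b cs + s * sum_list cs =
    (x \<bullet> x) * sum_list cs - 2 * (x \<bullet> lincomb cs xs) + moment cs xs"
  using assms
proof (induction b xs arbitrary: cs rule: list_all2_induct)
  case (Cons e b y ys)
  then obtain c cs' where cs: "cs = c # cs'" by (cases cs) auto
  have d: "x \<bullet> x - 2 * (x \<bullet> y) + y \<bullet> y = s + of_bool e"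
    using Cons(1)
      by (simp add: dist_norm power2_norm_eq_inner inner_diff_left inner_diff_right inner_commute)
  have IH: "select_sum b cs' + s * sum_list cs' =
    (x \<bullet> x) * sum_list cs' - 2 * (x \<bullet> lincomb cs' ys) + moment cs' ys"
    using Cons cs by auto
  have "c * (x \<bullet> x) - 2 * (c * (x \<bullet> y)) + c * (y \<bullet> y) = c * s + c * of_bool e"
    using arg_cong[OF d, of "\<lambda>t. c * t"] by (simp add: algebra_simps)
  with IH show ?case using cs by (auto simp: algebra_simps inner_add_right)
qed auto

text \<open>
  Expanding \<open>dist x y\<^sup>2 = x \<bullet> x - 2 (x \<bullet> y) + y \<bullet> y\<close> in \<open>\<Sum> c\<^sub>i c\<^sub>j (dist x\<^sub>i x\<^sub>j)\<^sup>2\<close> leaves,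
  besides the norm of the combination, only a multiple of \<open>\<Sum> c\<^sub>i\<close>.
\<close>

lemma realizes_energy:
  fixes xs :: "'a::real_inner list"
  assumes "realizes s G xs" "length cs = length xs"
  shows "adj_form G cs + s * ((sum_list cs)\<^sup>2 - sum_squares cs) =
    2 * (sum_list cs * moment cs xs - lincomb cs xs \<bullet> lincomb cs xs)"
  using assms
proof (induction s G xs arbitrary: cs rule: realizes.induct)
  case (2 s b G x xs)
  then obtain c cs' where cs: "cs = c # cs'" by (cases cs) auto
  have IH: "adj_form G cs' + s * ((sum_list cs')\<^sup>2 - sum_squares cs') =
    2 * (sum_list cs' * moment cs' xs - lincomb cs' xs \<bullet> lincomb cs' xs)"
    using 2 cs by auto
  have R: "select_sum b cs' + s * sum_list cs' =
    (x \<bullet> x) * sum_list cs' - 2 * (x \<bullet> lincomb cs' xs) + moment cs' xs"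
    using 2 cs by (intro row_energy) auto
  have "c * select_sum b cs' + c * s * sum_list cs' =
    c * (x \<bullet> x) * sum_list cs' - 2 * c * (x \<bullet> lincomb cs' xs) + c * moment cs' xs"
    using arg_cong[OF R, of "\<lambda>t. c * t"] by (simp add: algebra_simps)
  with IH show ?case using cs
    by (simp add: algebra_simps power2_eq_square inner_add_left inner_add_right inner_commute)
qed auto

lemma realizes_form_le:
  fixes xs :: "'a::real_inner list"
  assumes "realizes s G xs" "length cs = length xs" "sum_list cs = 0"
  shows "adj_form G cs \<le> s * sum_squares cs"
proof -
  have "0 \<le> lincomb cs xs \<bullet> lincomb cs xs" by simp
  with realizes_energy[OF assms(1,2)] assms(3) show ?thesis
    by (simp del: inner_ge_zero add: algebra_simps)
qed

lemma realizes_form_eq: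
  fixes xs :: "'a::real_inner list"
  assumes "realizes s G xs" "length cs = length xs" "sum_list cs = 0" "lincomb cs xs = 0"
  shows "adj_form G cs = s * sum_squares cs"
  using realizes_energy[OF assms(1,2)] assms(3,4) by (simp add: algebra_simps)

lemma sum_squares_nonneg: "0 \<le> sum_squares (cs :: real list)"
  by (induction cs) auto

lemma sum_squares_pos: "\<exists>c\<in>set cs. c \<noteq> 0 \<Longrightarrow> 0 < sum_squares (cs :: real list)"
proof (induction cs)
  case (Cons a cs)
  show ?case
  proof (cases "a = 0")
    case False
    then have "0 < a * a" by (metis not_real_square_gt_zero)
    then show ?thesis using sum_squares_nonneg[of cs] by simp
  qed (use Cons in auto)
qed auto

lemma lincomb_map: "lincomb (map u xs) xs = (\<Sum>x\<leftarrow>xs. u x *\<^sub>R x)"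
  by (induction xs) auto

lemma affine_dependency:
  fixes xs :: "'a::euclidean_space list"
  assumes "distinct xs" "length xs \<ge> DIM('a) + 2"
  obtains cs where "length cs = length xs" "sum_list cs = 0" "lincomb cs xs = 0"
    "0 < sum_squares cs"
proof -
  have "affine_dependent (set xs)"
    using assms by (intro affine_dependent_biggerset) (auto simp: distinct_card)
  then obtain U where U: "sum U (set xs) = 0" "\<exists>v\<in>set xs. U v \<noteq> 0" "(\<Sum>v\<in>set xs. U v *\<^sub>R v) = 0"
    by (subst (asm) affine_dependent_explicit_finite) auto
  show ?thesis
  proof
    show "sum_list (map U xs) = 0" using U assms by (simp add: sum_list_distinct_conv_sum_set)
    show "lincomb (map U xs) xs = 0" unfolding lincomb_map using U assms
      by (simp add: sum_list_distinct_conv_sum_set)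
    show "0 < sum_squares (map U xs)" using U by (intro sum_squares_pos) auto
  qed auto
qed

text \<open>
  Apply the form of \<open>G\<close> to an affine dependence of the second realization: there it equals \<open>t\<close>
  times the sum of squares, and the first realization bounds it by \<open>s\<close> times that sum. By
  symmetry the graph of six or more points of \<open>\<real>\<^sup>4\<close> determines its scale.
\<close>

lemma realizes_scale_unique:
  fixes xs ys :: "'a::euclidean_space list"
  assumes "realizes s G xs" "realizes t G ys" "t > 0" "length xs \<ge> DIM('a) + 2"
  shows "t \<le> s"
proof -
  have len: "length ys = length xs" using assms(1,2) realizes_length by metis
  obtain cs where cs: "length cs = length ys" "sum_list cs = 0" "lincomb cs ys = 0"
    "0 < sum_squares cs"
    using affine_dependency[of ys] realizes_distinct[OF assms(2,3)] assms(4) len by metis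
  have "t * sum_squares cs = adj_form G cs" using realizes_form_eq[OF assms(2) cs(1-3)] by simp
  also have "\<dots> \<le> s * sum_squares cs" using realizes_form_le[OF assms(1)] cs len by auto
  finally show ?thesis using cs(4) by simp
qed

section \<open>Rational bounds for the scale\<close>

text \<open>
  A range \<open>(a, b, p, q)\<close> is the interval \<open>a / b \<le> s \<le> p / q\<close>, written without division so that
  \<open>(0, 1, 1, 0)\<close> stands for no upper bound.
\<close>

type_synonym range = "int \<times> int \<times> int \<times> int"

fun in_range :: "real \<Rightarrow> range \<Rightarrow> bool" where
  "in_range s (a, b, p, q) \<longleftrightarrow> real_of_int a \<le> real_of_int b * s \<and> real_of_int q * s \<le> real_of_int p"

text \<open>
  A symmetric matrix, as the list of its rows from the diagonal on: each row is its diagonal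
  entry with the entries to the right of it.
\<close>

type_synonym form = "(int \<times> int list) list"

fun dot :: "int list \<Rightarrow> real list \<Rightarrow> real" where
  "dot (c # v) (x # xs) = of_int c * x + dot v xs"
| "dot _ _ = 0"

fun eval_form :: "form \<Rightarrow> real list \<Rightarrow> real" where
  "eval_form ((a, v) # M) (x # xs) = of_int a * x\<^sup>2 + 2 * x * dot v xs + eval_form M xs"
| "eval_form _ _ = 0"

fun triangular :: "form \<Rightarrow> bool" where
  "triangular [] \<longleftrightarrow> True"
| "triangular ((a, v) # M) \<longleftrightarrow> length v = length M \<and> triangular M"

text \<open>
  One step of symmetric elimination, multiplied by the pivot \<open>a\<close> to stay within the integers.
\<close>

fun reduce_form :: "int \<Rightarrow> int list \<Rightarrow> form \<Rightarrow> form" where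
  "reduce_form a (y # v) ((b, w) # M) =
     (a * b - y * y, map2 (\<lambda>c z. a * c - y * z) w v) # reduce_form a v M"
| "reduce_form _ _ _ = []"

lemma length_reduce_form [termination_simp]: "length (reduce_form a v M) \<le> length M"
  by (induction a v M rule: reduce_form.induct) auto

fun psd :: "form \<Rightarrow> bool" where
  "psd [] = True"
| "psd ((a, v) # M) =
     (if a = 0 then list_all (\<lambda>y. y = 0) v \<and> psd M
      else 0 < a \<and> psd (reduce_form a v M))"

text \<open>
  The form \<open>p \<parallel>x\<parallel>\<^sup>2 - q (x \<bullet> A x)\<close> on the hyperplane \<open>\<Sum> x\<^sub>i = 0\<close>, in the coordinates that remain
  when the newest vertex, whose row is the third argument, is eliminated.
\<close>

fun restricted_form :: "int \<Rightarrow> int \<Rightarrow> bool list \<Rightarrow> graph \<Rightarrow> form" where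
  "restricted_form p q (e # c) (b # G) =
     (2 * p + 2 * q * of_bool e,
      map2 (\<lambda>f a. p + q * (of_bool e + of_bool f - of_bool a)) c b) # restricted_form p q c G"
| "restricted_form _ _ _ _ = []"

lemma dot_row:
  "length c = length xs \<Longrightarrow> length b = length xs \<Longrightarrow>
   dot (map2 (\<lambda>f a. p + q * (e + of_bool f - of_bool a)) c b) xs =
     of_int (p + q * e) * sum_list xs + of_int q * select_sum c xs - of_int q * select_sum b xs"
proof (induction xs arbitrary: c b)
  case (Cons x xs)
  then show ?case by (cases c; cases b) (auto simp: algebra_simps)
qed auto

lemma eval_restricted_form:
  "realizes s G ys \<Longrightarrow> length c = length ys \<Longrightarrow> length xs = length ys \<Longrightarrow>
   triangular (restricted_form p q c G) \<and> length (restricted_form p q c G) = length ys \<and>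
   eval_form (restricted_form p q c G) xs =
     of_int p * ((sum_list xs)\<^sup>2 + sum_squares xs) +
       2 * of_int q * sum_list xs * select_sum c xs - of_int q * adj_form G xs"
proof (induction s G ys arbitrary: c xs rule: realizes.induct)
  case (2 s b G y ys)
  obtain e c' where c: "c = e # c'" using 2 by (cases c) auto
  obtain x xs' where xs: "xs = x # xs'" using 2 by (cases xs) auto
  have l: "length b = length ys" "length c' = length ys" "length xs' = length ys"
    using 2 c xs by (auto dest: list_all2_lengthD)
  have IH: "triangular (restricted_form p q c' G)" "length (restricted_form p q c' G) = length ys"
    "eval_form (restricted_form p q c' G) xs' = of_int p * ((sum_list xs')\<^sup>2 + sum_squares xs') +
       2 * of_int q * sum_list xs' * select_sum c' xs' - of_int q * adj_form G xs'"
    using 2(1)[of c' xs'] 2(2) l by auto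
  have "dot (map2 (\<lambda>f a. p + q * (of_bool e + of_bool f - of_bool a)) c' b) xs' =
     of_int (p + q * of_bool e) * sum_list xs' +
       of_int q * select_sum c' xs' - of_int q * select_sum b xs'"
    using l by (intro dot_row) auto
  then have "eval_form (restricted_form p q c (b # G)) xs =
    of_int (2 * p + 2 * q * of_bool e) * x\<^sup>2 +
      2 * x * (of_int (p + q * of_bool e) * sum_list xs' +
        of_int q * select_sum c' xs' - of_int q * select_sum b xs') +
      eval_form (restricted_form p q c' G) xs'"
    unfolding c xs by simp
  also have "\<dots> =
    of_int p * ((sum_list xs)\<^sup>2 + sum_squares xs) + 2 * of_int q * sum_list xs * select_sum c xs -
      of_int q * adj_form (b # G) xs"
    unfolding IH(3) c xs by (cases e) (simp_all add: algebra_simps power2_eq_square)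
  finally show ?case using IH l c by simp
qed auto

lemma reduce_form_shape:
  "triangular M \<Longrightarrow> length v = length M
    \<Longrightarrow> triangular (reduce_form a v M) \<and> length (reduce_form a v M) = length M"
  by (induction a v M rule: reduce_form.induct) auto

lemma dot_combination:
  "length w = length xs \<Longrightarrow> length v = length xs \<Longrightarrow>
   dot (map2 (\<lambda>c z. a * c - y * z) w v) xs = of_int a * dot w xs - of_int y * dot v xs"
proof (induction xs arbitrary: w v)
  case (Cons x xs)
  then show ?case by (cases w; cases v) (auto simp: algebra_simps)
qed auto

text \<open>
  Completing the square: \<open>a\<close> times the form with pivot row \<open>(a, v)\<close> is the square of the linear
  form of that row plus the reduced form.
\<close>

lemma eval_reduce_form:
  "triangular M \<Longrightarrow> length v = length M \<Longrightarrow> length xs = length M \<Longrightarrow>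
   eval_form (reduce_form a v M) xs = of_int a * eval_form M xs - (dot v xs)\<^sup>2"
proof (induction a v M arbitrary: xs rule: reduce_form.induct)
  case (1 a y v b w M)
  then obtain x xs' where xs: "xs = x # xs'" by (cases xs) auto
  have IH: "eval_form (reduce_form a v M) xs' = of_int a * eval_form M xs' - (dot v xs')\<^sup>2"
    using 1 xs by auto
  have "dot (map2 (\<lambda>c z. a * c - y * z) w v) xs' = of_int a * dot w xs' - of_int y * dot v xs'"
    using 1(2-) xs by (intro dot_combination) auto
  then have "eval_form (reduce_form a (y # v) ((b, w) # M)) xs =
      of_int (a * b - y * y) * x\<^sup>2 + 2 * x * (of_int a * dot w xs' - of_int y * dot v xs') +
      (of_int a * eval_form M xs' - (dot v xs')\<^sup>2)"
    unfolding xs by (simp add: IH)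
  also have "\<dots> = of_int a * eval_form ((b, w) # M) xs - (dot (y # v) xs)\<^sup>2"
    unfolding xs by (simp add: algebra_simps power2_eq_square)
  finally show ?case .
qed auto

lemma dot_zero: "list_all (\<lambda>y. y = 0) v \<Longrightarrow> dot v xs = 0"
  by (induction v xs rule: dot.induct) auto

lemma psd_nonneg:
  "psd M \<Longrightarrow> triangular M \<Longrightarrow> length xs = length M \<Longrightarrow> 0 \<le> eval_form M xs"
proof (induction M arbitrary: xs rule: psd.induct)
  case (2 a v M)
  then obtain x xs' where xs: "xs = x # xs'" by (cases xs) auto
  show ?case
  proof (cases "a = 0")
    case True
    then show ?thesis using 2 xs by (auto simp: dot_zero)
  next
    case False
    then have a: "0 < a" "psd (reduce_form a v M)" using 2(3) by auto
    have "0 \<le> eval_form (reduce_form a v M) xs'"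
      using 2 False a xs reduce_form_shape[of M v a] by auto
    then have "0 \<le> of_int a * eval_form M xs' - (dot v xs')\<^sup>2"
      using 2(4,5) xs by (simp add: eval_reduce_form)
    moreover have "of_int a * eval_form ((a, v) # M) xs =
      (of_int a * x + dot v xs')\<^sup>2 + (of_int a * eval_form M xs' - (dot v xs')\<^sup>2)"
      using xs by (simp add: algebra_simps power2_eq_square)
    ultimately have "0 \<le> of_int a * eval_form ((a, v) # M) xs" by simp
    then show ?thesis using a by (simp add: zero_le_mult_iff)
  qed
qed auto

text \<open>
  As \<open>s\<close> is positive, a lower bound \<open>a \<le> 0\<close> holds by itself; a positive one is certified by the
  vector \<open>w\<close>.
\<close>

fun valid_range :: "graph \<times> range \<Rightarrow> int list \<Rightarrow> bool" where
  "valid_range (c # G, (a, b, p, q)) w \<longleftrightarrow> length G = 5 \<and> 0 \<le> b \<and>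
     (a \<le> 0 \<or> length w = 6 \<and> sum_list w = 0 \<and> 0 < sum_squares w \<and>
        a * sum_squares w \<le> b * adj_form (c # G) w) \<and>
     psd (restricted_form p q c G)"
| "valid_range _ _ \<longleftrightarrow> False"

lemma select_sum_of_int: "select_sum b (map of_int w) = (of_int (select_sum b w) :: real)"
  by (induction b w rule: select_sum.induct) auto

lemma adj_form_of_int: "adj_form G (map of_int w) = (of_int (adj_form G w) :: real)"
  by (induction G w rule: adj_form.induct) (auto simp: select_sum_of_int)

lemma sum_squares_of_int: "sum_squares (map of_int w) = (of_int (sum_squares w) :: real)"
  by (induction w) auto

lemma sum_list_of_int: "sum_list (map of_int w) = (of_int (sum_list w) :: real)"
  by (induction w) auto

text \<open>
  The lower bound is the value of the form at the test vector \<open>w\<close>. For the upper bound, take an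
  affine dependence \<open>c\<close> of the six points: there \<open>c \<bullet> A c = s \<parallel>c\<parallel>\<^sup>2\<close>, while semidefiniteness says
  \<open>q (c \<bullet> A c) \<le> p \<parallel>c\<parallel>\<^sup>2\<close>.
\<close>

lemma valid_range_sound:
  fixes ys :: "(real ^ 4) list"
  assumes "valid_range (H, J) w" "realizes s H ys" "s > 0"
  shows "in_range s J"
proof -
  obtain c G a b p q where H: "H = c # G" and J: "J = (a, b, p, q)"
    using assms(1) by (cases "((H, J), w)" rule: valid_range.cases) auto
  note v = assms(1)[unfolded H J valid_range.simps]
  have len: "length ys = 6" using v realizes_length[OF assms(2)] H by auto
  obtain y ys' where ys: "ys = y # ys'" using len by (cases ys) auto
  have G: "realizes s G ys'" "length c = length ys'"
    using assms(2) H ys by (auto dest: list_all2_lengthD)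
  have low: "real_of_int a \<le> of_int b * s"
  proof (cases "a \<le> 0")
    case True
    then have "real_of_int a \<le> 0" "0 \<le> of_int b * s" using v assms(3) by auto
    then show ?thesis by linarith
  next
    case False
    with v have w: "length w = 6" "sum_list w = 0" "0 < sum_squares w"
      "a * sum_squares w \<le> b * adj_form H w" unfolding H by auto
    have "adj_form H (map of_int w) \<le> s * sum_squares (map of_int w)"
      using realizes_form_le[OF assms(2), of "map of_int w"] w len by (simp add: sum_list_of_int)
    then have "of_int b * real_of_int (adj_form H w) \<le> of_int b * (s * of_int (sum_squares w))"
      using v by (intro mult_left_mono) (auto simp: adj_form_of_int sum_squares_of_int)
    moreover have "real_of_int a * of_int (sum_squares w) \<le> of_int b * of_int (adj_form H w)"
      using w(4) by (metis of_int_le_iff of_int_mult)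
    ultimately have "real_of_int a * of_int (sum_squares w)
      \<le> (of_int b * s) * of_int (sum_squares w)"
      by (simp add: algebra_simps)
    then show ?thesis using w(3) by simp
  qed
  have "of_int q * s \<le> real_of_int p"
  proof -
    obtain cs where cs: "length cs = length ys" "sum_list cs = 0" "lincomb cs ys = 0"
      "0 < sum_squares cs"
      using affine_dependency[of ys] realizes_distinct[OF assms(2,3)] len by auto
    obtain x xs where x: "cs = x # xs" using cs(1) ys by (cases cs) auto
    have x0: "x = - sum_list xs" using cs(2) x by simp
    have "0 \<le> eval_form (restricted_form p q c G) xs"
      using v eval_restricted_form[OF G, of xs p q] cs(1) ys x by (intro psd_nonneg) auto
    then have "0 \<le> of_int p * sum_squares cs - of_int q * adj_form H cs"
      using eval_restricted_form[OF G, of xs p q] cs(1) ys unfolding x x0 H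
      by (simp add: algebra_simps power2_eq_square)
    also have "adj_form H cs = s * sum_squares cs"
      using realizes_form_eq[OF assms(2) cs(1-3)] .
    finally have "(of_int q * s) * sum_squares cs \<le> of_int p * sum_squares cs"
      by (simp add: algebra_simps)
    then show ?thesis using cs(4) by simp
  qed
  with low show ?thesis unfolding J by simp
qed

section \<open>Sums over neighbours\<close>

primrec add_row :: "bool list \<Rightarrow> 'a::comm_ring_1 \<Rightarrow> 'a list \<Rightarrow> 'a list" where
  "add_row [] h ds = []"
| "add_row (e # b) h ds = (if e then hd ds + h else hd ds) # add_row b h (tl ds)"

text \<open>
  The product of the adjacency matrix with a vector; iterating it yields the degrees as well as
  an isomorphism invariant.
\<close>

fun neighbour_sums :: "graph \<Rightarrow> 'a::comm_ring_1 list \<Rightarrow> 'a list" where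
  "neighbour_sums (b # G) (h # hs) = select_sum b hs # add_row b h (neighbour_sums G hs)"
| "neighbour_sums _ _ = []"

definition degrees :: "graph \<Rightarrow> int list" where
  "degrees G = neighbour_sums G (map (\<lambda>_. 1) G)"

definition invariant :: "graph \<Rightarrow> int" where
  "invariant G =
     sum_list (map (\<lambda>t. t * t) (neighbour_sums G (map (\<lambda>d. d * d) (degrees G))))"

lemma length_add_row [simp]: "length (add_row b h ds) = length b"
  by (induction b arbitrary: ds) auto

lemma add_row_map:
  "length b = length xs \<Longrightarrow>
   add_row b h (map f xs) = map2 (\<lambda>e x. if e then f x + h else f x) b xs"
  by (induction b arbitrary: xs) (case_tac xs; auto)+

lemma select_sum_map:
  assumes "list_all2 (\<lambda>e y. (dist x y)\<^sup>2 = s + of_bool e) b xs" "distinct xs"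
  shows "select_sum b (map g xs) = (\<Sum>y | y \<in> set xs \<and> (dist x y)\<^sup>2 = s + 1. g y)"
  using assms
proof (induction b xs rule: list_all2_induct)
  case (Cons e b z zs)
  have "{y. y \<in> set (z # zs) \<and> (dist x y)\<^sup>2 = s + 1} =
    (if e then insert z else id) {y. y \<in> set zs \<and> (dist x y)\<^sup>2 = s + 1}"
    using Cons(1) by auto
  with Cons show ?case by auto
qed auto

text \<open>
  The right-hand side does not refer to the labelling, which is why quantities computed by
  \<open>neighbour_sums\<close> depend on the realized set only.
\<close>

lemma neighbour_sums_map:
  assumes "realizes s G xs" "s > 0"
  shows "neighbour_sums G (map g xs) =
    map (\<lambda>x. \<Sum>y | y \<in> set xs \<and> (dist x y)\<^sup>2 = s + 1. g y) xs"
  using assms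
proof (induction s G xs rule: realizes.induct)
  case (2 s b G z zs)
  have d: "distinct (z # zs)" using realizes_distinct[OF 2(2,3)] .
  have row: "list_all2 (\<lambda>e y. (dist z y)\<^sup>2 = s + of_bool e) b zs" and G: "realizes s G zs"
    using 2(2) by auto
  have len: "length b = length zs" using row by (rule list_all2_lengthD)
  have self: "(dist z z)\<^sup>2 \<noteq> s + 1" using 2(3) by simp
  have "{y. y \<in> set (z # zs) \<and> (dist z y)\<^sup>2 = s + 1} = {y. y \<in> set zs \<and> (dist z y)\<^sup>2 = s + 1}"
    using self by auto
  moreover have "select_sum b (map g zs) = (\<Sum>y | y \<in> set zs \<and> (dist z y)\<^sup>2 = s + 1. g y)"
    using select_sum_map[OF row] d by simp
  moreover have "add_row b (g z) (neighbour_sums G (map g zs)) =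
    map (\<lambda>x. \<Sum>y | y \<in> set (z # zs) \<and> (dist x y)\<^sup>2 = s + 1. g y) zs"
  proof (rule nth_equalityI)
    fix i assume "i < length (add_row b (g z) (neighbour_sums G (map g zs)))"
    then have i: "i < length zs" using len by simp
    have "(dist z (zs ! i))\<^sup>2 = s + of_bool (b ! i)"
      using row i by (auto simp: list_all2_conv_all_nth)
    then have e: "(dist (zs ! i) z)\<^sup>2 = s + 1 \<longleftrightarrow> b ! i" by (auto simp: dist_commute)
    have "{y. y \<in> set (z # zs) \<and> (dist (zs ! i) y)\<^sup>2 = s + 1} =
      (if b ! i then insert z else id) {y. y \<in> set zs \<and> (dist (zs ! i) y)\<^sup>2 = s + 1}"
      using e by auto
    then show "add_row b (g z) (neighbour_sums G (map g zs)) ! i =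
      map (\<lambda>x. \<Sum>y | y \<in> set (z # zs) \<and> (dist x y)\<^sup>2 = s + 1. g y) zs ! i"
      unfolding 2(1)[OF G 2(3)] add_row_map[OF len] using i len d by (auto simp: add.commute)
  qed (use len in simp)
  ultimately show ?case by simp
qed auto

lemma degrees_realizes:
  assumes "realizes s G xs" "s > 0"
  shows "degrees G = map (\<lambda>x. of_nat (card {y \<in> set xs. (dist x y)\<^sup>2 = s + 1})) xs"
proof -
  have "map (\<lambda>_. 1 :: int) G = map (\<lambda>_. 1) xs" using realizes_length[OF assms(1)]
    by (simp add: map_replicate_const)
  then show ?thesis unfolding degrees_def using neighbour_sums_map[OF assms, of "\<lambda>_. 1"] by simp
qed

lemma invariant_realizes:
  assumes "realizes s G xs" "s > 0"
  shows "invariant G = (\<Sum>x\<in>set xs. (\<Sum>y | y \<in> set xs \<and> (dist x y)\<^sup>2 = s + 1.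
    (int (card {z \<in> set xs. (dist y z)\<^sup>2 = s + 1}))\<^sup>2)\<^sup>2)"
  unfolding invariant_def degrees_realizes[OF assms] map_map comp_def
    neighbour_sums_map[OF assms]
  using realizes_distinct[OF assms] by (simp add: sum_list_distinct_conv_sum_set power2_eq_square)

section \<open>Adding one point\<close>

definition spread :: "real \<Rightarrow> 'a::metric_space set \<Rightarrow> bool" where
  "spread s X \<longleftrightarrow> finite X \<and> (\<forall>x\<in>X. \<forall>y\<in>X. x \<noteq> y \<longrightarrow> (dist x y)\<^sup>2 \<in> {s, s + 1})"

definition covers :: "nat \<Rightarrow> (graph \<times> range) list \<Rightarrow> bool" where
  "covers k L \<longleftrightarrow> (\<forall>s > 0. \<forall>X :: (real ^ 4) set. spread s X \<and> card X = k \<longrightarrow>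
     (\<exists>(G, I) \<in> set L. in_range s I \<and> (\<exists>xs. set xs = X \<and> realizes s G xs)))"

text \<open>
  A vector \<open>w\<close> on the old vertices, completed at the new vertex to \<open>z # w\<close> with sum zero, turns
  the upper bound \<open>p / q\<close> for \<open>s\<close> into a linear condition on the row of the new vertex: the sum
  of \<open>v\<close> over its neighbours is at most \<open>r\<close>, where \<open>(v, r)\<close> is the value of this function.
\<close>

definition half_space :: "graph \<Rightarrow> range \<Rightarrow> int list \<Rightarrow> int list \<times> int" where
  "half_space G I w = (case I of (_, _, p, q) \<Rightarrow> let z = - sum_list w in
     (map (\<lambda>x. 2 * q * z * x) w, p * (z * z + sum_squares w) - q * adj_form G w))"

text \<open>
  All rows that satisfy the given linear conditions, with the partial sums shared along the
  binary tree of rows.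
\<close>

primrec rows_in :: "nat \<Rightarrow> (int list \<times> int) list \<Rightarrow> bool list list" where
  "rows_in 0 T = (if list_all (\<lambda>(w, r). 0 \<le> r) T then [[]] else [])"
| "rows_in (Suc n) T =
     map (Cons False) (rows_in n (map (\<lambda>(w, r). (tl w, r)) T)) @
     map (Cons True) (rows_in n (map (\<lambda>(w, r). (tl w, r - hd w)) T))"

definition max_degree_row :: "int list \<Rightarrow> bool list \<Rightarrow> bool" where
  "max_degree_row ds b =
     (let n = select_sum b (map (\<lambda>_. 1) b) in list_all (\<lambda>d. d \<le> n) (add_row b 1 ds))"

text \<open>
  What becomes of a graph with one more vertex. \<open>Iso r p\<close>: in the order \<open>p\<close> of its vertices it is
  number \<open>r\<close> of the next list. \<open>Sub r p\<close>: its vertices \<open>p\<close> induce number \<open>r\<close> of the six-vertex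
  graphs, whose range excludes the current scale.
\<close>

datatype fate = Iso nat "nat list" | Sub nat "nat list"

text \<open>
  A graph with its range, its test vectors, and the fates of those rows of maximal degree that
  survive the tests, in the order in which \<open>rows_in\<close> lists these rows.
\<close>

type_synonym node = "graph \<times> range \<times> int list list \<times> fate list"

fun disjoint_ranges :: "range \<Rightarrow> range \<Rightarrow> bool" where
  "disjoint_ranges (a, b, c, d) (a', b', c', d') \<longleftrightarrow>
     0 < b \<and> 0 < d \<and> 0 < b' \<and> 0 < d' \<and> (c * b' < a' * d \<or> c' * b < a * d')"

fun valid_fate ::
  "(graph \<times> range) list \<Rightarrow> (graph \<times> range) list \<Rightarrow> graph \<Rightarrow> range \<Rightarrow> bool list \<Rightarrow> fate \<Rightarrow> bool" where
  "valid_fate L6 L G I b (Iso r p) \<longleftrightarrow> r < length L \<and> distinct p \<and> length p = Suc (length G) \<and>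
     list_all (\<lambda>i. i < Suc (length G)) p \<and> L ! r = (relabel (b # G) p, I)"
| "valid_fate L6 L G I b (Sub r p) \<longleftrightarrow> r < length L6 \<and> distinct p \<and>
     list_all (\<lambda>i. i < Suc (length G)) p \<and>
     (case L6 ! r of (H, J) \<Rightarrow> H = relabel (b # G) p \<and> disjoint_ranges I J)"

text \<open>
  A range that forces \<open>s \<le> 0\<close> marks a graph without any realization, so nothing extends it.
\<close>

fun valid_node :: "(graph \<times> range) list \<Rightarrow> (graph \<times> range) list \<Rightarrow> node \<Rightarrow> bool" where
  "valid_node L6 L (G, I, ws, fs) \<longleftrightarrow>
     (case I of (_, _, p, q) \<Rightarrow> 0 \<le> q \<and> (p \<le> 0 \<and> 0 < q \<or>
     list_all (\<lambda>w. length w = length G) ws \<and> list_all2 (valid_fate L6 L G I)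
       (filter (max_degree_row (degrees G)) (rows_in (length G) (map (half_space G I) ws))) fs))"

definition bare :: "node list \<Rightarrow> (graph \<times> range) list" where
  "bare = map (\<lambda>(G, I, _). (G, I))"

definition unbounded :: "node list \<Rightarrow> (graph \<times> range) list" where
  "unbounded = map (\<lambda>(G, _). (G, (0, 1, 1, 0)))"

lemma rows_in_complete:
  "length b = n \<Longrightarrow> \<forall>(w, r) \<in> set T. length w = n \<and> select_sum b w \<le> r \<Longrightarrow> b \<in> set (rows_in n T)"
proof (induction n arbitrary: b T)
  case 0
  then show ?case by (auto simp: list_all_iff)
next
  case (Suc n)
  from Suc(2) obtain e b' where b: "b = e # b'" by (cases b) auto
  have *: "length (tl w) = n \<and> select_sum b' (tl w) \<le> (if e then r - hd w else r)"
    if "(w, r) \<in> set T" for w r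
    using Suc(3) that b by (cases w) fastforce+
  define T' where "T' = map (\<lambda>(w, r). (tl w, if e then r - hd w else r)) T"
  have "b' \<in> set (rows_in n T')" using Suc(2) b * unfolding T'_def by (intro Suc(1)) auto
  then show ?case unfolding T'_def b by (cases e) auto
qed

lemma half_space_sound:
  fixes xs :: "'a::real_inner list"
  assumes "realizes s (b # G) (x # xs)" "in_range s I" "0 \<le> snd (snd (snd I))" "length w = length G"
  shows "case half_space G I w of (v, r) \<Rightarrow> length v = length G \<and> select_sum b v \<le> r"
proof -
  obtain a c p q where I: "I = (a, c, p, q)" by (cases I) auto
  define z where "z = - sum_list w"
  have len: "length xs = length G" "length b = length G"
    using assms(1) realizes_length[of s G xs] by (auto dest: list_all2_lengthD)
  have "adj_form (b # G) (map of_int (z # w)) \<le> s * sum_squares (map of_int (z # w))"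
    using realizes_form_le[OF assms(1), of "map of_int (z # w)"] assms(4) len
    by (simp add: sum_list_of_int z_def)
  then have 1: "real_of_int (adj_form (b # G) (z # w)) \<le> s * of_int (sum_squares (z # w))"
    unfolding adj_form_of_int sum_squares_of_int .
  have nn: "0 \<le> real_of_int (sum_squares (z # w))"
    using sum_squares_nonneg[of "map of_int (z # w)"] unfolding sum_squares_of_int .
  have "real_of_int (q * adj_form (b # G) (z # w)) \<le> of_int q * s * of_int (sum_squares (z # w))"
    using mult_left_mono[OF 1, of "of_int q"] assms(3) I by (simp add: algebra_simps)
  also have "\<dots> \<le> of_int p * of_int (sum_squares (z # w))"
    using mult_right_mono[OF _ nn, of "of_int q * s" "of_int p"] assms(2) I by simp
  finally have "real_of_int (q * adj_form (b # G) (z # w)) \<le> of_int (p * sum_squares (z # w))"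
    by simp
  then have 2: "q * adj_form (b # G) (z # w) \<le> p * sum_squares (z # w)"
    by (simp only: of_int_le_iff)
  have "select_sum b (map (\<lambda>x. k * x) w) = k * select_sum b w" for k
    by (induction b w rule: select_sum.induct) (auto simp: algebra_simps)
  with 2 assms(4) show ?thesis unfolding I half_space_def z_def Let_def
    by (simp add: algebra_simps)
qed

lemma disjoint_ranges_sound:
  assumes "disjoint_ranges I J" "in_range s I" "in_range s J"
  shows "False"
proof -
  obtain a b c d a' b' c' d' where I: "I = (a, b, c, d)" and J: "J = (a', b', c', d')"
    by (cases I; cases J) auto
  have *: "\<not> c * b' < a' * d"
    if "real_of_int d * s \<le> c" "real_of_int a' \<le> b' * s" "0 < d" "0 < b'" for a' b' c d :: int
  proof -
    have "real_of_int (a' * d) \<le> (b' * s) * d" using that by simp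
    also have "\<dots> = real_of_int b' * (real_of_int d * s)" by simp
    also have "\<dots> \<le> real_of_int b' * real_of_int c" using that by (intro mult_left_mono) auto
    finally have "real_of_int (a' * d) \<le> of_int (b' * c)" by simp
    then show ?thesis unfolding of_int_le_iff by (simp add: mult.commute)
  qed
  show False using assms *[of d c a' b'] *[of d' c' a b] unfolding I J by auto
qed

text \<open>
  Remove a point of maximal degree, recognise the rest in the list for \<open>k\<close>, and look up the fate
  of the row of the removed point. Each fate leads either to the next list, without changing the
  range, or to a six-point subset with a contradictory scale.
\<close>

lemma covers_Suc:
  assumes cov: "covers k (bare N)"
    and L6: "\<And>H J s (ys :: (real ^ 4) list). (H, J) \<in> set L6 \<Longrightarrow> realizes s H ys \<Longrightarrow> s > 0
      \<Longrightarrow> in_range s J"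
    and valid: "list_all (valid_node L6 L) N"
  shows "covers (Suc k) L"
  unfolding covers_def
proof (intro allI impI)
  fix s :: real and X :: "(real ^ 4) set"
  assume s: "s > 0" and X: "spread s X \<and> card X = Suc k"
  define deg where "deg v = card {y \<in> X. (dist v y)\<^sup>2 = s + 1}" for v
  have fin: "finite X" "X \<noteq> {}" using X by (auto simp: spread_def)
  have "Max (deg ` X) \<in> deg ` X" using fin by (intro Max_in) auto
  then obtain v where v: "v \<in> X" "deg v = Max (deg ` X)" by (metis imageE)
  then have v: "v \<in> X" "\<And>u. u \<in> X \<Longrightarrow> deg u \<le> deg v" using fin by simp_all
  have "spread s (X - {v})" "card (X - {v}) = k" using X v by (auto simp: spread_def)
  then obtain G I xs where G: "(G, I) \<in> set (bare N)" "in_range s I" "set xs = X - {v}"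
    "realizes s G xs"
    using cov s unfolding covers_def by blast
  then obtain ws fs where N: "(G, I, ws, fs) \<in> set N" by (auto simp: bare_def)
  define b where "b = map (\<lambda>x. (dist v x)\<^sup>2 = s + 1) xs"
  have realizes: "realizes s (b # G) (v # xs)"
    using G(3,4) X v unfolding b_def spread_def
      by (auto simp: list_all2_conv_all_nth) (metis Diff_iff nth_mem singletonI)+
  have len: "length G = length xs" "length b = length G" using realizes_length[OF G(4)]
    by (auto simp: b_def)
  have set: "set (v # xs) = X" using G v by auto
  obtain a c p q where I: "I = (a, c, p, q)" by (cases I) auto
  have valid_I: "valid_node L6 L (G, I, ws, fs)" using valid N unfolding list_all_iff by blast
  have "\<not> (p \<le> 0 \<and> 0 < q)"
  proof
    assume pq: "p \<le> 0 \<and> 0 < q"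
    have "of_int q * s \<le> of_int p" using G(2) I by auto
    moreover have "0 < of_int q * s" "real_of_int p \<le> 0" using pq s by auto
    ultimately show False by linarith
  qed
  with valid_I I have q: "0 \<le> q" and ws: "\<forall>w \<in> set ws. length w = length G" and fates:
    "list_all2 (valid_fate L6 L G I)
       (filter (max_degree_row (degrees G))
      (rows_in (length G) (map (half_space G I) ws))) fs"
    by (auto simp: I list_all_iff simp del: valid_fate.simps)
  have "b \<in> set (rows_in (length G) (map (half_space G I) ws))"
    using half_space_sound[OF realizes G(2)] ws q I len by (intro rows_in_complete) fastforce+
  moreover have "max_degree_row (degrees G) b"
  proof -
    have "degrees (b # G) = map (\<lambda>x. int (deg x)) (v # xs)"
      using degrees_realizes[OF realizes s] unfolding set deg_def by simp
    moreover have "map (\<lambda>_. 1 :: int) G = map (\<lambda>_. 1) b" using len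
      by (simp add: map_replicate_const)
    ultimately have "select_sum b (map (\<lambda>_. 1) b) = int (deg v)"
      "add_row b 1 (degrees G) = map (\<lambda>x. int (deg x)) xs"
      by (auto simp: degrees_def)
    then show ?thesis using v(2) set by (auto simp: max_degree_row_def list_all_iff)
  qed
  ultimately have "b \<in> set (filter (max_degree_row (degrees G))
      (rows_in (length G) (map (half_space G I) ws)))"
    by simp
  then obtain f where f: "valid_fate L6 L G I b f"
    using fates by (metis in_set_conv_nth list_all2_conv_all_nth)
  show "\<exists>(H, J) \<in> set L. in_range s J \<and> (\<exists>xs. set xs = X \<and> realizes s H xs)"
  proof (cases f)
    case (Iso r p)
    with f have r: "r < length L" "L ! r = (relabel (b # G) p, I)"
      and p: "distinct p" "length p = length (v # xs)"
      "\<forall>i \<in> set p. i < length (v # xs)" using len by (auto simp: list_all_iff)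
    have "set p = {..<length (v # xs)}"
      using p by (intro card_subset_eq) (auto simp: distinct_card)
    then have "set (map ((!) (v # xs)) p) = (!) (v # xs) ` {0..<length (v # xs)}"
      by (simp only: set_map atLeast0LessThan)
    also have "\<dots> = set (v # xs)" by (simp only: nth_image[OF order_refl] take_all[OF order_refl])
    finally have "set (map ((!) (v # xs)) p) = set (v # xs)" .
    moreover have "realizes s (relabel (b # G) p) (map ((!) (v # xs)) p)"
      using realizes_relabel[OF realizes p(1,3)] .
    moreover have "(relabel (b # G) p, I) \<in> set L" using r by (metis nth_mem)
    ultimately show ?thesis using G(2) set by blast
  next
    case (Sub r p)
    with f obtain H J where H: "(H, J) \<in> set L6" "H = relabel (b # G) p" "disjoint_ranges I J"
      "distinct p"
      "\<forall>i \<in> set p. i < length (v # xs)" using len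
        by (auto simp: list_all_iff split: prod.splits) (metis nth_mem)
    have "in_range s J" using L6[OF H(1) _ s] realizes_relabel[OF realizes H(4,5)] H(2) by blast
    with disjoint_ranges_sound[OF H(3) G(2)] show ?thesis by blast
  qed
qed

lemma covers_refine:
  assumes "covers 6 (unbounded N)" "list_all2 valid_range (bare N) ws"
  shows "covers 6 (bare N)"
    "(H, J) \<in> set (bare N) \<Longrightarrow> realizes s H (ys :: (real ^ 4) list) \<Longrightarrow> s > 0 \<Longrightarrow> in_range s J"
proof -
  show R: "in_range s J" if HJ: "(H, J) \<in> set (bare N)" and c: "realizes s H ys" and s: "s > 0"
    for H J s and ys :: "(real ^ 4) list"
  proof -
    obtain w where "valid_range (H, J) w"
      using assms(2) HJ by (metis in_set_conv_nth list_all2_conv_all_nth)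
    from valid_range_sound[OF this c s] show ?thesis .
  qed
  show "covers 6 (bare N)"
    unfolding covers_def
  proof (intro allI impI)
    fix s :: real and X :: "(real ^ 4) set"
    assume s: "s > 0" and X: "spread s X \<and> card X = 6"
    then obtain G xs I where G: "(G, I) \<in> set (unbounded N)" "set xs = X" "realizes s G xs"
      using assms(1) unfolding covers_def by blast
    then obtain J where J: "(G, J) \<in> set (bare N)" by (force simp: unbounded_def bare_def)
    from R[OF J G(3) s] J G
    show "\<exists>(H, J) \<in> set (bare N). in_range s J \<and> (\<exists>xs. set xs = X \<and> realizes s H xs)"
      by blast
  qed
qed

lemma covers_1: "covers 1 [([[]], (0, 1, 1, 0))]"
  unfolding covers_def
proof (intro allI impI)
  fix s :: real and X :: "(real ^ 4) set"
  assume "s > 0" "spread s X \<and> card X = 1"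
  then obtain x where x: "X = {x}" by (auto simp: card_Suc_eq dest!: card_1_singletonE)
  have "realizes s [[]] [x]" by simp
  then show "\<exists>(H, J) \<in> set [([[]], (0, 1, 1, 0))]. in_range s J \<and>
      (\<exists>xs. set xs = X \<and> realizes s H xs)"
    using x \<open>s > 0\<close> by (auto intro!: exI[of _ "[x]"])
qed

section \<open>Congruence of realizations\<close>

text \<open>
  The reflection in the perpendicular bisector of \<open>y\<close> and \<open>z\<close>.
\<close>

lemma reflection_between:
  fixes y z :: "'a::euclidean_space"
  obtains R where "isometry R" "R z = y" "\<And>w. dist w z = dist w y \<Longrightarrow> R w = w"
proof (cases "y = z")
  case True
  have "isometry (id :: 'a \<Rightarrow> 'a)" by (simp add: isometry_def)
  with True show ?thesis using that[of id] by simp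
next
  case False
  define n m where "n = z - y" and "m = (1/2) *\<^sub>R (z + y)"
  define R where "R w = w - (2 * ((w - m) \<bullet> n) / (n \<bullet> n)) *\<^sub>R n" for w
  have nn: "n \<bullet> n \<noteq> 0" using False by (simp add: n_def)
  show ?thesis
  proof
    show "isometry R"
      unfolding isometry_def
    proof (intro allI)
      fix p q
      define v k where "v = p - q" and "k = 2 * (v \<bullet> n) / (n \<bullet> n)"
      have "2 * ((p - m) \<bullet> n) / (n \<bullet> n) = 2 * ((q - m) \<bullet> n) / (n \<bullet> n) + k"
        by (simp add: v_def k_def inner_diff_left diff_divide_distrib)
      then have "R p - R q = v - k *\<^sub>R n"
        unfolding R_def by (simp add: v_def scaleR_add_left)
      moreover have "k * (n \<bullet> n) = 2 * (v \<bullet> n)" using nn by (simp add: k_def)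
      then have "k * (k * (n \<bullet> n)) = 2 * (k * (v \<bullet> n))" by simp
      then have "(v - k *\<^sub>R n) \<bullet> (v - k *\<^sub>R n) = v \<bullet> v"
        by (simp add: inner_diff_left inner_diff_right inner_commute)
      ultimately have "norm (R p - R q) = norm v" by (simp add: norm_eq_sqrt_inner)
      then show "dist (R p) (R q) = dist p q" by (simp add: dist_norm v_def)
    qed
    have "z - m = (1/2) *\<^sub>R n"
      by (simp add: n_def m_def algebra_simps) (metis scaleR_half_double scaleR_add_right)
    then have "2 * ((z - m) \<bullet> n) = n \<bullet> n" by simp
    then show "R z = y" using nn by (simp add: R_def n_def)
    fix w assume "dist w z = dist w y"
    then have "(w - z) \<bullet> (w - z) = (w - y) \<bullet> (w - y)" by (simp add: dist_norm norm_eq_sqrt_inner)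
    then have "(w - m) \<bullet> n = 0"
      by (simp add: n_def m_def inner_diff_left inner_diff_right inner_add_left inner_add_right
        inner_commute)
    then show "R w = w" by (simp add: R_def)
  qed
qed

text \<open>
  Extend an isometry to one more point by composing it with a reflection: the bisector that moves
  the image of the point to its target contains all earlier targets, since these have equal
  distances to both.
\<close>

lemma realizes_congruent:
  fixes xs ys :: "'a::euclidean_space list"
  assumes "realizes s G xs" "realizes s G ys"
  obtains f where "isometry f" "map f xs = ys"
proof -
  have "\<exists>f. isometry f \<and> map f xs = ys"
    using assms
  proof (induction s G xs arbitrary: ys rule: realizes.induct)
    case (1 s)
    then show ?case by (cases ys) (auto simp: isometry_def intro: exI[of _ id])
  next
    case (2 s b G x xs)
    then obtain y ys' where ys: "ys = y # ys'" by (cases ys) auto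
    with 2 obtain f where f: "isometry f" "map f xs = ys'" by auto
    obtain R where R: "isometry R" "R (f x) = y" "\<And>w. dist w (f x) = dist w y \<Longrightarrow> R w = w"
      using reflection_between[where y = y and z = "f x"] by blast
    have "R (f u) = f u" if u: "u \<in> set xs" for u
    proof (rule R(3))
      obtain i where i: "i < length xs" "u = xs ! i" using u by (auto simp: in_set_conv_nth)
      have "(dist x (xs ! i))\<^sup>2 = s + of_bool (b ! i)" "(dist y (ys' ! i))\<^sup>2 = s + of_bool (b ! i)"
        using 2(2,3) i ys by (auto simp: list_all2_conv_all_nth)
      then have "dist x (xs ! i) = dist y (ys' ! i)"
        by (metis power2_eq_imp_eq zero_le_dist)
      moreover have "dist (f x) (f u) = dist x u" using f by (simp add: isometry_def)
      moreover have "ys' ! i = f u" using i f by auto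
      ultimately show "dist (f u) (f x) = dist (f u) y" using i by (simp add: dist_commute)
    qed
    then have "map (R \<circ> f) (x # xs) = ys" using f R ys by auto
    moreover have "isometry (R \<circ> f)" using f R by (simp add: isometry_def)
    ultimately show ?case by blast
  qed auto
  then show ?thesis using that by blast
qed

section \<open>Counting similarity classes\<close>

lemma realizes_row_distance:
  assumes "realizes s G xs" "c \<in> set G" "e \<in> set c"
  shows "\<exists>x\<in>set xs. \<exists>y\<in>set xs. (dist x y)\<^sup>2 = s + of_bool e"
  using assms
proof (induction s G xs rule: realizes.induct)
  case (2 s b G x xs)
  show ?case
  proof (cases "c = b")
    case True
    with 2(4) obtain i where i: "i < length b" "b ! i = e" by (auto simp: in_set_conv_nth)
    then have "(dist x (xs ! i))\<^sup>2 = s + of_bool e" "xs ! i \<in> set xs"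
      using 2(2) by (auto simp: list_all2_conv_all_nth)
    then show ?thesis by auto
  qed (use 2 in auto)
qed auto

definition mixed :: "graph \<Rightarrow> bool" where
  "mixed G \<longleftrightarrow> list_ex (list_ex (\<lambda>e. e)) G \<and> list_ex (list_ex Not) G"

lemma realizes_distances:
  assumes "realizes s G xs" "s > 0" "mixed G"
  shows "distances (set xs) = {sqrt s, sqrt (s + 1)}"
proof
  show "distances (set xs) \<subseteq> {sqrt s, sqrt (s + 1)}"
  proof
    fix d assume "d \<in> distances (set xs)"
    then obtain x y where d: "d = dist x y" "x \<in> set xs" "y \<in> set xs" "x \<noteq> y"
      by (auto simp: distances_def)
    then obtain i j where ij: "i < length xs" "j < length xs" "x = xs ! i" "y = xs ! j"
      by (auto simp: in_set_conv_nth)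
    then have "i \<noteq> j" using d by auto
    then have "(dist x y)\<^sup>2 = s + of_bool (adj G i j)" using realizes_adj[OF assms(1) ij(1,2)] ij
      by simp
    then have "d = sqrt (s + of_bool (adj G i j))" using d by (simp add: real_sqrt_unique)
    then show "d \<in> {sqrt s, sqrt (s + 1)}" by auto
  qed
  have "sqrt (s + of_bool e) \<in> distances (set xs)" for e
  proof -
    have "\<exists>c\<in>set G. e \<in> set c" using assms(3) by (cases e) (auto simp: mixed_def list_ex_iff)
    then obtain x y where xy: "x \<in> set xs" "y \<in> set xs" "(dist x y)\<^sup>2 = s + of_bool e"
      using realizes_row_distance[OF assms(1)] by blast
    moreover have "x \<noteq> y" using xy(3) assms(2) by (auto simp: of_bool_def split: if_splits)
    moreover have "sqrt (s + of_bool e) = dist x y" using xy(3) by (simp add: real_sqrt_unique)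
    ultimately show ?thesis by (auto simp: distances_def)
  qed
  from this[of False] this[of True] show "{sqrt s, sqrt (s + 1)} \<subseteq> distances (set xs)" by simp
qed

lemma distances_similar:
  fixes X :: "'a::euclidean_space set"
  assumes "isometry f" "c > 0"
  shows "distances (f ` (\<lambda>x. c *\<^sub>R x) ` X) = (\<lambda>d. c * d) ` distances X"
proof -
  have D: "dist (f (c *\<^sub>R x)) (f (c *\<^sub>R y)) = c * dist x y" for x y
    using assms by (simp add: isometry_def dist_scaleR_both)
  have "f (c *\<^sub>R x) = f (c *\<^sub>R y) \<longleftrightarrow> x = y" for x y
    using D[of x y] assms(2) by (metis dist_eq_0_iff less_irrefl mult_eq_0_iff)
  with D show ?thesis unfolding distances_def image_def by auto (metis+)
qed

text \<open>
  A similarity with factor \<open>c\<close> multiplies the squared distances by \<open>c\<^sup>2\<close>. As both sets have two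
  of them with difference \<open>1\<close>, this forces \<open>c = 1\<close>, and the similarity is an isometry that
  respects adjacency.
\<close>

lemma realizes_similar_invariant:
  fixes xs ys :: "'a::euclidean_space list"
  assumes G: "realizes s G xs" "s > 0" "mixed G" and H: "realizes t H ys" "t > 0" "mixed H"
    and sim: "similar (set xs) (set ys)"
  shows "invariant G = invariant H"
proof -
  obtain c f where c: "c > 0" and f: "isometry f" and ys: "set ys = f ` (\<lambda>x. c *\<^sub>R x) ` set xs"
    using sim by (auto simp: similar_def)
  have "{sqrt t, sqrt (t + 1)} = {c * sqrt s, c * sqrt (s + 1)}"
    using distances_similar[OF f c, of "set xs"]
    unfolding ys[symmetric] realizes_distances[OF G] realizes_distances[OF H] by simp
  moreover have "sqrt t < sqrt (t + 1)" "c * sqrt s < c * sqrt (s + 1)" using c by auto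
  ultimately have *: "sqrt t = c * sqrt s" "sqrt (t + 1) = c * sqrt (s + 1)"
    by (metis doubleton_eq_iff less_asym)+
  have "t = c\<^sup>2 * s" using arg_cong[OF *(1), of "\<lambda>u. u\<^sup>2"] G(2) H(2)
    by (simp add: power_mult_distrib)
  moreover have "t + 1 = c\<^sup>2 * (s + 1)" using arg_cong[OF *(2), of "\<lambda>u. u\<^sup>2"] G(2) H(2)
    by (simp add: power_mult_distrib)
  ultimately have "c\<^sup>2 = 1" by (simp add: algebra_simps)
  then have c1: "c = 1" using c by (simp add: power2_eq_1_iff)
  with \<open>t = c\<^sup>2 * s\<close> have st: "s = t" by simp
  have "realizes t G (map f xs)" using realizes_isometry[OF G(1), of f] f st
    by (simp add: isometry_def)
  moreover have "set (map f xs) = set ys" using ys c1 by (simp add: image_image)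
  ultimately show ?thesis
    using invariant_realizes[of t G "map f xs"] invariant_realizes[OF H(1,2)] H(2) by simp
qed

definition realizable :: "graph \<Rightarrow> bool" where
  "realizable G \<longleftrightarrow> (\<exists>s > 0. \<exists>xs :: (real ^ 4) list. realizes s G xs)"

text \<open>
  Sending a graph to the class of one of its realizations is onto because the graph determines
  the scale and then the realization up to isometry, and one-to-one because similar realizations
  have equal invariants.
\<close>

lemma card_two_distance_classes:
  assumes cov: "covers n L" and n: "n \<ge> 6"
    and real: "\<And>G. G \<in> fst ` set L \<Longrightarrow> realizable G \<and> mixed G \<and> length G = n"
    and inv: "distinct (map (invariant \<circ> fst) L)"
  shows "card (two_distance_classes n :: (real ^ 4) set set set) = length L"
proof -
  obtain s xs where sx: "\<And>G. G \<in> fst ` set L \<Longrightarrow> s G > 0 \<and> realizes (s G) G (xs G :: (real ^ 4) list)"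
    using real unfolding realizable_def by metis
  define C where "C G = similarity `` {set (xs G)}" for G
  have two: "two_distance_set (set (xs G))" "card (set (xs G)) = n" if "G \<in> fst ` set L" for G
  proof -
    show "two_distance_set (set (xs G))"
      using realizes_distances[of "s G" G "xs G"] sx[OF that] real[OF that]
        by (simp add: two_distance_set_def)
    show "card (set (xs G)) = n"
      using sx[OF that] real[OF that] realizes_distinct[of "s G" G "xs G"]
        realizes_length[of "s G" G "xs G"]
      by (simp add: distinct_card)
  qed
  have "two_distance_classes n = C ` fst ` set L"
  proof
    show "C ` fst ` set L \<subseteq> two_distance_classes n"
      using two by (auto simp: two_distance_classes_def C_def intro!: quotientI)
    show "two_distance_classes n \<subseteq> C ` fst ` set L"
    proof
      fix A :: "(real ^ 4) set set" assume "A \<in> two_distance_classes n"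
      then obtain X where X: "two_distance_set X" "card X = n" "A = similarity `` {X}"
        by (auto simp: two_distance_classes_def quotient_def)
      then obtain a b where ab: "distances X = {a, b}" "a < b"
        unfolding two_distance_set_def card_2_iff
          by (metis insert_commute linorder_neqE_linordered_idom)
      have "0 < a" using ab(1) unfolding distances_def
        by (smt (verit) insertI1 mem_Collect_eq zero_less_dist_iff)
      \<comment> \<open>The factor that makes the squares of the two distances differ by one.\<close>
      define c where "c = 1 / sqrt (b\<^sup>2 - a\<^sup>2)"
      have "0 < b\<^sup>2 - a\<^sup>2" using ab(2) \<open>0 < a\<close> by (simp add: power_strict_mono)
      then have c: "c > 0" "c\<^sup>2 * (b\<^sup>2 - a\<^sup>2) = 1" by (simp_all add: c_def power_divide)
      define Y where "Y = (\<lambda>x. c *\<^sub>R x) ` X"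
      have "(dist x y)\<^sup>2 \<in> {c\<^sup>2 * a\<^sup>2, c\<^sup>2 * a\<^sup>2 + 1}" if xy: "x \<in> Y" "y \<in> Y" "x \<noteq> y" for x y
      proof -
        obtain u v where u: "u \<in> X" "v \<in> X" "x = c *\<^sub>R u" "y = c *\<^sub>R v" using xy
          by (auto simp: Y_def)
        then have "dist u v \<in> {a, b}" using xy unfolding ab(1)[symmetric] distances_def by blast
        moreover have "(dist x y)\<^sup>2 = c\<^sup>2 * (dist u v)\<^sup>2" using u
          by (simp add: dist_scaleR_both power_mult_distrib)
        ultimately show ?thesis using c(2) by (auto simp: algebra_simps)
      qed
      then have "spread (c\<^sup>2 * a\<^sup>2) Y"
        using X(1) unfolding spread_def two_distance_set_def Y_def by blast
      moreover have "card Y = n" using X(2) c by (simp add: Y_def card_image inj_on_def)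
      moreover have "0 < c\<^sup>2 * a\<^sup>2" using c \<open>0 < a\<close> by simp
      ultimately obtain G ys I where G: "(G, I) \<in> set L" "set ys = Y" "realizes (c\<^sup>2 * a\<^sup>2) G ys"
        using cov unfolding covers_def by blast
      have GL: "G \<in> fst ` set L" using G(1) by force
      have "length ys \<ge> DIM(real ^ 4) + 2" "length (xs G) \<ge> DIM(real ^ 4) + 2"
        using real[OF GL] n realizes_length[OF G(3)] realizes_length[of "s G" G "xs G"] sx[OF GL]
          by auto
      then have "c\<^sup>2 * a\<^sup>2 = s G"
        using realizes_scale_unique[OF G(3), of "s G" "xs G"]
          realizes_scale_unique[of "s G" G "xs G", OF _ G(3)]
          sx[OF GL] \<open>0 < c\<^sup>2 * a\<^sup>2\<close> by force
      then obtain f where f: "isometry f" "map f ys = xs G"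
        using realizes_congruent[OF G(3), of "xs G"] sx[OF GL] by metis
      then have "set (xs G) = f ` Y" using G(2) by (metis set_map)
      then have "similar X (set (xs G))" using f c unfolding similar_def Y_def by blast
      then have "A = C G" unfolding X(3) C_def
        by (intro equiv_class_eq[OF equiv_similarity]) (simp add: similarity_def)
      with GL show "A \<in> C ` fst ` set L" by blast
    qed
  qed
  moreover have "inj_on C (fst ` set L)"
  proof (rule inj_onI)
    fix G H assume GH: "G \<in> fst ` set L" "H \<in> fst ` set L" "C G = C H"
    then have "(set (xs G), set (xs H)) \<in> similarity"
      unfolding C_def by (metis UNIV_I eq_equiv_class equiv_similarity)
    then have "invariant G = invariant H"
      using realizes_similar_invariant[of "s G" G "xs G" "s H" H "xs H"]
        sx[OF GH(1)] sx[OF GH(2)] real[OF GH(1)] real[OF GH(2)]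
      by (auto simp: similarity_def)
    with inv GH(1,2) show "G = H" by (auto simp: distinct_map inj_on_def)
  qed
  ultimately have "card (two_distance_classes n :: (real ^ 4) set set set) = card (fst ` set L)"
    by (simp add: card_image)
  also have "\<dots> = length L"
    using inv by (metis (no_types, lifting) card_image distinct_card
        distinct_map length_map list.map_comp set_map)
  finally show ?thesis .
qed

section \<open>Realizations over the field generated by the square root of five\<close>

lemma realizable_relabel:
  assumes "realizable G" "distinct p" "\<forall>i\<in>set p. i < length G"
  shows "realizable (relabel G p)"
proof -
  obtain s and xs :: "(real ^ 4) list" where "s > 0" "realizes s G xs" using assms(1)
    by (auto simp: realizable_def)
  with realizes_relabel[OF this(2) assms(2)] assms(3) realizes_length[of s G xs] show ?thesis
    unfolding realizable_def by metis
qed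

lemma vector_4:
  "(vector [a, b, c, d] :: 'a::zero ^ 4) $ 1 = a" "(vector [a, b, c, d] :: 'a ^ 4) $ 2 = b"
  "(vector [a, b, c, d] :: 'a ^ 4) $ 3 = c" "(vector [a, b, c, d] :: 'a ^ 4) $ 4 = d"
  unfolding vector_def by simp_all

lemma length_4_cases:
  assumes "length xs = 4"
  obtains a b c d where "xs = [a, b, c, d]"
  using assms by (auto simp: numeral_eq_Suc length_Suc_conv)

lemma dist_vector_4:
  "(dist (vector [a, b, c, d] :: real ^ 4) (vector [a', b', c', d']))\<^sup>2 =
     (a - a')\<^sup>2 + (b - b')\<^sup>2 + (c - c')\<^sup>2 + (d - d')\<^sup>2"
  by (simp add: dist_vec_def L2_set_def sum_4 dist_real_def sum_nonneg vector_4)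

text \<open>
  The pair \<open>(a, b)\<close> stands for \<open>a + b \<surd>5\<close>.
\<close>

type_synonym root5 = "int \<times> int"

definition root5_val :: "root5 \<Rightarrow> real" where
  "root5_val x = of_int (fst x) + of_int (snd x) * sqrt 5"

fun root5_pos :: "root5 \<Rightarrow> bool" where
  "root5_pos (a, b) \<longleftrightarrow> 0 < a \<and> 0 \<le> b \<or> 0 < a \<and> 5 * (b * b) < a * a \<or> 0 < b \<and> a * a < 5 * (b * b)"

text \<open>
  One coordinate's contribution \<open>d (x - y)\<^sup>2\<close> to a squared distance, where \<open>d\<close> is the weight of
  the axis.
\<close>

fun root5_term :: "root5 \<Rightarrow> root5 \<Rightarrow> root5 \<Rightarrow> root5" where
  "root5_term (d, e) (a, b) (a', b') =
     (let u = a - a'; v = b - b'; m = u * u + 5 * (v * v); n = 2 * (u * v) in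
       (d * m + 5 * (e * n), d * n + e * m))"

fun root5_dist :: "root5 list \<Rightarrow> root5 list \<Rightarrow> root5 list \<Rightarrow> root5" where
  "root5_dist (d # ds) (x # xs) (y # ys) =
     (case root5_term d x y of (a, b) \<Rightarrow> case root5_dist ds xs ys of (a', b') \<Rightarrow> (a + a', b + b'))"
| "root5_dist _ _ _ = (0, 0)"

fun root5_realizes :: "int \<Rightarrow> root5 \<Rightarrow> root5 list \<Rightarrow> graph \<Rightarrow> root5 list list \<Rightarrow> bool" where
  "root5_realizes m s ds [] [] \<longleftrightarrow> True"
| "root5_realizes m s ds (b # G) (x # xs) \<longleftrightarrow> length x = 4 \<and>
     list_all2 (\<lambda>e y. root5_dist ds x y = (if e then (fst s + m, snd s) else s)) b xs \<and>
     root5_realizes m s ds G xs"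
| "root5_realizes m s ds _ _ \<longleftrightarrow> False"

text \<open>
  In \<open>(G, m, s, ds, xs)\<close> a point \<open>x\<close> of the list \<open>xs\<close> has the \<open>k\<close>-th coordinate \<open>\<surd>(d\<^sub>k / m) x\<^sub>k\<close>,
  and the scale is \<open>s / m\<close>. The weights come from a Cholesky decomposition of the Gram matrix
  without square roots, and \<open>m\<close> clears denominators.
\<close>

type_synonym model = "graph \<times> int \<times> root5 \<times> root5 list \<times> root5 list list"

fun valid_model :: "model \<Rightarrow> bool" where
  "valid_model (G, m, s, ds, xs) \<longleftrightarrow> 0 < m \<and> root5_pos s \<and> length ds = 4 \<and> list_all root5_pos ds \<and>
     root5_realizes m s ds G xs"

lemma root5_pos_val:
  assumes "root5_pos x"
  shows "0 < root5_val x"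
proof -
  obtain a b where x: "x = (a, b)" by (cases x)
  have *: "u < v" if "u * u < v * v" "0 < v" for u v :: real
    using that power2_less_imp_less[of u v] by (simp add: power2_eq_square)
  consider "0 < a" "0 \<le> b" | "0 < a" "5 * (b * b) < a * a" | "0 < b" "a * a < 5 * (b * b)"
    using assms x by auto
  then show ?thesis
  proof cases
    case 1
    then show ?thesis by (simp add: root5_val_def x add_pos_nonneg)
  next
    case 2
    have "real_of_int (5 * (b * b)) < of_int (a * a)" using 2 of_int_less_iff by blast
    then have "(- (of_int b * sqrt 5)) * (- (of_int b * sqrt 5)) < real_of_int a * of_int a"
      by (simp add: algebra_simps)
    from *[OF this] 2 show ?thesis by (simp add: root5_val_def x)
  next
    case 3
    have "real_of_int (a * a) < of_int (5 * (b * b))" using 3 of_int_less_iff by blast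
    then have "(- of_int a) * (- of_int a) < (real_of_int b * sqrt 5) * (of_int b * sqrt 5)"
      by (simp add: algebra_simps)
    from *[OF this] 3 show ?thesis by (simp add: root5_val_def x)
  qed
qed

lemma root5_term_val:
  "root5_val (root5_term d x y) = root5_val d * (root5_val x - root5_val y)\<^sup>2"
proof -
  obtain a b a' b' c e where [simp]: "x = (a, b)" "y = (a', b')" "d = (c, e)"
    by (cases x; cases y; cases d)
  define u v where "u = real_of_int (a - a')" and "v = real_of_int (b - b')"
  define m n where "m = u * u + 5 * (v * v)" and "n = 2 * (u * v)"
  have "root5_val x - root5_val y = u + v * sqrt 5"
    by (simp add: root5_val_def u_def v_def algebra_simps)
  then have "(root5_val x - root5_val y)\<^sup>2 = m + n * sqrt 5"
    by (simp add: m_def n_def power2_eq_square algebra_simps)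
  moreover have "root5_val (root5_term d x y) =
      (of_int c * m + 5 * (of_int e * n)) + (of_int c * n + of_int e * m) * sqrt 5"
    by (simp add: root5_val_def Let_def u_def v_def m_def n_def)
  moreover have "root5_val d = of_int c + of_int e * sqrt 5" by (simp add: root5_val_def)
  moreover have "(of_int c + of_int e * sqrt 5) * (m + n * sqrt 5) =
      (of_int c * m + 5 * (of_int e * n)) + (of_int c * n + of_int e * m) * sqrt 5"
    by (simp add: algebra_simps)
  ultimately show ?thesis by metis
qed

lemma valid_model_realizable:
  assumes "valid_model (G, m, s, ds, xs)"
  shows "realizable G"
proof -
  have v: "0 < m" "root5_pos s" "length ds = 4" "list_all root5_pos ds" "root5_realizes m s ds G xs"
    using assms by auto
  obtain d1 d2 d3 d4 where ds: "ds = [d1, d2, d3, d4]" using length_4_cases[OF v(3)] .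
  define P :: "root5 list \<Rightarrow> real ^ 4" where
    "P x = vector (map2 (\<lambda>d t. sqrt (root5_val d / of_int m) * root5_val t) ds x)" for x
  have pos: "0 < root5_val d / of_int m" if "d \<in> set ds" for d
    using v that root5_pos_val[of d] by (auto simp: list_all_iff)
  have "root5_val (a + a', b + b') = root5_val (a, b) + root5_val (a', b')" for a a' b b'
    by (simp add: root5_val_def algebra_simps)
  then have cons: "root5_val (root5_dist (d # ds) (x # xs) (y # ys)) =
      root5_val d * (root5_val x - root5_val y)\<^sup>2 +
        root5_val (root5_dist ds xs ys)" for d ds x xs y ys
    by (simp add: root5_term_val[symmetric] split: prod.splits)
  have D: "(dist (P x) (P y))\<^sup>2 = root5_val (root5_dist ds x y) / of_int m"
    if l: "length x = 4" "length y = 4" for x y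
  proof -
    obtain x1 x2 x3 x4 where x: "x = [x1, x2, x3, x4]" using length_4_cases[OF l(1)] .
    obtain y1 y2 y3 y4 where y: "y = [y1, y2, y3, y4]" using length_4_cases[OF l(2)] .
    have coordinate: "(sqrt (root5_val d / of_int m) * t - sqrt (root5_val d / of_int m) * u)\<^sup>2 =
        root5_val d * (t - u)\<^sup>2 / of_int m" if "d \<in> set ds" for d t u
      using pos[OF that] unfolding right_diff_distrib[symmetric] power_mult_distrib by simp
    have "root5_val (root5_dist [] [] []) = 0" by (simp add: root5_val_def)
    then have "root5_val (root5_dist ds x y) = root5_val d1 * (root5_val x1 - root5_val y1)\<^sup>2 +
        root5_val d2 * (root5_val x2 - root5_val y2)\<^sup>2 +
          root5_val d3 * (root5_val x3 - root5_val y3)\<^sup>2 +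
        root5_val d4 * (root5_val x4 - root5_val y4)\<^sup>2"
      unfolding ds x y cons by simp
    moreover have "(dist (P x) (P y))\<^sup>2 =
      root5_val d1 * (root5_val x1 - root5_val y1)\<^sup>2 / of_int m +
        root5_val d2 * (root5_val x2 - root5_val y2)\<^sup>2 / of_int m +
        root5_val d3 * (root5_val x3 - root5_val y3)\<^sup>2 / of_int m +
        root5_val d4 * (root5_val x4 - root5_val y4)\<^sup>2 / of_int m"
      unfolding P_def ds x y by (simp add: dist_vector_4 coordinate ds)
    ultimately show ?thesis by (simp add: add_divide_distrib)
  qed
  have four: "list_all (\<lambda>x. length x = 4) xs" if "root5_realizes m s ds G xs" for G xs
    using that by (induction G arbitrary: xs) (case_tac xs; simp)+
  have shift: "root5_val (if e then (fst s + m, snd s) else s) / of_int m =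
    root5_val s / of_int m + of_bool e" for e
    using v(1) by (simp add: root5_val_def field_simps)
  have "realizes (root5_val s / of_int m) G (map P xs)"
    using v(5)
  proof (induction G arbitrary: xs)
    case Nil
    then show ?case by (cases xs) auto
  next
    case (Cons b G)
    then obtain x ys where xs: "xs = x # ys" by (cases xs) auto
    have row: "list_all2 (\<lambda>e y. root5_dist ds x y = (if e then (fst s + m, snd s) else s)) b ys"
      and "length x = 4" "root5_realizes m s ds G ys" using Cons.prems xs by auto
    have "list_all2 (\<lambda>e y. (dist (P x) (P y))\<^sup>2 = root5_val s / of_int m + of_bool e) b ys"
      using row four[OF \<open>root5_realizes m s ds G ys\<close>] \<open>length x = 4\<close>
      by (auto simp: list_all2_conv_all_nth list_all_length D shift simp del: of_bool_eq_iff)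
    with Cons.IH[OF \<open>root5_realizes m s ds G ys\<close>] show ?case
      by (simp add: xs list_all2_map2)
  qed
  moreover have "0 < root5_val s / of_int m" using v root5_pos_val[of s] by simp
  ultimately show ?thesis unfolding realizable_def by blast
qed

section \<open>Realizations with a rotation of order seven\<close>

text \<open>
  The orbit of a point under the rotation of \<open>\<real>\<^sup>4\<close> that turns two orthogonal planes by \<open>2 \<pi> / 7\<close>
  and \<open>4 \<pi> / 7\<close>; the orbit has radii \<open>\<surd>A\<close> and \<open>\<surd>B\<close> in these planes.
\<close>

lemma heptagon_points:
  fixes A B :: real
  assumes "0 \<le> A" "0 \<le> B"
  defines "f \<equiv> \<lambda>d. 2 * A * (1 - cos (d * (2 * pi / 7))) + 2 * B * (1 - cos (2 * d * (2 * pi / 7)))"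
  shows "\<exists>P :: real \<Rightarrow> real ^ 4. \<forall>i j. (dist (P i) (P j))\<^sup>2 = f (i - j)"
proof -
  define t where "t i = i * (2 * pi / 7)" for i
  define P :: "real \<Rightarrow> real ^ 4" where
    "P i = vector [sqrt A * cos (t i), sqrt A * sin (t i), sqrt B * cos (2 * t i),
      sqrt B * sin (2 * t i)]" for i
  have circle: "(sqrt C * cos x - sqrt C * cos y)\<^sup>2 + (sqrt C * sin x - sqrt C * sin y)\<^sup>2 =
    2 * C * (1 - cos (x - y))"
    if "0 \<le> C" for C x y
  proof -
    have "(cos x - cos y)\<^sup>2 + (sin x - sin y)\<^sup>2 = 2 * (1 - cos (x - y))"
      unfolding power2_diff cos_diff using sin_cos_squared_add[of x] sin_cos_squared_add[of y]
        by algebra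
    then show ?thesis using that
      unfolding right_diff_distrib[symmetric] power_mult_distrib real_sqrt_pow2[OF that]
      by (metis distrib_left mult.assoc mult.commute)
  qed
  have "(dist (P i) (P j))\<^sup>2 = f (i - j)" for i j
  proof -
    have "(dist (P i) (P j))\<^sup>2 =
      2 * A * (1 - cos (t i - t j)) + 2 * B * (1 - cos (2 * t i - 2 * t j))"
      unfolding P_def dist_vector_4
        using circle[OF assms(1), of "t i" "t j"] circle[OF assms(2), of "2 * t i" "2 * t j"]
      by linarith
    moreover have "t i - t j = (i - j) * (2 * pi / 7)"
      "2 * t i - 2 * t j = 2 * (i - j) * (2 * pi / 7)"
      unfolding t_def by (simp_all only: left_diff_distrib right_diff_distrib mult.assoc)
    ultimately show ?thesis by (simp only: f_def)
  qed
  then show ?thesis by blast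
qed

text \<open>
  Such an orbit has at most three distances, which belong to the index differences \<open>1\<close>, \<open>2\<close>, \<open>3\<close>
  modulo \<open>7\<close> up to sign.
\<close>

lemma heptagon_realizable:
  fixes e1 e2 e3 :: bool
  assumes "0 \<le> A" "0 \<le> B" "s > 0"
    and "2 * A * (1 - cos (2 * pi / 7)) + 2 * B * (1 - cos (4 * pi / 7)) = s + of_bool e1"
    and "2 * A * (1 - cos (4 * pi / 7)) + 2 * B * (1 - cos (6 * pi / 7)) = s + of_bool e2"
    and "2 * A * (1 - cos (6 * pi / 7)) + 2 * B * (1 - cos (2 * pi / 7)) = s + of_bool e3"
  shows "realizable [[e1, e2, e3, e3, e2, e1], [e1, e2, e3, e3, e2], [e1, e2, e3, e3],
    [e1, e2, e3], [e1, e2], [e1], []]"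
proof -
  define f where "f d =
    2 * A * (1 - cos (d * (2 * pi / 7))) + 2 * B * (1 - cos (2 * d * (2 * pi / 7)))" for d
  obtain P :: "real \<Rightarrow> real ^ 4" where P: "\<And>i j. (dist (P i) (P j))\<^sup>2 = f (i - j)"
    using heptagon_points[OF assms(1,2)] unfolding f_def by blast
  have per: "cos x = cos y" if "x + y = 2 * pi \<or> x + y = 4 * pi" for x y :: real
  proof -
    have "cos (2 * pi - y) = cos y" "cos (4 * pi - y) = cos y"
      using cos_periodic[of "2 * pi - y"] cos_periodic[of "- y"] by (simp_all add: algebra_simps)
    with that show ?thesis by (metis add_diff_cancel_right')
  qed
  have c: "cos (8 * pi / 7) = cos (6 * pi / 7)" "cos (12 * pi / 7) = cos (2 * pi / 7)"
    "cos (16 * pi / 7) = cos (12 * pi / 7)" "cos (20 * pi / 7) = cos (8 * pi / 7)"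
    "cos (24 * pi / 7) = cos (4 * pi / 7)" "cos (10 * pi / 7) = cos (4 * pi / 7)"
    by (rule per; simp add: field_simps)+
  have f: "f 1 = s + of_bool e1" "f 2 = s + of_bool e2" "f 3 = s + of_bool e3"
    "f 4 = s + of_bool e3" "f 5 = s + of_bool e2" "f 6 = s + of_bool e1"
    using assms(4-6) c by (simp_all add: f_def)
  have "realizes s [[e1, e2, e3, e3, e2, e1], [e1, e2, e3, e3, e2], [e1, e2, e3, e3],
    [e1, e2, e3], [e1, e2], [e1], []]
    (map P [6, 5, 4, 3, 2, 1, 0])"
    by (simp add: P f)
  with assms(3) show ?thesis unfolding realizable_def by blast
qed

text \<open>
  A suitable ratio \<open>A : B\<close> makes two of the three distances equal: those of the differences \<open>1\<close>
  and \<open>3\<close> for the seven-cycle, those of \<open>2\<close> and \<open>3\<close> for its complement. Both ratios are positive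
  as \<open>cos (2 \<pi> / 7) > cos (4 \<pi> / 7) > cos (6 \<pi> / 7)\<close>; the divisor \<open>D\<close> makes the difference of the
  two squared distances equal to \<open>1\<close>.
\<close>

lemma heptagons_realizable:
  "realizable [[False, True, False, False, True, False], [False, True, False, False, True],
     [False, True, False, False], [False, True, False], [False, True], [False], []]" (is ?A)
  "realizable [[False, True, True, True, True, False], [False, True, True, True, True],
     [False, True, True, True], [False, True, True], [False, True], [False], []]" (is ?B)
proof -
  define c1 c2 c3 where "c1 = cos (2 * pi / 7)" "c2 = cos (4 * pi / 7)" "c3 = cos (6 * pi / 7)"
  have c: "c3 < c2" "c2 < c1" "c1 < 1"
    using cos_monotone_0_pi[of 0 "2 * pi / 7"] cos_monotone_0_pi[of "2 * pi / 7" "4 * pi / 7"]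
      cos_monotone_0_pi[of "4 * pi / 7" "6 * pi / 7"] unfolding c1_c2_c3_def by simp_all
  show ?A
  proof -
    define D where "D = 2 * ((c1 - c2) * (c1 - c2) + (c1 - c3) * (c2 - c3))"
    have D: "D > 0" unfolding D_def using c by (simp add: add_pos_pos)
    define u where "u = 1 / D"
    have u: "u > 0" "u * D = 1" using D by (simp_all add: u_def)
    define A B where "A = (c1 - c2) * u" "B = (c1 - c3) * u"
    have AB: "A > 0" "B > 0" using c u by (simp_all add: A_B_def)
    define s where "s = 2 * A * (1 - c1) + 2 * B * (1 - c2)"
    have "s > 0" unfolding s_def using AB c by (simp add: add_pos_pos)
    moreover have "2 * A * (1 - c2) + 2 * B * (1 - c3) - s = u * D"
      unfolding s_def A_B_def D_def by (simp add: algebra_simps)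
    moreover have "2 * A * (1 - c3) + 2 * B * (1 - c1) - s = 0"
      unfolding s_def A_B_def by (simp add: algebra_simps)
    ultimately show ?thesis
      using heptagon_realizable[of A B s False True False] AB u
      unfolding s_def c1_c2_c3_def by simp
  qed
  show ?B
  proof -
    define D where "D = 2 * ((c1 - c3) * (c1 - c2) + (c2 - c3) * (c2 - c3))"
    have D: "D > 0" unfolding D_def using c by (simp add: add_pos_pos)
    define u where "u = 1 / D"
    have u: "u > 0" "u * D = 1" using D by (simp_all add: u_def)
    define A B where "A = (c1 - c3) * u" "B = (c2 - c3) * u"
    have AB: "A > 0" "B > 0" using c u by (simp_all add: A_B_def)
    define s where "s = 2 * A * (1 - c1) + 2 * B * (1 - c2)"
    have "s > 0" unfolding s_def using AB c by (simp add: add_pos_pos)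
    moreover have "2 * A * (1 - c2) + 2 * B * (1 - c3) - s = u * D"
      unfolding s_def A_B_def D_def by (simp add: algebra_simps)
    moreover have "2 * A * (1 - c3) + 2 * B * (1 - c1) = 2 * A * (1 - c2) + 2 * B * (1 - c3)"
      unfolding A_B_def by (simp add: algebra_simps)
    ultimately show ?thesis
      using heptagon_realizable[of A B s False True True] AB u
      unfolding s_def c1_c2_c3_def by simp
  qed
qed

section \<open>The lists of graphs\<close>

abbreviation T :: bool where "T \<equiv> True"
abbreviation F :: bool where "F \<equiv> False"

text \<open>
  Up to five vertices there is no bound on the scale, hence no test vector, and the fates just
  say that the next list contains all graphs.
\<close>

definition nodes1 :: "node list" where
  "nodes1 = [
   ([[]], (0, 1, 1, 0), [], [Iso 0 [0,1], Iso 1 [0,1]])]"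

definition nodes2 :: "node list" where
  "nodes2 = [
   ([[F],[]], (0, 1, 1, 0), [], [Iso 0 [0,1,2], Iso 1 [0,2,1], Iso 1 [0,1,2], Iso 2 [0,1,2]]),
   ([[T],[]], (0, 1, 1, 0), [], [Iso 3 [0,1,2]])]"

definition nodes3 :: "node list" where
  "nodes3 = [
   ([[F,F],[F],[]], (0, 1, 1, 0), [], [Iso 0 [0,1,2,3], Iso 1 [0,3,1,2], Iso 1 [0,2,1,3],
     Iso 2 [0,2,3,1], Iso 1 [0,1,2,3], Iso 2 [0,1,3,2], Iso 2 [0,1,2,3], Iso 3 [0,1,2,3]]),
   ([[T,F],[F],[]], (0, 1, 1, 0), [], [Iso 5 [0,1,2,3], Iso 6 [0,2,1,3], Iso 6 [0,1,2,3],
     Iso 4 [0,1,2,3], Iso 7 [0,1,2,3]]),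
   ([[T,T],[F],[]], (0, 1, 1, 0), [], [Iso 8 [0,1,2,3], Iso 9 [0,1,2,3]]),
   ([[T,T],[T],[]], (0, 1, 1, 0), [], [Iso 10 [0,1,2,3]])]"

definition nodes4 :: "node list" where
  "nodes4 = [
   ([[F,F,F],[F,F],[F],[]], (0, 1, 1, 0), [], [Iso 0 [0,1,2,3,4], Iso 1 [0,4,1,2,3],
     Iso 1 [0,3,1,2,4], Iso 2 [0,3,4,1,2], Iso 1 [0,2,1,3,4], Iso 2 [0,2,4,1,3], Iso 2 [0,2,3,1,4],
     Iso 3 [0,2,3,4,1], Iso 1 [0,1,2,3,4], Iso 2 [0,1,4,2,3], Iso 2 [0,1,3,2,4], Iso 3 [0,1,3,4,2],
     Iso 2 [0,1,2,3,4], Iso 3 [0,1,2,4,3], Iso 3 [0,1,2,3,4], Iso 4 [0,1,2,3,4]]),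
   ([[T,F,F],[F,F],[F],[]], (0, 1, 1, 0), [], [Iso 6 [0,1,2,4,3], Iso 6 [0,1,2,3,4],
     Iso 28 [0,3,4,1,2], Iso 7 [0,2,1,4,3], Iso 7 [0,2,1,3,4], Iso 14 [0,2,3,4,1],
     Iso 7 [0,1,2,4,3], Iso 7 [0,1,2,3,4], Iso 14 [0,1,3,4,2], Iso 5 [0,1,2,3,4],
     Iso 8 [0,1,2,4,3], Iso 8 [0,1,2,3,4], Iso 9 [0,1,2,3,4]]),
   ([[T,T,F],[F,F],[F],[]], (0, 1, 1, 0), [], [Iso 20 [3,0,1,2,4], Iso 20 [2,0,1,3,4],
     Iso 10 [0,1,2,3,4], Iso 17 [0,2,3,1,4], Iso 12 [0,1,3,2,4], Iso 12 [0,1,2,3,4],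
     Iso 11 [0,1,2,3,4], Iso 13 [0,1,2,3,4]]),
   ([[T,T,T],[F,F],[F],[]], (0, 1, 1, 0), [], [Iso 15 [0,1,2,3,4], Iso 16 [0,1,2,3,4]]),
   ([[T,T,F],[T,F],[F],[]], (0, 1, 1, 0), [], [Iso 25 [2,3,0,1,4], Iso 25 [1,3,0,2,4],
     Iso 25 [1,2,0,3,4], Iso 18 [0,1,2,3,4], Iso 19 [0,1,2,3,4]]),
   ([[F,F,T],[T,F],[F],[]], (0, 1, 1, 0), [], [Iso 20 [0,3,4,1,2], Iso 20 [0,2,4,1,3],
     Iso 29 [0,2,3,1,4], Iso 30 [0,2,3,4,1], Iso 29 [0,1,4,2,3], Iso 20 [0,1,3,2,4],
     Iso 30 [0,1,4,3,2], Iso 20 [0,1,2,3,4], Iso 30 [0,1,4,2,3], Iso 30 [0,2,3,1,4],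
     Iso 21 [0,1,2,3,4]]),
   ([[T,F,T],[T,F],[F],[]], (0, 1, 1, 0), [], [Iso 22 [0,1,2,3,4], Iso 31 [0,2,3,1,4],
     Iso 31 [0,1,4,2,3], Iso 25 [0,1,2,4,3], Iso 25 [0,2,1,3,4], Iso 23 [0,1,2,3,4]]),
   ([[T,T,T],[T,F],[F],[]], (0, 1, 1, 0), [], [Iso 32 [2,3,0,1,4], Iso 24 [0,1,2,3,4]]),
   ([[F,T,T],[T,T],[F],[]], (0, 1, 1, 0), [], [Iso 32 [0,2,3,4,1], Iso 32 [0,1,3,4,2],
     Iso 32 [0,4,1,2,3], Iso 32 [0,3,1,2,4], Iso 26 [0,1,2,3,4]]),
   ([[T,T,T],[T,T],[F],[]], (0, 1, 1, 0), [], [Iso 27 [0,1,2,3,4]]),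
   ([[T,T,T],[T,T],[T],[]], (0, 1, 1, 0), [], [Iso 33 [0,1,2,3,4]])]"

definition nodes5 :: "node list" where
  "nodes5 = [
   ([[F,F,F,F],[F,F,F],[F,F],[F],[]], (0, 1, 1, 0), [], [Iso 0 [0,1,2,3,4,5],
     Iso 1 [0,5,1,2,3,4], Iso 1 [0,4,1,2,3,5], Iso 2 [0,4,5,1,2,3], Iso 1 [0,3,1,2,4,5],
     Iso 2 [0,3,5,1,2,4], Iso 2 [0,3,4,1,2,5], Iso 3 [0,3,4,5,1,2], Iso 1 [0,2,1,3,4,5],
     Iso 2 [0,2,5,1,3,4], Iso 2 [0,2,4,1,3,5], Iso 3 [0,2,4,5,1,3], Iso 2 [0,2,3,1,4,5],
     Iso 3 [0,2,3,5,1,4], Iso 3 [0,2,3,4,1,5], Iso 4 [0,2,3,4,5,1], Iso 1 [0,1,2,3,4,5],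
     Iso 2 [0,1,5,2,3,4], Iso 2 [0,1,4,2,3,5], Iso 3 [0,1,4,5,2,3], Iso 2 [0,1,3,2,4,5],
     Iso 3 [0,1,3,5,2,4], Iso 3 [0,1,3,4,2,5], Iso 4 [0,1,3,4,5,2], Iso 2 [0,1,2,3,4,5],
     Iso 3 [0,1,2,5,3,4], Iso 3 [0,1,2,4,3,5], Iso 4 [0,1,2,4,5,3], Iso 3 [0,1,2,3,4,5],
     Iso 4 [0,1,2,3,5,4], Iso 4 [0,1,2,3,4,5], Iso 5 [0,1,2,3,4,5]]),
   ([[T,F,F,F],[F,F,F],[F,F],[F],[]], (0, 1, 1, 0), [], [Iso 7 [0,1,2,5,3,4],
     Iso 7 [0,1,2,4,3,5], Iso 75 [0,4,5,1,2,3], Iso 7 [0,1,2,3,4,5], Iso 75 [0,3,5,1,2,4],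
     Iso 75 [0,3,4,1,2,5], Iso 121 [0,3,4,5,1,2], Iso 8 [0,2,1,5,3,4], Iso 8 [0,2,1,4,3,5],
     Iso 19 [0,2,4,5,1,3], Iso 8 [0,2,1,3,4,5], Iso 19 [0,2,3,5,1,4], Iso 19 [0,2,3,4,1,5],
     Iso 26 [0,2,3,4,5,1], Iso 8 [0,1,2,5,3,4], Iso 8 [0,1,2,4,3,5], Iso 19 [0,1,4,5,2,3],
     Iso 8 [0,1,2,3,4,5], Iso 19 [0,1,3,5,2,4], Iso 19 [0,1,3,4,2,5], Iso 26 [0,1,3,4,5,2],
     Iso 6 [0,1,2,3,4,5], Iso 9 [0,1,2,5,3,4], Iso 9 [0,1,2,4,3,5], Iso 10 [0,1,2,4,5,3],
     Iso 9 [0,1,2,3,4,5], Iso 10 [0,1,2,3,5,4], Iso 10 [0,1,2,3,4,5], Iso 11 [0,1,2,3,4,5]]),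
   ([[T,T,F,F],[F,F,F],[F,F],[F],[]], (0, 1, 1, 0), [], [Iso 16 [0,1,2,3,4,5],
     Iso 36 [3,0,1,2,5,4], Iso 36 [3,0,1,2,4,5], Iso 62 [0,3,1,4,5,2], Iso 36 [2,0,1,3,5,4],
     Iso 36 [2,0,1,3,4,5], Iso 62 [0,2,1,4,5,3], Iso 12 [0,1,2,3,4,5], Iso 30 [0,2,3,1,5,4],
     Iso 30 [0,2,3,1,4,5], Iso 31 [0,2,3,1,4,5], Iso 17 [0,1,2,3,4,5], Iso 14 [0,1,3,2,5,4],
     Iso 14 [0,1,3,2,4,5], Iso 27 [0,1,3,4,5,2], Iso 14 [0,1,2,3,5,4], Iso 14 [0,1,2,3,4,5],
     Iso 27 [0,1,2,4,5,3], Iso 13 [0,1,2,3,4,5], Iso 15 [0,1,2,3,5,4], Iso 15 [0,1,2,3,4,5],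
     Iso 18 [0,1,2,3,4,5]]),
   ([[T,T,T,F],[F,F,F],[F,F],[F],[]], (0, 1, 1, 0), [], [Iso 22 [0,1,3,4,2,5],
     Iso 22 [0,1,2,4,3,5], Iso 22 [0,1,2,3,4,5], Iso 20 [0,1,2,3,4,5], Iso 24 [0,1,2,3,4,5],
     Iso 23 [0,1,3,4,2,5], Iso 23 [0,1,2,4,3,5], Iso 23 [0,1,2,3,4,5], Iso 21 [0,1,2,3,4,5],
     Iso 25 [0,1,2,3,4,5]]),
   ([[T,T,T,T],[F,F,F],[F,F],[F],[]], (0, 1, 1, 0), [], [Iso 28 [0,1,2,3,4,5],
     Iso 29 [0,1,2,3,4,5]]),
   ([[T,T,F,F],[T,F,F],[F,F],[F],[]], (0, 1, 1, 0), [], [Iso 115 [1,2,3,0,4,5],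
     Iso 48 [3,0,1,2,4,5], Iso 48 [2,0,1,3,4,5], Iso 51 [2,3,0,1,5,4], Iso 51 [2,3,0,1,4,5],
     Iso 34 [0,2,3,1,4,5], Iso 48 [1,0,2,3,4,5], Iso 51 [1,3,0,2,5,4], Iso 51 [1,3,0,2,4,5],
     Iso 34 [0,1,3,2,4,5], Iso 51 [1,2,0,3,5,4], Iso 51 [1,2,0,3,4,5], Iso 34 [0,1,2,3,4,5],
     Iso 32 [0,1,2,3,4,5], Iso 33 [0,1,2,3,5,4], Iso 33 [0,1,2,3,4,5], Iso 35 [0,1,2,3,4,5]]),
   ([[F,F,T,F],[T,F,F],[F,F],[F],[]], (0, 1, 1, 0), [], [Iso 38 [0,1,2,3,4,5],
     Iso 122 [0,4,1,5,2,3], Iso 122 [0,3,2,5,1,4], Iso 36 [0,3,4,1,2,5], Iso 52 [0,3,4,5,1,2],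
     Iso 122 [0,2,3,5,1,4], Iso 36 [0,2,4,1,3,5], Iso 52 [0,2,4,5,1,3], Iso 76 [0,2,3,1,4,5],
     Iso 123 [0,2,3,5,1,4], Iso 77 [0,2,3,4,1,5], Iso 108 [0,2,3,4,5,1], Iso 122 [0,1,4,5,2,3],
     Iso 76 [0,1,4,2,3,5], Iso 123 [0,1,4,5,2,3], Iso 36 [0,1,3,2,4,5], Iso 52 [0,1,3,5,2,4],
     Iso 77 [0,1,4,3,2,5], Iso 108 [0,1,4,3,5,2], Iso 36 [0,1,2,3,4,5], Iso 52 [0,1,2,5,3,4],
     Iso 77 [0,1,4,2,3,5], Iso 108 [0,1,4,2,5,3], Iso 77 [0,2,3,1,4,5], Iso 108 [0,2,3,1,5,4],
     Iso 37 [0,1,2,3,4,5], Iso 39 [0,1,2,3,4,5]]),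
   ([[T,F,T,F],[T,F,F],[F,F],[F],[]], (0, 1, 1, 0), [], [Iso 94 [1,4,0,2,3,5],
     Iso 94 [2,3,0,1,4,5], Iso 40 [0,1,2,3,4,5], Iso 82 [0,3,4,1,2,5], Iso 43 [0,2,1,4,3,5],
     Iso 109 [2,0,3,1,5,4], Iso 78 [0,2,3,1,4,5], Iso 79 [0,2,3,4,1,5], Iso 109 [1,0,4,2,5,3],
     Iso 43 [0,1,2,3,4,5], Iso 78 [0,1,4,2,3,5], Iso 79 [0,1,4,3,2,5], Iso 42 [0,1,2,3,4,5],
     Iso 51 [0,1,2,4,3,5], Iso 63 [0,1,2,4,5,3], Iso 51 [0,2,1,3,4,5], Iso 63 [0,2,1,3,5,4],
     Iso 41 [0,1,2,3,4,5], Iso 44 [0,1,2,3,4,5]]),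
   ([[T,T,T,F],[T,F,F],[F,F],[F],[]], (0, 1, 1, 0), [], [Iso 70 [3,1,0,2,4,5],
     Iso 70 [2,1,0,3,4,5], Iso 95 [2,3,0,1,4,5], Iso 83 [2,3,0,1,4,5], Iso 81 [0,2,3,1,4,5],
     Iso 53 [1,0,3,4,2,5], Iso 53 [1,0,2,4,3,5], Iso 46 [0,1,2,3,4,5], Iso 45 [0,1,2,3,4,5],
     Iso 47 [0,1,2,3,4,5]]),
   ([[T,T,T,T],[T,F,F],[F,F],[F],[]], (0, 1, 1, 0), [], [Iso 49 [0,1,2,3,4,5],
     Iso 50 [0,1,2,3,4,5]]),
   ([[F,T,T,F],[T,T,F],[F,F],[F],[]], (0, 1, 1, 0), [], [Iso 64 [3,4,0,1,2,5],
     Iso 96 [2,4,0,1,3,5], Iso 96 [2,3,0,1,4,5], Iso 83 [0,2,3,4,1,5], Iso 84 [0,2,3,4,1,5],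
     Iso 96 [1,4,0,2,3,5], Iso 96 [1,3,0,2,4,5], Iso 83 [0,1,3,4,2,5], Iso 84 [0,1,3,4,2,5],
     Iso 64 [1,2,0,3,4,5], Iso 83 [0,4,1,2,3,5], Iso 84 [0,4,1,2,3,5], Iso 83 [0,3,1,2,4,5],
     Iso 84 [0,3,1,2,4,5], Iso 54 [0,1,2,3,4,5], Iso 55 [0,1,2,3,4,5]]),
   ([[T,T,T,F],[T,T,F],[F,F],[F],[]], (0, 1, 1, 0), [], [Iso 144 [1,2,3,4,0,5],
     Iso 85 [2,0,3,4,1,5], Iso 85 [1,0,3,4,2,5], Iso 67 [1,2,0,4,3,5], Iso 67 [1,2,0,3,4,5],
     Iso 56 [0,1,2,3,4,5], Iso 57 [0,1,2,3,4,5]]),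
   ([[T,T,F,T],[T,T,F],[F,F],[F],[]], (0, 1, 1, 0), [], [Iso 116 [3,1,2,0,4,5],
     Iso 110 [2,0,3,1,4,5], Iso 110 [1,0,3,2,5,4], Iso 59 [0,1,2,3,4,5], Iso 67 [0,1,2,3,5,4],
     Iso 67 [0,2,1,3,4,5], Iso 60 [0,1,2,3,4,5]]),
   ([[T,T,T,T],[T,T,F],[F,F],[F],[]], (0, 1, 1, 0), [], [Iso 71 [2,0,1,3,4,5],
     Iso 61 [0,1,2,3,4,5]]),
   ([[T,T,T,F],[F,F,T],[F,F],[F],[]], (0, 1, 1, 0), [], [Iso 128 [0,1,3,4,2,5],
     Iso 70 [2,0,1,5,4,3], Iso 70 [2,0,1,5,3,4], Iso 64 [0,1,2,3,4,5], Iso 69 [0,2,1,5,3,4],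
     Iso 129 [0,1,3,4,2,5], Iso 53 [0,1,2,4,5,3], Iso 53 [0,1,2,3,5,4], Iso 65 [0,1,2,3,4,5],
     Iso 66 [0,1,2,3,4,5]]),
   ([[F,T,T,T],[T,T,T],[F,F],[F],[]], (0, 1, 1, 0), [], [Iso 72 [0,1,2,3,4,5],
     Iso 154 [0,2,3,4,5,1], Iso 154 [0,1,3,4,5,2], Iso 71 [0,1,2,4,5,3], Iso 71 [0,1,2,3,5,4],
     Iso 71 [0,1,2,3,4,5], Iso 73 [0,1,2,3,4,5]]),
   ([[T,T,T,T],[T,T,T],[F,F],[F],[]], (0, 1, 1, 0), [], [Iso 74 [0,1,2,3,4,5]]),
   ([[T,T,F,T],[F,T,F],[T,F],[F],[]], (0, 1, 1, 0), [], [Iso 116 [3,0,4,1,2,5],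
     Iso 116 [2,0,4,1,3,5], Iso 86 [0,1,2,3,4,5], Iso 144 [0,4,2,3,1,5], Iso 145 [0,4,2,3,1,5],
     Iso 110 [0,1,3,4,5,2], Iso 110 [0,1,2,4,5,3], Iso 114 [0,1,2,3,5,4], Iso 85 [0,1,2,3,4,5],
     Iso 87 [0,1,2,3,4,5]]),
   ([[T,T,T,F],[T,T,F],[T,F],[F],[]], (0, 1, 1, 0), [], [Iso 112 [2,3,4,0,1,5],
     Iso 112 [1,3,4,0,2,5], Iso 112 [1,2,4,0,3,5], Iso 112 [1,2,3,0,4,5], Iso 88 [0,1,2,3,4,5],
     Iso 89 [0,1,2,3,4,5]]),
   ([[T,T,T,T],[T,T,F],[T,F],[F],[]], (0, 1, 1, 0), [], [Iso 152 [2,3,4,0,1,5],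
     Iso 93 [0,1,2,3,4,5]]),
   ([[T,T,F,F],[F,F,T],[T,F],[F],[]], (0, 1, 1, 0), [], [Iso 58 [0,2,3,1,4,5],
     Iso 150 [0,3,4,1,5,2], Iso 150 [0,2,5,1,4,3], Iso 70 [0,2,3,5,1,4], Iso 70 [0,3,2,4,1,5],
     Iso 68 [0,2,3,4,5,1], Iso 97 [0,1,2,3,4,5], Iso 96 [0,1,3,2,5,4], Iso 138 [0,3,1,4,2,5],
     Iso 140 [0,3,1,4,5,2], Iso 138 [0,2,1,5,3,4], Iso 96 [0,1,2,3,4,5], Iso 140 [0,2,1,5,4,3],
     Iso 95 [0,1,2,3,4,5], Iso 111 [0,1,2,3,5,4], Iso 111 [0,1,3,2,4,5], Iso 98 [0,1,2,3,4,5]]),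
   ([[T,T,T,T],[F,F,T],[T,F],[F],[]], (0, 1, 1, 0), [], [Iso 101 [0,1,2,3,4,5],
     Iso 102 [0,1,2,3,4,5]]),
   ([[F,F,T,T],[T,F,T],[T,F],[F],[]], (0, 1, 1, 0), [], [Iso 116 [0,3,4,5,1,2],
     Iso 116 [0,2,5,4,1,3], Iso 147 [0,2,3,5,1,4], Iso 147 [0,3,2,4,1,5], Iso 151 [0,2,3,4,5,1],
     Iso 147 [0,1,4,5,2,3], Iso 116 [0,1,5,3,2,4], Iso 147 [0,4,1,3,2,5], Iso 151 [0,1,4,3,5,2],
     Iso 147 [0,5,1,2,3,4], Iso 116 [0,1,4,2,3,5], Iso 151 [0,1,5,2,4,3], Iso 116 [0,2,3,1,4,5],
     Iso 151 [0,2,5,1,3,4], Iso 151 [0,3,4,1,2,5], Iso 103 [0,1,2,3,4,5]]),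
   ([[T,T,T,T],[T,F,T],[T,F],[F],[]], (0, 1, 1, 0), [], [Iso 117 [2,3,0,1,4,5],
     Iso 106 [0,1,2,3,4,5]]),
   ([[T,T,T,T],[T,T,T],[T,F],[F],[]], (0, 1, 1, 0), [], [Iso 107 [0,1,2,3,4,5]]),
   ([[T,T,T,F],[T,T,F],[F,T],[F],[]], (0, 1, 1, 0), [], [Iso 104 [2,0,3,1,4,5],
     Iso 104 [1,0,3,2,4,5], Iso 141 [1,2,0,4,3,5], Iso 92 [0,3,1,2,4,5], Iso 112 [0,1,2,3,4,5],
     Iso 113 [0,1,2,3,4,5]]),
   ([[T,T,T,T],[F,T,T],[T,T],[F],[]], (0, 1, 1, 0), [], [Iso 118 [0,1,2,3,4,5],
     Iso 119 [0,1,2,3,4,5]]),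
   ([[T,T,T,T],[T,T,T],[T,T],[F],[]], (0, 1, 1, 0), [], [Iso 120 [0,1,2,3,4,5]]),
   ([[T,T,F,F],[F,F,F],[F,F],[T],[]], (0, 1, 1, 0), [], [Iso 115 [0,4,5,1,2,3],
     Iso 94 [3,0,5,1,2,4], Iso 94 [3,0,4,1,2,5], Iso 142 [0,4,5,3,1,2], Iso 94 [2,0,5,1,3,4],
     Iso 94 [2,0,4,1,3,5], Iso 142 [0,4,5,2,1,3], Iso 124 [0,1,2,3,4,5], Iso 130 [0,2,3,1,5,4],
     Iso 130 [0,2,3,1,4,5], Iso 149 [0,4,5,2,3,1], Iso 48 [0,1,4,5,2,3], Iso 109 [0,1,3,5,2,4],
     Iso 109 [0,1,3,4,2,5], Iso 80 [0,1,3,4,5,2], Iso 109 [0,1,2,5,3,4], Iso 109 [0,1,2,4,3,5],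
     Iso 80 [0,1,2,4,5,3], Iso 125 [0,1,2,3,4,5], Iso 126 [0,1,2,3,5,4], Iso 126 [0,1,2,3,4,5],
     Iso 127 [0,1,2,3,4,5]]),
   ([[T,T,F,F],[T,F,F],[F,F],[T],[]], (0, 1, 1, 0), [], [Iso 90 [0,4,1,2,3,5],
     Iso 99 [0,3,4,1,2,5], Iso 99 [0,2,4,1,3,5], Iso 138 [2,3,0,1,5,4], Iso 138 [2,3,0,1,4,5],
     Iso 133 [0,2,3,1,4,5], Iso 99 [0,1,4,2,3,5], Iso 138 [1,3,0,2,5,4], Iso 138 [1,3,0,2,4,5],
     Iso 133 [0,1,3,2,4,5], Iso 138 [1,2,0,3,5,4], Iso 138 [1,2,0,3,4,5], Iso 133 [0,1,2,3,4,5],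
     Iso 131 [0,1,2,3,4,5], Iso 132 [0,1,2,3,5,4], Iso 132 [0,1,2,3,4,5], Iso 134 [0,1,2,3,4,5]]),
   ([[T,T,T,F],[T,F,F],[F,F],[T],[]], (0, 1, 1, 0), [], [Iso 91 [0,4,1,3,2,5],
     Iso 91 [0,4,1,2,3,5], Iso 147 [2,3,0,1,4,5], Iso 144 [2,3,0,1,4,5], Iso 143 [0,2,3,1,4,5],
     Iso 100 [0,1,4,3,2,5], Iso 100 [0,1,4,2,3,5], Iso 136 [0,1,2,3,4,5], Iso 135 [0,1,2,3,4,5],
     Iso 137 [0,1,2,3,4,5]]),
   ([[T,T,F,T],[T,T,F],[F,F],[T],[]], (0, 1, 1, 0), [], [Iso 105 [1,0,4,2,3,5],
     Iso 148 [0,2,4,3,1,5], Iso 148 [0,1,5,3,2,4], Iso 104 [0,1,2,4,5,3], Iso 141 [0,1,2,3,5,4],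
     Iso 141 [0,2,1,3,4,5], Iso 139 [0,1,2,3,4,5]]),
   ([[T,T,T,F],[T,T,F],[F,T],[T],[]], (0, 1, 1, 0), [], [Iso 117 [0,2,3,4,1,5],
     Iso 117 [0,1,3,4,2,5], Iso 146 [0,4,1,2,3,5], Iso 146 [0,3,1,2,4,5], Iso 152 [0,1,2,3,4,5],
     Iso 153 [0,1,2,3,4,5]]),
   ([[T,T,T,T],[T,T,T],[T,T],[T],[]], (0, 1, 1, 0), [], [Iso 155 [0,1,2,3,4,5]])]"

text \<open>
  On six vertices the ranges become effective. Their ends are fractions with small denominators,
  close enough to \<open>\<theta>\<close> for the tests and for the disjointness required by \<open>Sub\<close>; a rational \<open>\<theta>\<close>
  with a small denominator is both ends. The eleven graphs with the range \<open>(0, 1, 0, 1)\<close> are the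
  complete multipartite ones, among them the graph without edges, for which \<open>x \<bullet> A x \<le> 0\<close> on the
  whole hyperplane. Each test vector is a rounded top eigenvector of a graph with one more
  vertex, restricted to the old vertices.
\<close>

definition nodes6 :: "node list" where
  "nodes6 = [
   ([[F,F,F,F,F],[F,F,F,F],[F,F,F],[F,F],[F],[]], (0, 1, 0, 1), [], []),
   ([[T,F,F,F,F],[F,F,F,F],[F,F,F],[F,F],[F],[]], (2, 3, 2, 3), [[9,9,-4,-4,-4,-4],
     [3,3,-2,-2,-2,-2], [2,1,1,-2,-2,-2], [1,2,1,-2,-2,-2], [2,1,-2,1,-2,-2], [1,2,-2,1,-2,-2],
     [2,1,-2,-2,1,-2], [1,2,-2,-2,1,-2], [-2,-1,2,2,2,-1], [1,2,-2,-2,-2,1]], [Sub 4 [0,2,4,5,6,3],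
     Sub 4 [0,2,3,5,6,4], Sub 4 [0,2,3,4,6,5], Sub 4 [0,2,3,4,5,6]]),
   ([[T,T,F,F,F],[F,F,F,F],[F,F,F],[F,F],[F],[]], (5, 7, 8, 11), [[3,2,2,-2,-2,-2],
     [2,1,1,-1,-2,-2], [2,1,1,-2,-1,-2], [2,1,1,-2,-2,-1]], [Sub 3 [0,2,3,6,4,5],
     Sub 3 [0,2,3,5,4,6], Sub 3 [0,2,3,4,5,6], Sub 4 [0,2,3,5,6,4], Sub 4 [0,2,3,4,6,5],
     Sub 4 [0,2,3,4,5,6]]),
   ([[T,T,T,F,F],[F,F,F,F],[F,F,F],[F,F],[F],[]], (3, 5, 13, 21), [[2,1,1,1,-2,-2],
     [4,2,2,2,-5,-7], [4,2,2,2,-7,-5]], [Iso 0 [0,1,3,4,2,6,5], Iso 0 [0,1,3,4,2,5,6],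
     Iso 0 [0,1,2,4,3,6,5], Iso 0 [0,1,2,4,3,5,6], Iso 0 [0,1,2,3,4,6,5], Iso 0 [0,1,2,3,4,5,6]]),
   ([[T,T,T,T,F],[F,F,F,F],[F,F,F],[F,F],[F],[]], (0, 1, 2, 5), [[3,1,1,1,1,-6], [2,1,1,1,1,-7]],
     []),
   ([[T,T,T,T,T],[F,F,F,F],[F,F,F],[F,F],[F],[]], (0, 1, 0, 1), [], []),
   ([[T,T,F,F,F],[T,F,F,F],[F,F,F],[F,F],[F],[]], (1, 1, 1, 1), [[3,3,4,-3,-3,-3],
     [4,4,4,-5,-5,-5]], [Sub 8 [0,3,1,6,4,5], Sub 8 [0,3,1,5,4,6], Sub 8 [0,3,1,4,5,6],
     Sub 8 [0,3,2,6,4,5], Sub 8 [0,3,2,5,4,6], Sub 8 [0,3,2,4,5,6], Sub 8 [0,2,3,6,4,5],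
     Sub 8 [0,2,3,5,4,6], Sub 8 [0,2,3,4,5,6], Sub 10 [0,2,3,5,6,4], Sub 10 [0,2,3,4,6,5],
     Sub 10 [0,2,3,4,5,6]]),
   ([[F,F,T,F,F],[T,F,F,F],[F,F,F],[F,F],[F],[]], (1, 1, 1, 1), [[4,-4,-4,4,1,1],
     [-4,4,4,-4,1,1], [1,1,1,1,-1,-1]], [Iso 1 [0,1,2,3,4,6,5], Iso 1 [0,1,2,3,4,5,6],
     Sub 8 [0,3,2,4,5,6], Sub 8 [0,4,1,6,2,5], Sub 8 [0,4,1,5,2,6], Sub 19 [0,4,5,6,1,2],
     Sub 8 [0,2,3,4,5,6], Sub 8 [0,4,1,6,3,5], Sub 8 [0,4,1,5,3,6], Sub 19 [0,4,5,6,1,3],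
     Sub 8 [1,0,3,4,5,6], Sub 8 [0,3,2,6,4,5], Sub 8 [0,3,2,5,4,6], Sub 19 [0,3,5,6,2,4],
     Sub 8 [1,0,2,4,5,6], Sub 8 [0,2,3,6,4,5], Sub 8 [0,2,3,5,4,6], Sub 19 [0,2,5,6,3,4],
     Sub 9 [0,2,3,4,5,6], Sub 10 [0,2,3,4,6,5], Sub 10 [0,2,3,4,5,6], Sub 11 [0,2,3,4,5,6]]),
   ([[T,F,T,F,F],[T,F,F,F],[F,F,F],[F,F],[F],[]], (3, 5, 13, 21), [[1,3,2,-1,-2,-2],
     [2,0,-1,2,-1,-1], [1,0,-1,1,-1,-1], [0,1,1,-1,-1,-1]], [Iso 2 [0,1,2,3,4,5,6],
     Iso 3 [0,1,2,3,4,6,5], Iso 3 [0,1,2,3,4,5,6], Iso 4 [0,1,2,3,4,6,5], Iso 4 [0,1,2,3,4,5,6],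
     Iso 5 [0,1,2,3,4,5,6]]),
   ([[T,T,T,F,F],[T,F,F,F],[F,F,F],[F,F],[F],[]], (4, 5, 9, 11), [[3,3,3,0,-4,-4],
     [1,1,1,0,-2,-2], [2,4,4,-3,-3,-6], [2,4,4,-3,-6,-3]], [Sub 10 [0,2,3,4,6,5],
     Sub 10 [0,2,3,4,5,6]]),
   ([[T,T,T,T,F],[T,F,F,F],[F,F,F],[F,F],[F],[]], (3, 5, 13, 21), [[1,2,2,-1,-1,-2],
     [1,4,4,-2,-2,-6]], [Sub 20 [0,1,3,4,5,6], Iso 6 [0,1,2,3,5,4,6], Iso 6 [0,1,2,3,4,5,6]]),
   ([[T,T,T,T,T],[T,F,F,F],[F,F,F],[F,F],[F],[]], (3, 5, 13, 21), [], [Sub 28 [0,1,3,4,5,6],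
     Sub 29 [0,1,3,4,5,6]]),
   ([[F,T,T,F,F],[T,T,F,F],[F,F,F],[F,F],[F],[]], (2, 3, 2, 3), [[3,3,3,3,-5,-5],
     [2,2,2,2,-4,-5], [2,2,1,4,-5,-2], [2,2,4,1,-5,-2], [1,4,2,2,-5,-2], [4,1,2,2,-5,-2],
     [2,2,1,4,-2,-5], [2,2,4,1,-2,-5], [1,4,2,2,-2,-5], [4,1,2,2,-2,-5], [2,2,2,2,-5,-4]], []),
   ([[T,T,T,F,F],[T,T,F,F],[F,F,F],[F,F],[F],[]], (5, 6, 7, 8), [[4,4,3,3,-6,-6],
     [1,1,1,1,-3,-3], [3,3,1,3,-5,-4], [3,3,3,1,-5,-4], [3,3,1,3,-4,-5], [3,3,3,1,-4,-5]],
     [Sub 15 [0,2,3,4,6,5], Sub 15 [0,2,3,4,5,6]]),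
   ([[T,T,F,T,F],[T,T,F,F],[F,F,F],[F,F],[F],[]], (3, 5, 13, 21), [[2,2,3,-1,-1,-3],
     [-1,2,1,2,-3,-2], [-2,1,-1,3,-2,2]], [Iso 8 [0,1,2,3,4,5,6], Iso 10 [0,1,2,3,4,5,6],
     Iso 9 [0,1,2,3,4,5,6], Iso 11 [0,1,2,3,4,5,6]]),
   ([[T,T,T,T,F],[T,T,F,F],[F,F,F],[F,F],[F],[]], (3, 5, 13, 21), [[2,3,2,2,-3,-5],
     [1,3,2,2,-3,-6]], [Iso 12 [0,1,2,3,4,5,6]]),
   ([[F,F,F,T,T],[T,T,F,F],[F,F,F],[F,F],[F],[]], (7, 5, 17, 12), [[-7,8,5,5,-5,-5],
     [-8,7,5,5,-5,-5]], [Sub 36 [4,0,2,3,6,5], Sub 36 [4,0,2,3,5,6], Sub 36 [3,0,2,4,6,5],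
     Sub 36 [3,0,2,4,5,6], Sub 31 [0,3,4,2,5,6], Sub 14 [0,2,4,3,6,5], Sub 14 [0,2,4,3,5,6],
     Sub 14 [0,2,3,4,6,5], Sub 14 [0,2,3,4,5,6], Sub 18 [0,2,3,4,5,6]]),
   ([[T,F,F,T,T],[T,T,F,F],[F,F,F],[F,F],[F],[]], (1, 1, 1, 1), [[-3,3,3,3,-3,-4],
     [-3,3,3,4,-3,-3]], [Sub 128 [0,1,5,6,2,4], Sub 30 [0,5,6,1,4,3], Sub 30 [0,5,6,1,3,4],
     Sub 30 [0,3,4,2,6,5], Sub 30 [0,3,4,2,5,6], Sub 14 [0,2,4,3,6,5], Sub 14 [0,2,4,3,5,6],
     Sub 14 [0,2,3,4,6,5], Sub 14 [0,2,3,4,5,6], Sub 18 [0,2,3,4,5,6]]),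
   ([[T,T,T,T,T],[T,T,F,F],[F,F,F],[F,F],[F],[]], (3, 5, 13, 21), [[-1,6,4,4,-6,-6]], []),
   ([[T,T,T,F,F],[F,F,T,F],[F,F,F],[F,F],[F],[]], (3, 4, 7, 9), [[2,-2,2,2,-3,0],
     [2,-4,3,3,-6,1], [7,-2,4,4,-6,-3], [2,1,0,3,-1,-3], [2,1,3,0,-1,-3], [1,-4,3,3,-4,-1]],
     [Sub 21 [0,1,2,3,4,6], Sub 25 [0,1,2,3,4,6]]),
   ([[F,T,T,T,F],[T,T,T,F],[F,F,F],[F,F],[F],[]], (0, 1, 5, 12), [[1,1,1,1,1,-4],
     [1,1,1,1,1,-6]], []),
   ([[T,T,T,T,F],[T,T,T,F],[F,F,F],[F,F],[F],[]], (0, 1, 4, 7), [[2,2,1,1,1,-5], [2,2,1,1,1,-8]],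
     []),
   ([[F,T,T,F,T],[T,T,T,F],[F,F,F],[F,F],[F],[]], (1, 1, 1, 1), [[3,-2,0,0,-3,3],
     [-2,3,0,0,3,-3]], [Iso 25 [4,0,1,2,3,5,6], Iso 25 [3,0,1,2,4,5,6], Sub 24 [0,2,3,4,5,6],
     Sub 20 [0,1,3,4,6,5], Sub 20 [0,2,3,4,5,6], Sub 27 [2,0,5,3,4,6], Sub 23 [0,2,4,5,3,6],
     Sub 23 [0,2,3,5,4,6], Sub 15 [2,0,3,4,5,6], Sub 25 [0,2,3,4,5,6]]),
   ([[T,T,T,F,T],[T,T,T,F],[F,F,F],[F,F],[F],[]], (3, 5, 13, 21), [[2,-6,-1,-1,-4,7],
     [2,-2,0,0,-3,4]], [Iso 13 [0,1,2,4,3,5,6], Iso 13 [0,1,2,3,4,5,6], Sub 25 [0,2,3,4,5,6]]),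
   ([[F,T,T,T,T],[T,T,T,F],[F,F,F],[F,F],[F],[]], (2, 3, 5, 7), [[-3,3,1,1,1,-4],
     [2,-3,-1,-1,-2,4], [-3,2,1,1,-2,-2], [3,-2,-1,2,-1,2], [3,-2,2,-1,-1,2], [-2,3,1,2,1,-4],
     [-2,3,2,1,1,-4], [-1,4,1,1,1,-4]], [Sub 29 [0,1,3,4,5,6]]),
   ([[T,T,T,T,T],[T,T,T,F],[F,F,F],[F,F],[F],[]], (2, 5, 7, 16), [[-1,4,2,2,2,-8]],
     [Sub 28 [0,1,3,4,5,6]]),
   ([[T,T,T,T,F],[F,F,F,T],[F,F,F],[F,F],[F],[]], (5, 6, 13, 15), [[6,-6,4,4,4,-9],
     [1,-4,2,2,2,-4]], [Sub 29 [0,1,2,3,4,5]]),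
   ([[T,T,T,T,F],[T,F,F,T],[F,F,F],[F,F],[F],[]], (3, 4, 4, 5), [[2,-2,0,2,2,-3],
     [2,-5,-1,4,4,-6], [1,-2,-2,2,2,-2]], [Sub 25 [0,1,3,4,5,6]]),
   ([[F,T,T,T,T],[T,T,T,T],[F,F,F],[F,F],[F],[]], (0, 1, 0, 1), [], []),
   ([[T,T,T,T,T],[T,T,T,T],[F,F,F],[F,F],[F],[]], (0, 1, 0, 1), [], []),
   ([[T,T,F,T,F],[F,T,F,F],[T,F,F],[F,F],[F],[]], (2, 3, 13, 19), [[-2,3,3,8,-5,-5],
     [-2,1,1,2,-3,0], [-2,1,1,3,-3,1], [1,2,2,3,-2,-3], [-6,3,3,8,-7,-4]], [Sub 21 [0,1,2,3,5,6],
     Sub 25 [0,1,2,3,5,6]]),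
   ([[T,T,F,T,T],[F,T,F,F],[T,F,F],[F,F],[F],[]], (5, 6, 8, 9), [[-2,1,1,3,-2,-2],
     [-2,2,2,5,-3,-3]], [Sub 24 [1,0,3,5,6,2], Sub 24 [1,0,2,5,6,3], Sub 29 [0,1,2,3,5,6]]),
   ([[T,T,T,F,F],[T,T,F,F],[T,F,F],[F,F],[F],[]], (1, 1, 1, 1), [[3,3,3,3,-5,-5],
     [1,1,1,1,-3,-3]], [Sub 88 [0,1,2,3,4,5], Sub 88 [0,1,2,3,4,6]]),
   ([[T,T,T,T,F],[T,T,F,F],[T,F,F],[F,F],[F],[]], (4, 5, 5, 6), [[1,3,3,3,-4,-5],
     [-1,0,0,0,-1,1]], [Sub 83 [3,4,0,1,5,6], Sub 46 [0,1,3,4,5,6], Sub 45 [0,1,3,4,5,6]]),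
   ([[T,T,F,T,T],[T,T,F,F],[T,F,F],[F,F],[F],[]], (15, 14, 13, 12), [[-1,2,2,2,-2,-2],
     [-4,3,3,5,-4,-4]], [Sub 50 [0,1,2,3,5,6]]),
   ([[T,T,T,T,T],[T,T,F,F],[T,F,F],[F,F],[F],[]], (0, 1, 20, 23), [[-1,4,4,4,-5,-5]], []),
   ([[T,T,F,F,F],[F,F,T,F],[T,F,F],[F,F],[F],[]], (1, 1, 1, 1), [[0,-3,3,3,-4,0],
     [0,-3,3,4,-3,0], [2,3,0,-2,2,-2]], [Iso 7 [0,2,3,1,4,5,6], Iso 14 [0,3,1,5,2,4,6],
     Iso 14 [0,2,1,4,3,5,6], Sub 19 [3,0,1,4,6,5], Sub 14 [0,3,4,1,5,6], Sub 79 [0,2,5,3,1,6],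
     Sub 30 [0,1,4,3,5,6], Sub 43 [0,1,2,5,3,6], Sub 14 [0,3,1,4,5,6], Sub 42 [0,3,1,2,4,6],
     Sub 14 [2,0,1,4,5,6], Sub 42 [0,2,1,3,5,6], Sub 9 [3,0,1,4,5,6], Sub 14 [0,3,1,4,6,5],
     Sub 15 [0,3,1,4,5,6], Sub 18 [0,3,1,4,5,6]]),
   ([[T,T,T,T,F],[F,F,T,F],[T,F,F],[F,F],[F],[]], (1, 1, 1, 1), [[-1,-3,3,3,-4,1],
     [1,-3,3,4,-3,-1]], [Sub 83 [3,4,0,1,5,6], Sub 81 [0,3,4,1,5,6], Sub 45 [0,1,3,4,5,6],
     Sub 47 [0,1,3,4,5,6]]),
   ([[F,F,F,F,T],[F,F,T,F],[T,F,F],[F,F],[F],[]], (1, 1, 1, 1), [[6,-3,-3,-3,-3,7],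
     [-4,0,5,5,1,-4], [2,-4,2,1,-4,1]], [Iso 15 [0,4,5,6,1,2,3], Iso 15 [0,3,5,6,1,2,4],
     Iso 15 [0,2,4,6,1,3,5], Iso 15 [0,2,3,6,1,4,5], Iso 15 [0,1,4,5,2,3,6],
     Iso 15 [0,1,3,5,2,4,6], Iso 15 [0,1,2,4,3,5,6], Iso 15 [0,1,2,3,4,5,6],
     Iso 16 [0,1,2,3,4,5,6]]),
   ([[T,T,T,T,T],[F,F,T,F],[T,F,F],[F,F],[F],[]], (1, 1, 1, 1), [], [Sub 49 [0,1,3,4,5,6],
     Sub 50 [0,1,3,4,5,6]]),
   ([[F,F,T,T,F],[T,F,T,F],[T,F,F],[F,F],[F],[]], (3, 5, 13, 21), [[-1,-1,2,2,-4,1],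
     [-1,-1,2,2,-2,1], [-1,-1,6,6,-4,-3], [1,-2,1,2,-2,-1], [-2,2,2,-1,-1,-1]],
     [Iso 17 [0,1,2,3,4,5,6], Iso 18 [0,1,2,3,4,5,6]]),
   ([[T,T,T,T,F],[T,F,T,F],[T,F,F],[F,F],[F],[]], (3, 5, 13, 21), [[-1,-1,-1,0,0,2],
     [-2,-1,0,1,-2,2], [2,0,1,2,-1,-2]], [Sub 54 [2,0,1,3,5,6], Iso 19 [0,1,2,3,4,5,6],
     Iso 20 [0,1,2,3,4,5,6]]),
   ([[T,T,F,F,T],[T,F,T,F],[T,F,F],[F,F],[F],[]], (3, 5, 13, 21), [[-5,2,2,4,4,-9],
     [0,0,3,2,-2,-2], [-1,2,-1,-1,3,-1]], [Iso 21 [0,1,2,3,4,5,6]]),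
   ([[T,F,T,F,T],[T,F,T,F],[T,F,F],[F,F],[F],[]], (4, 5, 21, 26), [[2,-2,-1,2,-3,3],
     [-2,2,2,-1,3,-3], [1,-2,-2,-1,-1,3], [-1,-1,2,2,-2,-2], [2,-2,1,3,-3,1], [4,-2,-3,0,-3,6],
     [2,-4,0,3,-6,3]], [Sub 116 [4,0,3,1,2,6], Sub 44 [0,2,3,4,5,6]]),
   ([[T,T,T,T,T],[T,F,T,F],[T,F,F],[F,F],[F],[]], (3, 5, 13, 21), [], [Sub 71 [2,0,1,3,5,6],
     Sub 61 [0,1,2,3,5,6]]),
   ([[T,T,T,T,F],[T,T,T,F],[T,F,F],[F,F],[F],[]], (3, 5, 13, 21), [[1,1,1,1,0,-3],
     [1,1,1,1,-1,-4]], []),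
   ([[T,T,T,F,T],[T,T,T,F],[T,F,F],[F,F],[F],[]], (3, 5, 13, 21), [[2,2,2,2,-3,-3],
     [1,-1,0,0,-1,2], [-1,1,0,0,2,-1]], [Iso 23 [0,1,2,3,4,5,6]]),
   ([[T,T,T,T,T],[T,T,T,F],[T,F,F],[F,F],[F],[]], (3, 5, 13, 21), [[-1,3,4,4,-2,-6]],
     [Sub 153 [2,3,4,0,1,5]]),
   ([[T,T,T,F,F],[F,F,T,T],[T,F,F],[F,F],[F],[]], (11, 8, 18, 13), [[5,-8,8,9,-7,-6],
     [2,-3,3,3,-3,-3], [3,-5,6,6,-4,-5]], [Sub 128 [0,2,5,6,1,4], Sub 79 [2,0,6,1,4,5],
     Sub 79 [2,0,5,1,4,6], Sub 64 [0,2,1,5,6,3], Sub 64 [0,2,1,5,6,4], Sub 66 [0,2,1,5,6,4]]),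
   ([[F,T,T,T,T],[T,T,T,T],[T,F,F],[F,F],[F],[]], (1, 2, 9, 17), [[-2,1,6,6,-5,-5],
     [-1,-1,3,3,-2,-5], [-1,-1,3,3,-5,-2], [1,-2,6,6,-5,-5]], [Sub 72 [0,1,2,4,5,6],
     Sub 73 [0,1,2,4,5,6]]),
   ([[T,T,T,T,T],[T,T,T,T],[T,F,F],[F,F],[F],[]], (1, 2, 4, 7), [], [Sub 74 [0,1,2,4,5,6]]),
   ([[T,T,T,F,F],[T,T,F,F],[F,T,F],[F,F],[F],[]], (6, 7, 7, 8), [[4,4,-2,5,-6,-4],
     [5,5,-5,8,-9,-6]], [Sub 43 [0,3,1,4,5,6], Sub 43 [0,3,2,4,5,6], Sub 79 [0,2,4,5,3,6],
     Sub 41 [0,3,2,4,5,6]]),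
   ([[T,T,T,F,F],[F,F,F,T],[F,T,F],[F,F],[F],[]], (1, 1, 1, 1), [[1,4,-3,0,-4,4],
     [1,-3,4,0,4,-4], [2,0,0,2,-1,-1]], [Iso 29 [0,1,4,2,3,5,6], Sub 40 [0,2,1,4,6,5],
     Sub 40 [0,3,1,4,5,6], Sub 30 [3,0,1,4,5,6], Sub 79 [0,3,5,4,1,6], Sub 79 [0,1,4,5,3,6],
     Sub 78 [0,1,4,2,6,5], Sub 78 [0,1,4,3,5,6], Sub 63 [0,3,1,5,6,4], Sub 51 [0,1,3,4,5,6],
     Sub 44 [0,3,1,4,5,6]]),
   ([[T,T,T,T,F],[T,T,F,T],[F,T,F],[F,F],[F],[]], (5, 6, 7, 8), [[-1,3,-3,3,-4,3],
     [-2,2,-3,2,-5,4]], [Sub 116 [4,2,1,0,5,6], Sub 61 [0,2,1,3,4,6]]),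
   ([[T,T,T,T,F],[F,T,T,F],[T,T,F],[F,F],[F],[]], (0, 1, 5, 9), [[2,1,1,1,1,-4], [1,1,1,1,1,-6]],
     []),
   ([[T,T,T,T,T],[F,T,T,F],[T,T,F],[F,F],[F],[]], (3, 7, 6, 13), [[-1,2,2,2,2,-6]],
     [Sub 118 [0,1,2,3,4,5]]),
   ([[T,T,T,T,F],[T,T,T,F],[T,T,F],[F,F],[F],[]], (3, 5, 13, 21), [[1,1,1,0,2,-4],
     [1,1,1,1,1,-6]], []),
   ([[T,T,T,T,T],[T,T,T,F],[T,T,F],[F,F],[F],[]], (3, 5, 13, 21), [[-1,3,3,2,2,-8]], []),
   ([[F,F,F,T,T],[F,T,F,T],[T,T,F],[F,F],[F],[]], (1, 1, 1, 1), [[-6,3,3,6,-4,-4],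
     [-6,4,4,6,-3,-3], [0,4,-3,0,-3,4], [0,-3,4,0,4,-3]], [Iso 25 [0,4,5,6,1,2,3],
     Iso 28 [0,2,3,5,6,1,4], Iso 28 [0,1,3,4,6,2,5], Iso 28 [0,1,2,4,5,3,6],
     Iso 25 [0,1,2,3,4,5,6], Iso 26 [0,1,2,3,4,5,6]]),
   ([[T,T,F,T,T],[T,T,F,T],[T,T,F],[F,F],[F],[]], (3, 5, 13, 21), [[2,2,-7,-4,-4,8],
     [-2,7,-2,4,-8,4], [-4,1,1,4,-2,-2]], [Iso 27 [0,1,2,3,4,5,6]]),
   ([[T,T,T,T,T],[T,T,F,T],[T,T,F],[F,F],[F],[]], (3, 5, 13, 21), [], [Sub 153 [2,3,4,0,1,6],
     Sub 107 [0,1,2,3,4,6]]),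
   ([[T,T,T,T,T],[T,T,T,T],[T,T,F],[F,F],[F],[]], (0, 1, 10, 23), [[-1,-1,5,3,3,-8]], []),
   ([[T,F,T,T,F],[T,F,F,F],[F,F,T],[F,F],[F],[]], (7, 6, 25, 21), [[3,0,-3,2,2,-3],
     [5,-2,-7,5,5,-7], [4,-1,-5,3,2,-4], [4,-1,-5,2,3,-4]], [Sub 24 [0,1,2,4,5,6],
     Sub 20 [0,1,2,4,5,6], Sub 23 [0,1,4,5,2,6], Sub 14 [3,0,2,5,6,4], Sub 14 [3,0,2,4,6,5],
     Sub 25 [0,1,2,4,5,6]]),
   ([[T,T,T,T,F],[T,T,F,F],[F,F,T],[F,F],[F],[]], (4, 5, 5, 6), [[2,2,-1,2,0,-3],
     [2,1,-4,3,2,-6], [2,1,-2,2,3,-4]], [Sub 110 [2,1,4,0,3,5], Sub 61 [0,1,2,3,4,5]]),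
   ([[F,T,T,T,F],[T,T,T,F],[F,F,T],[F,F],[F],[]], (4, 5, 5, 6), [[1,2,-2,2,2,-4],
     [1,1,-5,3,3,-5], [2,2,-4,3,3,-7], [2,1,-2,2,2,-4], [3,3,-2,3,3,-7]], [Sub 49 [1,2,0,5,3,4],
     Sub 49 [1,2,0,4,3,5], Sub 73 [0,1,2,3,4,5]]),
   ([[T,T,T,T,F],[T,T,T,F],[F,F,T],[F,F],[F],[]], (0, 1, 14, 15), [[3,3,-4,3,3,-7],
     [1,1,-3,2,2,-4]], []),
   ([[T,T,T,T,T],[T,T,T,F],[F,F,T],[F,F],[F],[]], (3, 4, 4, 5), [], [Sub 73 [2,0,1,3,4,5],
     Sub 74 [0,1,2,3,4,5]]),
   ([[T,T,T,T,F],[T,T,T,F],[T,F,T],[F,F],[F],[]], (0, 1, 4, 5), [[-3,-3,3,0,-5,7],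
     [2,2,-3,0,3,-5]], []),
   ([[T,T,T,T,F],[F,F,T,T],[T,F,T],[F,F],[F],[]], (1, 1, 1, 1), [[1,3,-3,-3,4,-1],
     [1,-3,3,4,-3,-1]], [Sub 84 [3,4,0,1,5,6], Sub 110 [3,0,4,1,6,5], Sub 67 [0,1,3,4,5,6],
     Sub 60 [0,3,1,4,5,6]]),
   ([[T,F,T,T,T],[T,T,F,F],[F,T,T],[F,F],[F],[]], (5, 6, 13, 15), [[2,2,-3,4,-2,-2],
     [1,2,-3,3,-2,-2], [1,5,-5,8,-4,-7], [1,5,-5,8,-7,-4]], [Sub 73 [0,1,3,2,5,6]]),
   ([[T,T,T,F,F],[F,T,T,F],[F,T,T],[F,F],[F],[]], (9, 8, 8, 7), [[3,4,-4,5,-2,-5],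
     [2,4,-5,5,-1,-6]], [Sub 116 [5,0,2,3,1,6], Sub 86 [0,3,1,5,2,6], Sub 83 [1,4,0,2,5,6],
     Sub 41 [2,0,1,4,5,6], Sub 46 [0,2,1,4,5,6], Sub 47 [0,2,1,4,5,6]]),
   ([[T,T,T,T,F],[F,T,T,T],[T,T,T],[F,F],[F],[]], (0, 1, 5, 12), [[7,-1,-1,4,4,-12],
     [2,-1,-1,1,1,-4]], []),
   ([[F,F,T,T,T],[F,T,T,T],[T,T,T],[F,F],[F],[]], (0, 1, 0, 1), [], []),
   ([[T,T,T,T,T],[F,T,T,T],[T,T,T],[F,F],[F],[]], (0, 1, 0, 1), [], []),
   ([[T,T,T,T,T],[T,T,T,T],[T,T,T],[F,F],[F],[]], (0, 1, 0, 1), [], []),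
   ([[T,T,F,F,F],[F,F,F,F],[F,F,F],[T,F],[F],[]], (7, 6, 13, 11), [[5,4,4,-5,-5,-1],
     [6,4,4,-7,-8,-1], [7,5,4,-8,-7,-2]], [Sub 12 [0,1,2,3,4,6], Sub 30 [0,2,3,1,6,4],
     Sub 12 [0,1,2,3,5,6], Sub 30 [0,2,3,1,6,5], Sub 14 [0,1,3,2,6,4], Sub 14 [0,1,3,2,6,5],
     Sub 14 [0,1,2,3,6,4], Sub 14 [0,1,2,3,6,5], Sub 10 [0,4,5,2,3,6], Sub 11 [0,4,5,2,3,6]]),
   ([[T,T,F,F,F],[T,F,F,F],[F,F,F],[T,F],[F],[]], (7, 5, 23, 16), [[5,5,5,-6,-6,-2],
     [4,4,4,-6,-6,-1]], [Sub 51 [2,3,0,1,5,6], Sub 51 [2,3,0,1,6,4], Sub 51 [2,3,0,1,4,6],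
     Sub 51 [2,3,0,1,6,5], Sub 51 [1,3,0,2,5,6], Sub 51 [1,3,0,2,6,4], Sub 51 [1,3,0,2,4,6],
     Sub 51 [1,3,0,2,6,5], Sub 51 [1,2,0,3,5,6], Sub 51 [1,2,0,3,6,4], Sub 51 [1,2,0,3,4,6],
     Sub 51 [1,2,0,3,6,5], Sub 33 [0,1,2,3,5,6]]),
   ([[T,T,T,F,F],[T,F,F,F],[F,F,F],[T,F],[F],[]], (9, 8, 17, 15), [[4,7,7,-6,-8,-3],
     [3,7,7,-7,-9,-2]], [Sub 82 [0,5,3,1,4,6], Sub 41 [0,4,1,3,5,6]]),
   ([[T,T,F,T,F],[T,T,F,F],[F,F,F],[T,F],[F],[]], (5, 7, 26, 35), [[4,4,7,-5,-5,-4],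
     [1,2,3,-2,-3,-2], [-1,0,-1,2,1,0]], [Sub 54 [0,1,4,2,5,6]]),
   ([[T,T,T,F,T],[T,F,T,F],[F,F,F],[T,F],[F],[]], (3, 4, 7, 9), [[2,0,2,-2,-3,2],
     [1,0,1,-2,-3,2], [1,2,3,-3,-2,0], [-1,2,3,-5,-2,1]], [Sub 50 [0,1,2,3,4,6]]),
   ([[T,T,T,T,F],[T,F,F,T],[F,F,F],[T,F],[F],[]], (6, 5, 26, 21), [[-2,6,3,-6,-6,6],
     [-3,5,3,-6,-6,5]], [Sub 95 [4,5,0,1,3,6], Sub 47 [0,1,4,5,3,6]]),
   ([[T,T,F,T,T],[T,T,F,F],[T,F,F],[T,F],[F],[]], (4, 5, 21, 26), [[-4,4,4,6,-1,-8],
     [-4,2,2,4,0,-5]], [Sub 152 [0,2,3,1,4,5]]),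
   ([[T,T,F,F,T],[F,F,T,F],[T,F,F],[T,F],[F],[]], (1, 1, 1, 1), [[-4,0,0,3,3,-4],
     [-2,0,0,3,3,-3], [-1,-2,1,1,-1,0], [1,-1,2,1,-1,0]], [Sub 128 [0,1,3,6,2,5],
     Sub 128 [0,1,2,6,3,4], Sub 116 [0,5,2,3,1,4], Sub 116 [0,4,3,2,1,5], Sub 42 [0,4,5,2,3,6],
     Sub 151 [0,4,3,1,5,2], Sub 151 [0,5,2,1,4,3], Sub 78 [5,0,2,3,4,6], Sub 78 [4,0,3,2,5,6],
     Sub 44 [0,4,5,2,3,6]]),
   ([[T,T,T,F,F],[T,T,F,F],[F,T,F],[T,F],[F],[]], (0, 1, 4, 7), [[2,2,1,1,-1,-4],
     [2,2,1,1,-1,-6], [1,2,0,0,-2,0], [2,1,0,0,-2,0], [0,0,-1,-1,-2,3]], []),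
   ([[T,T,T,F,T],[T,T,F,F],[F,T,F],[T,F],[F],[]], (2, 3, 17, 25), [[4,1,-1,-1,-5,4],
     [1,0,-1,-1,-3,3], [2,-1,-1,-3,-3,4], [-2,1,3,1,3,-4], [2,-3,-2,-2,-3,6]],
     [Sub 153 [0,1,2,3,4,5]]),
   ([[T,T,T,T,F],[T,T,F,T],[F,T,F],[T,F],[F],[]], (0, 1, 16, 19), [[-4,4,-2,-2,-6,9],
     [-3,6,-2,-2,-6,9]], []),
   ([[F,T,T,F,T],[T,T,F,T],[F,T,F],[T,F],[F],[]], (5, 7, 11, 15), [[2,2,-2,-2,-5,6],
     [-2,-2,2,2,6,-5], [-2,6,-2,6,-1,-1], [6,-2,-2,6,-1,-1], [-2,6,6,-2,-1,-1], [6,-2,6,-2,-1,-1]],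
     [Sub 71 [0,1,2,3,4,6], Sub 73 [0,1,2,3,4,6]]),
   ([[T,T,T,T,T],[T,T,F,T],[F,T,F],[T,F],[F],[]], (2, 3, 5, 7), [], [Sub 73 [2,0,1,3,4,6],
     Sub 74 [0,1,2,3,4,6]]),
   ([[T,T,T,T,F],[T,T,T,F],[T,T,F],[T,F],[F],[]], (2, 3, 2, 3), [[-1,-1,-1,-1,-2,4],
     [-1,-1,-1,-1,-1,6]], []),
   ([[T,T,T,T,T],[T,T,T,F],[T,T,F],[T,F],[F],[]], (0, 1, 8, 11), [[1,-2,-2,-2,-2,6]], []),
   ([[T,F,F,F,T],[F,F,F,T],[T,T,F],[T,F],[F],[]], (2, 1, 2, 1), [[4,4,-4,-4,-4,3],
     [4,4,-4,-4,-3,4]], [Sub 138 [4,5,0,3,6,1], Sub 138 [3,5,0,4,6,1], Sub 138 [3,4,0,5,6,1],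
     Sub 138 [4,5,0,3,6,2], Sub 138 [3,5,0,4,6,2], Sub 138 [3,4,0,5,6,2], Sub 138 [4,5,0,3,2,6],
     Sub 138 [3,5,0,4,2,6], Sub 138 [3,4,0,5,2,6], Sub 134 [0,3,4,5,2,6]]),
   ([[T,F,T,F,T],[T,F,F,T],[T,T,F],[T,F],[F],[]], (7, 5, 17, 12), [[5,5,-5,-5,-7,8],
     [-5,-5,5,5,8,-7]], [Sub 145 [2,6,0,1,4,3], Sub 151 [2,0,6,1,3,4], Sub 151 [1,0,6,2,4,3],
     Sub 145 [1,6,0,2,3,4], Sub 104 [0,1,2,3,4,6], Sub 139 [0,1,2,6,3,4]]),
   ([[T,T,T,F,T],[T,T,F,T],[T,T,F],[T,F],[F],[]], (1, 1, 1, 1), [[2,2,-3,-3,-5,5],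
     [3,3,-2,-2,-5,5]], [Sub 107 [0,1,2,3,4,6]]),
   ([[T,T,T,T,T],[T,T,T,T],[T,T,F],[T,F],[F],[]], (3, 5, 13, 21), [[1,1,-3,-3,-3,6]], []),
   ([[T,F,T,F,F],[T,F,F,F],[F,F,T],[T,F],[F],[]], (11, 9, 5, 4), [[3,-4,-7,7,6,-6],
     [4,-3,-7,7,6,-6]], [Iso 22 [0,3,4,1,2,5,6], Sub 109 [4,0,5,1,6,2], Sub 79 [0,1,2,5,4,6],
     Sub 78 [0,2,1,3,6,5], Sub 78 [0,1,2,4,5,6], Sub 51 [0,1,4,2,5,6], Sub 44 [0,4,1,2,5,6]]),
   ([[T,T,T,F,F],[T,T,F,F],[F,F,T],[T,F],[F],[]], (1, 1, 1, 1), [[0,0,4,-3,-3,4],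
     [0,0,-3,4,4,-3], [2,2,0,0,-1,-1]], [Sub 53 [4,0,2,5,1,6], Sub 53 [4,0,1,5,2,6],
     Sub 81 [0,1,2,4,5,6], Sub 83 [1,2,0,3,6,5], Sub 83 [1,2,0,4,5,6], Sub 33 [4,0,1,2,5,6],
     Sub 47 [0,4,1,2,5,6]]),
   ([[T,T,F,T,F],[T,T,F,F],[F,F,T],[T,F],[F],[]], (1, 1, 1, 1), [[0,0,4,-3,-3,4],
     [0,0,3,-4,-4,3]], [Iso 24 [0,3,1,4,2,5,6], Sub 59 [0,3,2,1,4,6], Sub 59 [0,3,1,2,5,6],
     Sub 84 [0,1,2,5,4,6], Sub 84 [0,2,1,4,5,6], Sub 83 [0,1,2,5,4,6], Sub 83 [0,2,1,4,5,6],
     Sub 55 [0,1,4,2,5,6]]),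
   ([[T,F,F,T,T],[T,T,F,F],[F,F,T],[T,F],[F],[]], (1, 1, 1, 1), [[0,0,4,-3,-3,4],
     [0,0,-3,4,4,-3]], [Sub 116 [5,0,4,1,2,6], Sub 110 [0,2,3,6,4,1], Sub 110 [0,1,5,4,6,2],
     Sub 81 [2,0,1,6,3,4], Sub 84 [1,0,2,6,3,5], Sub 84 [1,0,2,5,4,6], Sub 81 [1,0,2,4,5,6],
     Sub 87 [0,1,2,5,4,6]]),
   ([[T,T,T,T,T],[T,T,F,F],[F,F,T],[T,F],[F],[]], (1, 1, 1, 1), [], [Sub 71 [4,0,1,2,5,6],
     Sub 61 [0,1,4,2,5,6]]),
   ([[T,T,F,F,T],[F,T,T,F],[F,F,T],[T,F],[F],[]], (12, 7, 26, 15), [[2,-3,3,-3,-3,3],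
     [3,-2,3,-3,-3,3]], [Sub 147 [4,5,0,2,1,6], Sub 140 [2,5,0,4,1,6], Sub 140 [2,4,0,5,1,6],
     Sub 140 [1,6,0,3,2,5], Sub 140 [1,3,0,6,2,5], Sub 111 [1,0,6,2,3,4], Sub 111 [1,0,6,2,3,5],
     Sub 111 [2,0,5,1,4,6], Sub 111 [2,0,4,1,5,6], Sub 137 [0,2,4,5,1,6]]),
   ([[T,T,T,F,T],[T,T,T,F],[F,F,T],[T,F],[F],[]], (11, 9, 5, 4), [[2,-3,4,-4,-5,5],
     [3,-2,4,-4,-5,5]], [Sub 148 [1,3,2,6,0,4], Sub 106 [0,1,3,2,4,6]]),
   ([[F,T,T,T,T],[T,T,T,T],[F,F,T],[T,F],[F],[]], (1, 1, 1, 1), [[0,0,3,-3,-3,4],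
     [0,0,-3,3,4,-3]], [Sub 154 [4,5,0,1,2,6], Sub 146 [0,2,4,5,1,6], Sub 146 [0,1,4,5,2,6],
     Sub 153 [0,4,5,1,2,6]]),
   ([[T,T,T,T,T],[T,T,T,T],[F,F,T],[T,F],[F],[]], (1, 1, 1, 1), [], [Sub 107 [0,1,2,4,5,6]]),
   ([[T,T,T,T,T],[F,F,T,T],[T,F,T],[T,F],[F],[]], (3, 5, 13, 21), [], [Iso 30 [0,1,2,3,4,5,6],
     Iso 31 [0,1,2,3,4,5,6]]),
   ([[T,T,T,T,F],[T,F,T,T],[T,F,T],[T,F],[F],[]], (7, 8, 13, 14), [[-2,1,1,-2,-2,3],
     [3,-3,-3,4,4,-6]], [Sub 119 [0,1,2,4,3,5]]),
   ([[F,F,T,T,T],[T,F,T,T],[T,F,T],[T,F],[F],[]], (1, 1, 1, 1), [[-3,3,3,-3,-3,4],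
     [3,-3,-3,3,4,-3]], [Sub 110 [3,6,0,4,2,1], Sub 110 [2,6,0,5,3,1], Sub 151 [4,0,5,1,3,6],
     Sub 110 [1,5,0,6,4,2], Sub 151 [3,0,6,2,4,5], Sub 151 [2,0,6,3,5,4], Sub 110 [1,4,0,6,5,3],
     Sub 110 [2,3,0,5,6,4], Sub 110 [3,2,0,4,6,5], Sub 139 [0,2,3,6,4,5]]),
   ([[T,T,T,T,T],[T,T,T,T],[T,F,T],[T,F],[F],[]], (3, 5, 13, 21), [], [Sub 120 [0,1,2,3,4,6]]),
   ([[T,T,T,T,T],[T,T,T,T],[T,T,T],[T,F],[F],[]], (3, 8, 2, 5), [], [Sub 155 [0,1,2,3,4,5]]),
   ([[T,T,T,T,F],[T,F,F,F],[F,F,F],[F,T],[F],[]], (11, 10, 10, 9), [[3,5,5,-6,2,-7],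
     [1,3,3,-4,0,-4]], [Sub 50 [0,1,2,3,4,5]]),
   ([[T,T,T,F,F],[T,F,T,F],[F,F,F],[F,T],[F],[]], (7, 6, 13, 11), [[-2,-5,-4,5,-2,6],
     [1,5,4,-7,3,-7]], [Sub 116 [3,2,1,0,4,5], Sub 84 [1,3,0,2,5,4], Sub 83 [1,3,0,2,5,6],
     Sub 43 [0,1,4,6,3,5], Sub 42 [4,0,1,3,5,6], Sub 44 [0,4,1,3,6,5]]),
   ([[T,T,T,T,F],[T,F,T,T],[T,F,F],[F,T],[F],[]], (5, 7, 14, 19), [[-2,-3,1,4,-4,3],
     [-1,-2,2,4,-4,2]], [Sub 153 [0,1,3,2,4,6]]),
   ([[T,T,T,T,F],[T,T,F,F],[F,T,F],[F,T],[F],[]], (11, 10, 10, 9), [[-3,-1,-6,6,-5,8],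
     [1,0,3,-4,3,-4]], [Sub 60 [0,4,1,2,5,6]]),
   ([[T,T,T,T,F],[T,T,T,F],[T,T,F],[F,T],[F],[]], (7, 8, 11, 12), [[-2,-2,-2,3,-4,6],
     [-1,-1,-1,2,-2,4]], [Sub 107 [1,2,3,0,5,4]]),
   ([[T,T,T,T,T],[T,T,T,F],[T,T,F],[F,T],[F],[]], (4, 5, 5, 6), [], [Sub 119 [2,3,0,1,4,5],
     Sub 120 [0,1,2,3,4,5]]),
   ([[T,T,T,T,F],[T,T,T,F],[F,F,T],[F,T],[F],[]], (5, 6, 7, 8), [[2,2,-1,-1,2,-3],
     [-1,-1,1,1,-2,3]], [Sub 146 [0,4,1,2,3,6], Sub 146 [0,3,1,2,4,6], Sub 74 [0,1,2,3,4,5]]),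
   ([[T,T,F,F,F],[T,F,F,F],[F,F,F],[T,T],[F],[]], (5, 3, 29, 17), [[6,6,6,-7,-5,-5],
     [3,3,3,-4,-3,-3]], [Sub 34 [0,2,3,1,5,6], Sub 34 [0,1,3,2,5,6], Sub 34 [0,1,2,3,5,6],
     Sub 35 [0,1,2,3,5,6]]),
   ([[T,T,T,F,F],[T,F,F,T],[F,T,F],[T,T],[F],[]], (5, 7, 23, 31), [[1,2,2,-2,-1,-1],
     [2,6,1,-6,-6,1], [0,0,1,-1,1,-2], [1,-1,1,0,2,-2], [-1,2,2,-3,-1,-1], [2,1,6,-6,1,-6]],
     [Sub 103 [0,4,2,3,5,6]]),
   ([[T,T,T,F,T],[T,T,T,F],[F,T,T],[T,T],[F],[]], (3, 5, 13, 21), [[1,-2,0,0,-2,2],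
     [2,-1,0,0,-2,2]], [Sub 153 [1,0,4,2,6,3], Sub 153 [1,0,3,2,6,4], Sub 119 [0,1,3,4,2,6]]),
   ([[F,T,T,T,T],[T,T,T,T],[F,T,T],[T,T],[F],[]], (0, 1, 0, 1), [], []),
   ([[T,T,T,T,T],[T,T,T,T],[F,T,T],[T,T],[F],[]], (0, 1, 0, 1), [], []),
   ([[T,T,T,T,T],[T,T,T,T],[T,T,T],[T,T],[F],[]], (0, 1, 0, 1), [], []),
   ([[T,T,T,F,F],[F,F,F,F],[F,F,F],[F,F],[T],[]], (5, 4, 19, 15), [[5,2,2,2,-5,-5],
     [6,3,3,2,-7,-8], [6,3,2,3,-7,-8], [6,2,3,3,-7,-8], [6,3,3,2,-8,-7], [6,3,2,3,-8,-7],
     [6,2,3,3,-8,-7]], [Sub 20 [0,1,2,3,4,5], Sub 20 [0,1,2,3,4,6], Sub 25 [0,1,2,3,4,6]]),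
   ([[T,F,T,F,F],[T,F,F,F],[F,F,F],[F,F],[T],[]], (6, 5, 11, 9), [[5,4,2,4,-7,-7],
     [5,5,3,3,-8,-9], [3,4,3,1,-5,-5]], [Sub 30 [2,0,1,4,3,5], Sub 30 [2,0,1,4,3,6],
     Sub 78 [0,2,3,1,4,5], Sub 78 [0,2,3,1,4,6], Sub 30 [1,0,2,3,4,5], Sub 30 [1,0,2,3,4,6],
     Sub 78 [0,1,4,2,3,5], Sub 78 [0,1,4,2,3,6], Sub 42 [0,1,2,3,4,6], Sub 14 [1,2,0,3,4,6],
     Sub 44 [0,1,2,3,4,6]]),
   ([[T,T,T,F,F],[T,F,F,F],[F,F,F],[F,F],[T],[]], (7, 5, 17, 12), [[4,3,3,1,-5,-5],
     [3,3,3,0,-5,-5]], [Sub 83 [2,3,0,1,4,5], Sub 83 [2,3,0,1,4,6], Sub 41 [1,0,3,2,4,5],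
     Sub 41 [1,0,3,2,4,6], Sub 41 [1,0,2,3,4,5], Sub 41 [1,0,2,3,4,6]]),
   ([[F,T,T,F,F],[T,T,F,F],[F,F,F],[F,F],[T],[]], (4, 3, 4, 3), [[4,4,4,4,-8,-7],
     [2,2,2,1,-4,-4]], [Sub 83 [0,2,3,4,1,5], Sub 83 [0,2,3,4,1,6], Sub 83 [0,1,3,4,2,5],
     Sub 83 [0,1,3,4,2,6], Sub 83 [0,4,1,2,3,5], Sub 83 [0,4,1,2,3,6], Sub 83 [0,3,1,2,4,5],
     Sub 83 [0,3,1,2,4,6]]),
   ([[T,T,T,F,F],[T,T,F,F],[F,F,F],[F,F],[T],[]], (3, 2, 20, 13), [[5,5,4,4,-8,-8],
     [5,5,3,3,-8,-9], [5,5,3,3,-9,-8]], [Sub 54 [2,0,1,3,4,5], Sub 54 [2,0,1,3,4,6],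
     Sub 54 [1,0,2,3,4,5], Sub 54 [1,0,2,3,4,6], Sub 45 [1,2,0,4,3,5], Sub 45 [1,2,0,4,3,6],
     Sub 45 [1,2,0,3,4,5], Sub 45 [1,2,0,3,4,6]]),
   ([[T,T,T,T,F],[T,T,F,F],[F,F,F],[F,F],[T],[]], (11, 9, 5, 4), [[2,4,3,3,-5,-6],
     [1,4,3,3,-6,-6]], []),
   ([[T,T,T,T,T],[T,T,F,F],[F,F,F],[F,F],[T],[]], (7, 6, 6, 5), [], [Sub 71 [2,0,1,3,4,6],
     Sub 61 [0,1,2,3,4,6]]),
   ([[F,T,T,F,T],[T,T,T,F],[F,F,F],[F,F],[T],[]], (3, 4, 4, 5), [[1,1,2,3,-3,-3],
     [1,0,1,1,-2,-2], [-1,4,4,4,-5,-9], [-1,4,2,2,-1,-4], [4,-1,2,2,-4,-1], [2,-2,2,2,-5,-2],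
     [-1,4,4,1,-3,-7], [-1,4,1,4,-3,-7], [4,-1,4,1,-7,-3], [4,-1,1,4,-7,-3]],
     [Sub 103 [0,1,5,2,4,6]]),
   ([[T,T,T,F,T],[T,T,T,F],[F,F,F],[F,F],[T],[]], (5, 6, 7, 8), [[2,2,2,2,-3,-3],
     [1,1,2,2,-3,-4]], [Sub 61 [0,1,2,3,4,6]]),
   ([[T,T,F,T,F],[F,T,F,F],[T,F,F],[F,F],[T],[]], (7, 6, 27, 23), [[0,2,2,3,-3,-3],
     [0,3,2,4,-5,-5], [0,2,3,4,-5,-5]], [Sub 128 [0,1,2,3,5,6], Sub 20 [2,3,0,1,4,6],
     Sub 84 [0,4,2,3,1,6], Sub 84 [0,1,2,3,4,6], Sub 83 [0,1,2,3,4,6], Sub 55 [0,2,3,1,4,6]]),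
   ([[T,T,T,F,F],[T,T,F,F],[T,F,F],[F,F],[T],[]], (5, 3, 5, 3), [[3,3,3,4,-6,-6],
     [7,7,7,7,-14,-15]], [Sub 56 [2,3,4,0,1,5], Sub 56 [2,3,4,0,1,6], Sub 56 [1,3,4,0,2,5],
     Sub 56 [1,3,4,0,2,6], Sub 56 [1,2,4,0,3,5], Sub 56 [1,2,4,0,3,6], Sub 56 [1,2,3,0,4,5],
     Sub 56 [1,2,3,0,4,6]]),
   ([[T,T,T,T,F],[T,T,F,F],[T,F,F],[F,F],[T],[]], (7, 5, 13, 9), [[2,4,4,4,-6,-7],
     [1,4,4,4,-7,-7]], []),
   ([[T,T,F,T,T],[T,T,F,F],[T,F,F],[F,F],[T],[]], (3, 2, 23, 15), [[-2,4,4,5,-5,-5],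
     [-1,2,2,2,-3,-3]], [Sub 141 [2,3,0,4,1,6], Sub 113 [0,2,3,1,4,6]]),
   ([[T,T,T,T,T],[T,T,F,F],[T,F,F],[F,F],[T],[]], (7, 5, 10, 7), [], [Sub 152 [2,3,4,0,1,6],
     Sub 93 [0,1,2,3,4,6]]),
   ([[T,T,T,T,F],[T,T,T,F],[T,F,F],[F,F],[T],[]], (0, 1, 13, 11), [[2,3,4,4,-5,-7],
     [1,1,3,3,-4,-5]], []),
   ([[T,T,T,F,T],[T,T,T,F],[T,F,F],[F,F],[T],[]], (0, 1, 22, 19), [[1,2,4,4,-5,-5],
     [1,1,3,3,-4,-5]], []),
   ([[T,T,T,T,T],[T,T,T,F],[T,F,F],[F,F],[T],[]], (10, 9, 8, 7), [], [Sub 153 [2,3,4,0,1,5],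
     Sub 107 [0,1,2,3,4,5]]),
   ([[T,T,T,F,F],[T,T,F,F],[F,T,F],[F,F],[T],[]], (7, 5, 38, 27), [[5,5,0,5,-7,-7],
     [3,3,0,3,-5,-5]], [Sub 85 [2,0,3,4,1,6], Sub 54 [2,0,1,3,4,6], Sub 85 [1,0,3,4,2,6],
     Sub 54 [1,0,2,3,4,6], Sub 67 [1,2,0,3,4,6], Sub 45 [1,2,0,3,4,6]]),
   ([[T,T,T,T,T],[T,T,F,T],[T,T,F],[F,F],[T],[]], (5, 7, 3, 4), [], [Sub 118 [0,1,2,5,3,6],
     Sub 119 [0,1,2,5,3,6]]),
   ([[T,T,T,T,F],[T,T,F,F],[F,F,T],[F,F],[T],[]], (10, 9, 29, 26), [[2,2,0,2,-2,-3],
     [1,4,0,4,-5,-5]], [Sub 60 [1,0,2,4,3,5], Sub 61 [0,1,2,3,4,5]]),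
   ([[T,T,T,T,F],[T,T,T,F],[T,F,T],[F,F],[T],[]], (0, 1, 5, 6), [[3,3,2,5,-5,-7],
     [1,1,1,2,-3,-3]], []),
   ([[T,T,T,F,F],[T,F,F,F],[F,F,F],[T,F],[T],[]], (13, 9, 3, 2), [[3,3,3,-1,-4,-3],
     [3,5,5,-3,-6,-5]], [Sub 81 [0,2,3,1,4,6], Sub 83 [2,3,0,1,4,6], Sub 53 [1,0,3,4,2,6],
     Sub 41 [1,0,3,2,4,6], Sub 53 [1,0,2,4,3,6], Sub 41 [1,0,2,3,4,6], Sub 46 [0,1,2,3,4,6],
     Sub 47 [0,1,2,3,4,6]]),
   ([[T,T,F,T,T],[T,T,F,F],[T,F,F],[T,F],[T],[]], (7, 6, 20, 17), [[-1,3,3,3,-3,-4],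
     [-2,3,3,2,-4,-4]], [Sub 146 [0,4,2,3,1,5], Sub 153 [0,2,3,1,4,5]]),
   ([[T,T,T,F,F],[T,T,F,F],[F,T,F],[T,F],[T],[]], (9, 8, 25, 22), [[5,6,2,2,-6,-8],
     [5,5,1,1,-7,-7], [6,5,2,2,-6,-8]], [Sub 54 [2,0,1,3,4,6], Sub 54 [1,0,2,3,4,6]]),
   ([[T,T,T,F,T],[T,T,F,F],[F,T,F],[T,F],[T],[]], (5, 7, 3, 4), [[2,3,1,1,-3,-3],
     [1,4,1,1,-4,-4]], [Sub 73 [0,1,5,3,4,6]]),
   ([[T,T,T,F,T],[T,T,F,T],[T,T,F],[T,F],[T],[]], (2, 5, 3, 7), [[0,0,1,1,0,-1], [1,1,0,0,-1,0],
     [-1,-1,2,2,1,-4], [2,2,-1,-1,-4,1]], [Sub 153 [0,3,4,2,5,6]]),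
   ([[T,T,T,F,F],[T,T,F,F],[F,F,T],[T,F],[T],[]], (10, 9, 9, 8), [[10,10,3,3,-12,-12],
     [4,4,1,1,-6,-6]], [Sub 116 [0,6,3,4,1,5], Sub 116 [0,5,4,3,1,6], Sub 116 [0,6,3,4,2,5],
     Sub 116 [0,5,4,3,2,6]]),
   ([[T,T,T,F,T],[T,T,T,F],[F,F,T],[T,F],[T],[]], (4, 5, 21, 26), [[1,-2,3,-4,-2,3],
     [2,-1,4,-3,-3,2]], [Iso 32 [1,5,0,3,2,4,6], Sub 153 [0,2,4,1,5,6]]),
   ([[T,T,T,T,F],[T,F,F,F],[F,F,F],[F,T],[T],[]], (5, 4, 22, 17), [[2,3,3,-2,-2,-3],
     [2,6,6,-4,-4,-7]], [Sub 116 [5,6,0,1,3,4], Sub 116 [4,6,0,1,3,5], Sub 50 [0,1,2,3,4,5]]),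
   ([[T,T,F,T,F],[T,T,F,F],[F,F,F],[F,T],[T],[]], (6, 5, 23, 19), [[6,6,7,-5,-4,-9],
     [3,4,5,-3,-4,-6], [6,6,7,-4,-5,-9], [4,3,5,-4,-3,-6]], [Sub 110 [2,0,3,1,4,5],
     Sub 110 [1,0,3,2,5,4], Sub 59 [0,1,2,3,4,5], Sub 103 [0,4,5,1,2,6]]),
   ([[T,T,T,T,F],[T,F,T,F],[T,F,F],[F,T],[T],[]], (0, 1, 9, 11), [[4,5,5,-2,-2,-9],
     [1,2,2,-1,-1,-4], [3,2,8,2,-9,-9], [3,8,2,-9,2,-9]], []),
   ([[T,T,T,T,F],[T,T,T,F],[T,T,F],[F,T],[T],[]], (0, 1, 3, 5), [[4,4,4,-1,-1,-9],
     [2,2,2,-1,-1,-5]], []),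
   ([[T,T,T,T,T],[T,T,T,F],[T,T,F],[F,T],[T],[]], (1, 3, 5, 13), [], [Sub 118 [0,1,4,5,3,6],
     Sub 119 [0,1,4,5,3,6]]),
   ([[T,T,T,T,F],[T,T,T,F],[F,F,T],[F,T],[T],[]], (0, 1, 3, 8), [[12,12,-1,-1,-1,-20],
     [1,1,0,0,0,-3]], []),
   ([[T,T,T,T,T],[T,T,T,T],[T,T,T],[T,T],[T],[]], (0, 1, 0, 1), [], [])]"

text \<open>
  Rounded top eigenvectors of the graphs in \<open>nodes6\<close>, which prove the positive lower ends of
  their ranges.
\<close>

definition low_vectors :: "int list list" where
  "low_vectors =
    [[], [2,2,-1,-1,-1,-1], [7,4,4,-5,-5,-5], [3,1,1,1,-3,-3], [], [], [1,1,1,-1,-1,-1],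
    [-1,1,1,-1,0,0], [-1,1,2,-2,0,0], [3,3,3,-1,-4,-4], [1,3,3,-2,-2,-3], [0,3,3,-2,-2,-2],
    [1,1,1,1,-2,-2], [1,1,1,1,-2,-2], [-1,1,0,2,-2,0], [1,2,1,1,-2,-3], [-3,3,2,2,-2,-2],
    [-1,1,1,1,-1,-1], [-1,3,2,2,-3,-3], [1,-1,1,1,-2,0], [], [], [1,-1,0,0,-1,1], [1,-1,0,0,-2,2],
    [-2,3,1,1,1,-4], [-1,2,1,1,1,-4], [3,-4,2,2,2,-5], [1,-2,-1,2,2,-2], [], [], [-3,2,2,5,-5,-1],
    [-2,2,2,4,-3,-3], [1,1,1,1,-2,-2], [0,2,2,2,-3,-3], [-3,3,3,5,-4,-4], [], [0,-1,1,1,-1,0],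
    [0,-1,1,1,-1,0], [1,0,-1,-1,0,1], [0,-1,1,1,-1,0], [0,-1,1,2,-2,0], [0,-1,1,2,-2,0],
    [-1,-1,2,3,-2,-1], [4,-4,-2,2,-5,5], [0,-1,1,2,-2,0], [1,1,2,2,-1,-5], [1,-1,0,0,-2,2],
    [-1,1,2,2,-1,-3], [3,-5,5,5,-4,-4], [0,0,1,1,-1,-1], [0,0,1,1,-1,-1], [3,3,-2,4,-5,-3],
    [0,1,-1,0,-1,1], [-1,1,-1,1,-2,2], [], [-1,1,1,1,1,-3], [1,1,1,1,1,-5], [-1,2,2,1,1,-5],
    [-1,1,0,1,-1,0], [-2,1,1,3,-2,-1], [0,1,-1,0,-2,2], [], [3,-1,-3,2,2,-3], [1,1,-2,2,1,-3],
    [2,2,-4,3,3,-6], [], [0,1,-1,1,1,-2], [], [0,-1,1,1,-1,0], [1,1,-2,2,-1,-1], [2,3,-4,4,-1,-4],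
    [], [], [], [], [5,3,3,-5,-5,-1], [3,3,3,-4,-4,-1], [2,3,3,-3,-4,-1], [2,2,4,-3,-3,-2],
    [1,0,1,-1,-2,1], [-1,2,1,-2,-2,2], [-3,3,3,4,-1,-6], [1,0,0,-1,-1,1], [], [2,0,-1,-1,-3,3], [],
    [1,1,-1,-1,-3,3], [0,2,-1,-1,-3,3], [-1,-1,-1,-1,-1,5], [], [1,1,-1,-1,-1,1], [2,2,-2,-2,-3,3],
    [1,1,-1,-1,-2,2], [1,1,-2,-2,-2,4], [1,-1,-2,2,2,-2], [0,0,1,-1,-1,1], [0,0,1,-1,-1,1],
    [0,0,1,-1,-1,1], [0,0,1,-1,-1,1], [2,-2,3,-3,-3,3], [1,-1,2,-2,-2,2], [0,0,1,-1,-1,1],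
    [0,0,1,-1,-1,1], [0,1,0,-2,-1,2], [-1,1,1,-2,-2,3], [1,-1,-1,1,1,-1], [0,0,1,-1,-2,2],
    [0,1,1,-5,-5,8], [3,7,7,-8,1,-10], [-1,-4,-3,5,-2,5], [-2,-2,1,4,-4,3], [-3,0,-6,7,-6,8],
    [-1,-1,-1,2,-2,3], [1,-3,-3,3,-4,6], [-1,-1,1,1,-2,2], [1,1,1,-1,-1,-1], [2,3,3,-4,-2,-2],
    [1,-1,0,0,-2,2], [], [], [], [4,2,2,2,-5,-5], [2,2,1,1,-3,-3], [3,2,2,1,-4,-4],
    [1,1,1,1,-2,-2], [1,1,1,1,-2,-2], [1,3,2,2,-4,-4], [0,4,3,3,-5,-5], [1,1,2,2,-3,-3],
    [1,1,1,1,-2,-2], [0,3,3,4,-5,-5], [1,1,1,1,-2,-2], [0,2,2,2,-3,-3], [-1,2,2,3,-3,-3],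
    [0,2,2,2,-3,-3], [], [], [-1,5,9,9,-10,-12], [2,2,0,2,-3,-3], [0,1,1,2,-2,-2],
    [7,14,-2,15,-15,-19], [], [1,2,2,-1,-2,-2], [-1,3,3,2,-3,-4], [6,6,2,2,-7,-9], [1,3,1,1,-3,-3],
    [2,2,-2,-2,-3,3], [3,3,1,1,-4,-4], [2,-2,5,-5,-4,4], [1,3,3,-2,-2,-3], [6,6,8,-5,-5,-10], [],
    [], [0,1,1,0,0,-2], [], []]"

text \<open>
  A set of seven or more points has the scale of any six of them, so each graph inherits the
  range of the graph that it extends.
\<close>

definition nodes7 :: "node list" where
  "nodes7 = [
   ([[T,T,T,F,T,F],[T,T,T,F,F],[F,F,F,F],[F,F,F],[F,F],[F],[]], (3, 5, 13, 21),
     [[2,2,2,2,-1,-1,-5], [1,1,1,1,-1,-1,-3], [-1,2,1,1,1,-3,-2], [2,-1,1,1,-3,1,-2]],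
     [Iso 0 [0,1,2,4,3,5,6,7], Iso 0 [0,1,2,3,4,5,6,7], Iso 1 [0,1,2,3,4,5,6,7]]),
   ([[F,F,F,F,T,F],[F,F,T,F,F],[T,F,F,F],[F,F,F],[F,F],[F],[]], (1, 1, 1, 1), [[-6,3,3,3,3,-7,0],
     [-3,0,4,4,1,-3,-1], [-2,4,-2,-2,4,-2,1], [-1,-1,2,2,-1,-1,1]], [Iso 2 [0,1,2,3,4,5,6,7],
     Sub 8 [0,5,2,6,3,7], Sub 8 [0,6,1,7,2,3], Sub 8 [0,5,2,6,4,7], Sub 8 [0,6,1,7,2,4],
     Sub 8 [0,4,3,6,5,7], Sub 8 [0,6,1,7,3,5], Sub 8 [0,3,4,6,5,7], Sub 8 [0,6,1,7,4,5],
     Sub 8 [0,4,3,5,6,7], Sub 8 [0,5,2,7,3,6], Sub 8 [0,3,4,5,6,7], Sub 8 [0,5,2,7,4,6],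
     Sub 8 [2,0,4,5,6,7], Sub 8 [0,4,3,7,5,6], Sub 8 [2,0,3,5,6,7], Sub 8 [0,3,4,7,5,6],
     Sub 10 [0,3,4,5,6,7], Sub 11 [0,3,4,5,6,7]]),
   ([[F,F,T,T,F,F],[T,F,T,F,F],[T,F,F,F],[F,F,F],[F,F],[F],[]], (3, 5, 13, 21),
     [[1,1,1,1,1,-2,-2], [1,1,1,1,1,-3,-3], [0,2,0,-1,2,-1,-1], [0,0,2,2,-1,-1,-1],
     [2,0,-1,0,2,-1,-1]], [Iso 3 [0,1,2,3,4,5,7,6], Iso 3 [0,1,2,3,4,5,6,7],
     Iso 4 [0,1,2,3,4,5,6,7]]),
   ([[T,T,F,F,T,F],[T,F,T,F,F],[T,F,F,F],[F,F,F],[F,F],[F],[]], (3, 5, 13, 21),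
     [[2,0,0,-1,-1,2,-1], [0,2,0,-1,2,-1,-1], [1,1,-3,-4,2,2,-1], [0,0,1,1,-1,-1,-1]],
     [Iso 6 [0,1,2,3,4,5,6,7], Iso 5 [0,1,2,3,4,5,6,7], Iso 7 [0,1,2,3,4,5,6,7]]),
   ([[T,T,T,T,T,F],[T,F,T,F,F],[T,F,F,F],[F,F,F],[F,F],[F],[]], (3, 5, 13, 21),
     [[1,2,2,1,1,-2,-4], [1,4,4,1,1,-4,-8]], [Iso 8 [0,1,2,3,4,5,6,7]]),
   ([[T,T,T,T,T,T],[T,F,T,F,F],[T,F,F,F],[F,F,F],[F,F],[F],[]], (3, 5, 13, 21),
     [[-1,4,4,2,2,-5,-5]], [Sub 28 [0,1,4,5,6,7]]),
   ([[T,T,T,T,F,T],[T,T,T,T,F],[T,F,F,F],[F,F,F],[F,F],[F],[]], (3, 5, 13, 21),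
     [[1,1,4,4,-2,-3,-3], [-1,1,0,0,0,1,-2], [-1,1,0,0,0,2,-1]], [Iso 9 [0,1,2,3,4,5,6,7]]),
   ([[F,F,F,T,T,F],[F,T,F,T,F],[T,T,F,F],[F,F,F],[F,F],[F],[]], (1, 1, 1, 1),
     [[-4,-4,7,3,3,-9,1], [-3,-3,9,4,4,-7,-1], [6,-4,0,-4,6,0,-1], [4,-6,0,-6,4,0,1]],
     [Sub 3 [6,0,1,2,3,7], Sub 19 [6,0,1,2,7,3], Iso 16 [3,6,0,1,2,4,5,7],
     Iso 16 [2,5,0,1,3,4,6,7], Sub 14 [0,3,5,4,6,7], Sub 42 [0,2,6,1,4,7],
     Iso 16 [1,4,0,2,3,5,6,7], Sub 14 [0,3,4,5,6,7], Sub 42 [0,1,6,2,5,7], Sub 14 [2,0,4,5,6,7],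
     Sub 42 [0,1,5,3,6,7], Sub 3 [3,0,4,5,6,7], Sub 19 [3,0,4,5,7,6], Sub 15 [0,3,4,5,6,7],
     Sub 18 [0,3,4,5,6,7]]),
   ([[T,T,F,T,T,F],[T,T,F,T,F],[T,T,F,F],[F,F,F],[F,F],[F],[]], (3, 5, 13, 21),
     [[1,1,1,0,0,0,-2], [-2,-2,1,2,2,-5,3], [-3,-3,7,4,4,-9,4], [0,0,1,1,1,-1,-1],
     [-1,2,-1,1,-2,1,1], [-2,1,1,2,-1,-1,-1]], [Iso 11 [0,1,2,3,4,5,6,7],
     Iso 12 [0,1,2,3,4,5,6,7]]),
   ([[T,T,T,T,T,F],[T,T,F,T,F],[T,T,F,F],[F,F,F],[F,F],[F],[]], (3, 5, 13, 21),
     [[1,1,1,1,0,0,-3], [1,3,3,3,-1,-1,-9]], []),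
   ([[T,T,T,F,F,T],[T,T,F,T,F],[T,T,F,F],[F,F,F],[F,F],[F],[]], (3, 5, 13, 21),
     [[2,2,2,5,-3,-3,-3], [-2,1,1,0,1,1,-3], [-1,2,-1,0,-1,3,-1], [0,0,1,1,1,-1,-1]],
     [Iso 13 [0,1,2,3,4,5,6,7]]),
   ([[T,T,T,T,T,T],[T,T,F,T,F],[T,T,F,F],[F,F,F],[F,F],[F],[]], (3, 5, 13, 21),
     [[-1,3,3,3,-1,-1,-5]], [Sub 28 [0,1,4,5,6,7]]),
   ([[T,T,T,T,F,T],[T,T,T,T,F],[T,T,F,F],[F,F,F],[F,F],[F],[]], (3, 5, 13, 21),
     [[1,1,3,1,4,-4,-4], [1,-1,0,0,0,-1,2], [-1,1,0,0,0,2,-1]], []),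
   ([[T,T,T,F,T,T],[T,T,T,F,T],[T,T,T,F],[F,F,F],[F,F],[F],[]], (3, 5, 13, 21),
     [[-1,-1,1,0,1,1,-2], [1,-1,1,0,-1,2,-1], [-1,1,1,0,2,-1,-1], [-1,-1,3,1,2,2,-4],
     [-1,3,-1,1,2,-4,2], [-3,1,1,-1,4,-2,-2]], [Iso 15 [0,1,2,3,4,5,6,7], Sub 107 [0,1,2,3,4,7]]),
   ([[T,F,T,F,F,T],[T,F,F,T,F],[F,T,F,F],[T,F,F],[F,F],[F],[]], (1, 1, 1, 1),
     [[-1,8,2,-6,-5,6,-2], [2,-6,-2,8,5,-6,1], [-3,1,3,-1,2,0,-3], [-3,1,3,0,2,1,-3]],
     [Iso 10 [0,1,2,5,3,4,6,7], Sub 40 [0,1,2,6,7,5], Sub 42 [0,5,4,1,3,6], Sub 42 [0,2,3,5,6,7],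
     Sub 42 [0,5,3,2,4,7], Sub 42 [1,0,4,5,6,7], Sub 14 [0,5,4,3,6,7], Sub 14 [0,5,3,4,7,6],
     Sub 14 [1,4,0,5,7,6], Sub 18 [0,5,3,4,6,7]]),
   ([[T,T,T,F,F,F],[F,F,F,F,T],[F,F,T,F],[T,F,F],[F,F],[F],[]], (1, 1, 1, 1),
     [[0,6,-3,-3,-3,-3,7], [0,-4,0,5,5,1,-4], [1,-1,3,-1,-2,3,-2], [2,1,1,1,-1,-1,-1]],
     [Iso 16 [0,1,4,2,3,6,7,5], Iso 16 [0,1,3,2,4,5,7,6], Sub 8 [2,7,0,1,5,6],
     Iso 16 [0,1,2,3,4,5,6,7], Sub 8 [3,6,0,1,5,7], Sub 8 [4,5,0,1,6,7], Sub 3 [4,0,1,5,6,7],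
     Sub 79 [0,3,6,4,1,7], Sub 43 [0,1,3,6,4,7], Sub 42 [0,4,1,3,5,7], Sub 42 [0,3,1,4,6,7],
     Sub 14 [0,4,1,5,7,6], Sub 42 [2,0,1,4,6,7], Sub 14 [0,4,1,5,6,7], Sub 14 [3,0,1,5,6,7],
     Sub 9 [4,0,1,5,6,7], Sub 18 [0,4,1,5,6,7]]),
   ([[T,T,T,T,T,T],[F,F,F,F,T],[F,F,T,F],[T,F,F],[F,F],[F],[]], (1, 1, 1, 1), [],
     [Sub 49 [0,1,4,5,6,7], Sub 50 [0,1,4,5,6,7]]),
   ([[T,T,T,T,T,F],[F,F,T,T,F],[T,F,T,F],[T,F,F],[F,F],[F],[]], (3, 5, 13, 21),
     [[-2,-2,-2,3,3,-7,5], [2,2,-3,2,7,-3,-5]], [Sub 54 [2,0,1,5,6,7], Iso 17 [0,1,2,3,4,5,6,7],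
     Iso 18 [0,1,2,3,4,5,6,7]]),
   ([[T,T,T,T,T,T],[F,F,T,T,F],[T,F,T,F],[T,F,F],[F,F],[F],[]], (3, 5, 13, 21), [],
     [Sub 71 [2,0,1,5,6,7], Sub 61 [0,1,2,5,6,7]]),
   ([[T,T,T,T,T,F],[T,T,T,T,F],[T,F,T,F],[T,F,F],[F,F],[F],[]], (3, 5, 13, 21),
     [[-1,-1,-1,-1,0,0,3], [1,1,1,1,0,0,-5]], []),
   ([[T,T,T,T,T,T],[T,T,T,T,F],[T,F,T,F],[T,F,F],[F,F],[F],[]], (3, 5, 13, 21),
     [[-1,3,2,2,1,1,-7]], []),
   ([[T,T,T,T,T,T],[T,T,F,F,T],[T,F,T,F],[T,F,F],[F,F],[F],[]], (3, 5, 13, 21), [],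
     [Sub 153 [2,3,4,0,1,7], Sub 107 [0,1,2,3,4,7]]),
   ([[F,F,F,F,T,T],[F,F,T,F,T],[T,F,T,F],[T,F,F],[F,F],[F],[]], (11, 9, 5, 4),
     [[-3,-3,4,4,1,1,-5], [-4,-1,3,5,3,-1,-4], [3,-4,3,-1,-4,5,-1], [-2,3,-2,1,3,-3,1]],
     [Sub 44 [0,3,4,5,6,7]]),
   ([[T,T,T,T,T,T],[T,T,T,F,T],[T,T,T,F],[T,F,F],[F,F],[F],[]], (3, 5, 13, 21),
     [[-1,2,2,5,5,-6,-6]], []),
   ([[T,F,T,F,T,T],[T,F,T,F,T],[F,T,T,F],[T,T,F],[F,F],[F],[]], (1, 1, 1, 1),
     [[-3,-3,3,3,3,3,-7], [-4,-4,4,4,5,5,-8], [-3,1,3,-1,3,-2,-3], [-1,3,1,-3,2,-3,3]],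
     [Sub 59 [0,2,5,3,4,7], Sub 59 [0,2,3,5,6,7], Sub 59 [1,0,6,3,4,7], Sub 59 [1,0,4,5,6,7],
     Sub 55 [0,3,4,5,6,7]]),
   ([[T,T,T,F,F,F],[F,F,F,T,T],[F,T,F,T],[T,T,F],[F,F],[F],[]], (1, 1, 1, 1),
     [[-1,3,3,-7,-3,-3,6], [0,0,4,-3,0,-3,4], [0,4,-3,0,-3,4,0], [0,-2,1,1,3,-1,-1]],
     [Iso 14 [0,2,3,4,1,5,6,7], Sub 30 [2,6,7,0,1,5], Sub 30 [3,5,7,0,1,6], Sub 30 [4,5,6,0,1,7],
     Sub 23 [0,4,5,6,1,7], Sub 24 [0,4,1,5,6,7], Sub 20 [0,2,1,6,7,5], Sub 20 [0,3,1,5,7,6],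
     Sub 20 [0,4,1,5,6,7], Sub 10 [4,0,1,5,6,7], Sub 25 [0,4,1,5,6,7]]),
   ([[T,T,T,T,T,T],[F,F,F,T,T],[F,T,F,T],[T,T,F],[F,F],[F],[]], (1, 1, 1, 1), [],
     [Sub 71 [4,0,1,5,6,7], Sub 61 [0,1,4,5,6,7]]),
   ([[T,T,T,T,T,T],[T,T,F,T,T],[T,T,F,T],[T,T,F],[F,F],[F],[]], (3, 5, 13, 21), [],
     [Sub 119 [2,3,0,1,4,7], Sub 120 [0,1,2,3,4,7]]),
   ([[T,T,T,T,F,F],[F,F,T,F,T],[T,F,F,T],[F,T,F],[T,F],[F],[]], (1, 1, 1, 1), [[0,0,4,0,-3,-3,4],
     [0,0,-3,0,4,4,-3], [0,-4,2,4,-3,2,-3], [0,-3,0,4,0,4,-3]], [Iso 19 [0,3,5,1,2,4,6,7],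
     Iso 19 [0,2,4,1,3,5,6,7], Sub 20 [4,5,0,1,6,7], Sub 59 [0,2,5,1,6,7], Sub 59 [0,3,1,4,5,7],
     Sub 59 [2,0,1,4,5,7], Sub 83 [0,1,4,5,6,7], Sub 55 [0,4,5,1,6,7]]),
   ([[F,T,F,F,T,T],[T,T,T,F,F],[F,F,F,F],[F,F,T],[T,F],[F],[]], (1, 1, 1, 1),
     [[-3,4,0,6,-3,-6,4], [-4,3,0,6,-4,-6,3], [-4,3,0,0,3,0,-4], [-3,4,0,0,4,0,-3],
     [-3,0,-2,0,3,2,-2]], [Sub 40 [0,4,2,3,7,6], Sub 40 [0,5,2,3,6,7], Sub 116 [0,4,7,3,1,2],
     Sub 30 [7,0,1,3,4,5], Sub 30 [5,0,2,3,6,7], Sub 42 [0,5,2,3,6,7], Sub 42 [4,0,2,3,6,7],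
     Sub 151 [0,4,7,1,2,3], Sub 78 [0,2,3,4,7,6], Sub 78 [0,2,3,5,6,7], Sub 44 [0,5,2,3,6,7]]),
   ([[F,T,T,T,T,T],[T,T,T,T,T],[F,F,T,T],[T,F,T],[T,F],[F],[]], (3, 5, 13, 21),
     [[0,0,1,1,-2,-2,3], [0,0,1,-2,1,3,-2], [0,0,-2,1,3,1,-2], [0,0,-2,3,1,-2,1],
     [0,0,-3,2,2,-1,-1]], [Sub 73 [3,6,7,0,1,2], Sub 153 [3,0,2,6,7,1], Sub 153 [3,0,1,6,7,2],
     Sub 119 [0,3,1,2,6,7]]),
   ([[T,T,T,T,T,T],[T,T,T,T,T],[F,F,T,T],[T,F,T],[T,F],[F],[]], (3, 5, 13, 21), [],
     [Sub 120 [0,1,2,3,6,7]]),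
   ([[F,F,T,T,T,T],[T,F,T,T,T],[T,F,T,T],[T,F,T],[T,F],[F],[]], (4, 5, 21, 26),
     [[3,-3,-3,2,2,-1,-1], [3,-3,-2,3,1,-2,1], [-1,-1,2,2,-3,-3,3], [-2,1,3,1,-3,-2,3],
     [3,-2,-3,1,3,1,-2], [2,-3,-1,3,-1,-3,2], [1,-2,1,3,-2,-3,3]], [Sub 153 [0,5,6,1,2,7]])]"

definition nodes8 :: "node list" where
  "nodes8 = [
   ([[T,T,T,F,T,T,F],[T,T,T,F,T,F],[T,T,T,F,F],[F,F,F,F],[F,F,F],[F,F],[F],[]], (3, 5, 13, 21),
     [[1,1,1,1,0,0,0,-3], [1,1,1,1,0,0,0,-5], [-1,-1,3,1,2,2,-5,-3], [-1,-1,2,0,1,1,-2,1]],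
     [Iso 0 [0,1,2,3,4,5,6,7,8]]),
   ([[T,T,T,T,F,F,T],[T,T,T,F,T,F],[T,T,T,F,F],[F,F,F,F],[F,F,F],[F,F],[F],[]], (3, 5, 13, 21),
     [[2,2,2,2,2,-3,-3,-3], [-3,1,1,0,0,2,2,-4], [5,-1,-1,2,2,-7,-7,4]], []),
   ([[F,F,F,F,F,F,T],[F,F,F,F,T,F],[F,F,T,F,F],[T,F,F,F],[F,F,F],[F,F],[F],[]], (1, 1, 1, 1),
     [[6,-2,-2,-2,-2,-2,-2,7], [-3,3,3,-3,-3,4,4,-3], [-2,-2,-2,6,7,-2,-2,-2],
     [-3,-3,4,4,3,3,-3,-3], [-4,-4,3,3,3,3,-3,-3]], [Sub 8 [0,7,2,8,3,4], Sub 8 [0,7,2,8,3,5],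
     Sub 8 [0,7,2,8,4,6], Sub 8 [0,7,2,8,5,6], Sub 8 [0,6,3,8,4,7], Sub 8 [0,6,3,8,5,7],
     Sub 8 [0,5,4,8,6,7], Sub 8 [0,4,5,8,6,7], Sub 8 [0,6,3,7,4,8], Sub 8 [0,6,3,7,5,8],
     Sub 8 [0,5,4,7,6,8], Sub 8 [0,4,5,7,6,8], Sub 8 [0,5,4,6,7,8], Sub 8 [0,4,5,6,7,8],
     Sub 8 [3,0,5,6,7,8], Sub 8 [3,0,4,6,7,8], Sub 11 [0,4,5,6,7,8]]),
   ([[T,T,T,T,T,T,F],[F,F,T,T,F,F],[T,F,T,F,F],[T,F,F,F],[F,F,F],[F,F],[F],[]], (3, 5, 13, 21),
     [[2,2,2,2,2,2,-4,-7], [1,2,2,2,2,2,-4,-8]], [Iso 1 [0,1,2,3,4,5,6,7,8]]),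
   ([[T,T,T,T,T,T,T],[F,F,T,T,F,F],[T,F,T,F,F],[T,F,F,F],[F,F,F],[F,F],[F],[]], (3, 5, 13, 21),
     [[-1,2,2,2,2,2,-4,-4]], [Sub 28 [0,1,5,6,7,8]]),
   ([[T,T,T,T,T,T,F],[T,T,F,F,T,F],[T,F,T,F,F],[T,F,F,F],[F,F,F],[F,F],[F],[]], (3, 5, 13, 21),
     [[1,1,1,1,0,0,0,-3], [1,3,3,3,-1,-1,-1,-9]], []),
   ([[T,T,T,F,F,F,T],[T,T,F,F,T,F],[T,F,T,F,F],[T,F,F,F],[F,F,F],[F,F],[F],[]], (3, 5, 13, 21),
     [[4,4,4,4,-3,-3,-3,-3], [2,0,0,0,-1,-1,-1,2], [1,0,0,0,-1,-1,-1,1], [-3,2,2,-3,-4,6,6,-4],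
     [1,0,0,1,1,-1,-1,0], [1,-1,-1,1,2,-1,-1,2]], [Iso 2 [0,1,2,3,4,5,6,7,8]]),
   ([[T,T,T,T,T,T,T],[T,T,F,F,T,F],[T,F,T,F,F],[T,F,F,F],[F,F,F],[F,F],[F],[]], (3, 5, 13, 21),
     [[-1,4,4,4,-1,-1,-1,-7]], []),
   ([[T,T,T,T,T,F,T],[T,T,T,T,T,F],[T,F,T,F,F],[T,F,F,F],[F,F,F],[F,F],[F],[]], (3, 5, 13, 21),
     [[1,1,2,2,1,1,-3,-3], [1,-1,0,0,0,0,-1,2], [-1,1,0,0,0,0,2,-1]], []),
   ([[T,T,T,T,F,T,T],[T,T,T,T,F,T],[T,T,T,T,F],[T,F,F,F],[F,F,F],[F,F],[F],[]], (3, 5, 13, 21),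
     [[1,1,1,4,4,-3,-3,-3], [-1,-1,1,0,0,1,1,-2], [1,-1,1,0,0,-1,2,-1], [-1,1,1,0,0,2,-1,-1]], []),
   ([[F,F,T,F,F,T,T],[T,F,F,T,F,T],[F,T,F,T,F],[T,T,F,F],[F,F,F],[F,F],[F],[]], (1, 1, 1, 1),
     [[-4,0,0,4,4,4,-5,-5], [-4,0,0,4,5,5,-4,-4], [-3,4,4,-3,0,0,0,0], [-4,3,3,-4,0,0,0,0],
     [-1,1,-2,1,0,3,-3,0], [-1,-2,1,1,3,0,0,-3]], [Sub 40 [0,2,3,7,8,4], Sub 42 [0,4,6,2,5,7],
     Sub 42 [0,4,5,3,6,8], Sub 42 [0,3,5,4,7,8], Sub 42 [2,0,6,4,7,8], Sub 3 [4,0,5,6,7,8],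
     Sub 14 [0,4,6,5,7,8], Sub 14 [0,4,5,6,8,7], Sub 18 [0,4,5,6,7,8]]),
   ([[T,T,T,T,T,T,F],[T,T,F,T,T,F],[T,T,F,T,F],[T,T,F,F],[F,F,F],[F,F],[F],[]], (3, 5, 13, 21),
     [[-1,-1,-1,-1,0,0,0,3], [2,2,2,2,1,1,1,-12]], []),
   ([[T,T,T,T,T,T,T],[T,T,F,T,T,F],[T,T,F,T,F],[T,T,F,F],[F,F,F],[F,F],[F],[]], (3, 5, 13, 21),
     [[-1,3,3,3,1,1,1,-9]], []),
   ([[T,T,T,T,T,T,T],[T,T,T,F,F,T],[T,T,F,T,F],[T,T,F,F],[F,F,F],[F,F],[F],[]], (3, 5, 13, 21),
     [[-1,3,3,3,5,-4,-4,-4]], []),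
   ([[F,F,F,F,T,T,T],[F,F,T,F,T,T],[F,T,T,F,T],[T,T,T,F],[F,F,F],[F,F],[F],[]], (1, 1, 1, 1),
     [[-2,-2,-2,6,2,2,2,-7], [-2,-2,-2,7,2,2,2,-6], [3,-3,-3,3,-3,4,4,-3], [-3,0,4,0,4,0,-3,0],
     [-4,-4,3,3,3,3,-3,-3]], [Sub 4 [8,0,1,2,3,4], Sub 30 [2,7,8,0,5,6], Sub 30 [3,6,8,0,5,7],
     Sub 30 [4,6,7,0,5,8], Sub 20 [0,1,6,7,8,5], Sub 30 [3,5,8,0,6,7], Sub 30 [4,5,7,0,6,8],
     Sub 20 [0,2,5,7,8,6], Sub 30 [4,5,6,0,7,8], Sub 20 [0,3,5,6,8,7], Sub 20 [0,4,5,6,7,8],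
     Sub 4 [4,0,5,6,7,8], Sub 25 [0,4,5,6,7,8]]),
   ([[T,T,T,F,T,T,T],[T,T,T,F,T,T],[T,T,T,F,T],[T,T,T,F],[F,F,F],[F,F],[F],[]], (3, 5, 13, 21),
     [[-1,-1,-1,1,1,1,1,-3], [1,1,-1,1,-1,-1,3,-1], [1,-1,1,1,-1,3,-1,-1], [-1,1,1,1,3,-1,-1,-1],
     [1,1,1,-4,-2,-2,-2,5], [-1,-1,4,-1,2,2,-5,2], [1,-4,1,1,-2,5,-2,-2], [-4,1,1,1,5,-2,-2,-2]],
     [Sub 120 [0,1,2,3,4,8]]),
   ([[F,T,F,F,T,T,F],[T,T,T,F,F,F],[F,F,F,F,T],[F,F,T,F],[T,F,F],[F,F],[F],[]], (1, 1, 1, 1),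
     [[0,0,-7,3,3,3,3,-7], [4,-4,-4,0,0,5,5,-4], [-4,4,-4,5,5,0,0,-4], [0,0,-1,-2,2,2,-2,-2],
     [0,0,1,-2,2,2,-2,2]], [Iso 3 [0,3,1,5,2,7,4,6,8], Iso 3 [0,3,1,4,2,6,5,7,8],
     Sub 42 [0,4,7,1,2,8], Sub 40 [0,3,1,7,8,5], Sub 3 [7,0,1,4,5,8], Sub 8 [3,8,0,2,6,7],
     Sub 3 [5,0,2,6,7,8], Sub 42 [0,1,7,4,6,8], Sub 42 [0,1,6,5,7,8], Sub 14 [0,5,2,6,7,8],
     Sub 14 [1,6,0,5,7,8], Sub 18 [0,5,2,6,7,8]]),
   ([[T,T,T,T,T,T,F],[T,T,T,T,T,F],[F,F,T,T,F],[T,F,T,F],[T,F,F],[F,F],[F],[]], (3, 5, 13, 21),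
     [[-1,-1,-1,-1,-1,-1,-1,5], [-2,-2,-1,-1,-1,-1,-1,10]], []),
   ([[T,T,T,T,T,T,T],[T,T,T,T,T,F],[F,F,T,T,F],[T,F,T,F],[T,F,F],[F,F],[F],[]], (3, 5, 13, 21),
     [[2,-5,-2,-2,-2,-2,-2,12]], []),
   ([[T,T,F,F,F,T,T],[F,T,F,T,F,T],[T,T,F,T,F],[T,T,F,F],[F,F,T],[T,F],[F],[]], (1, 1, 1, 1),
     [[-3,3,-3,4,4,-1,-7,5], [0,0,0,0,-3,4,4,-3], [4,-4,5,-4,0,-4,5,1], [-5,-5,3,3,4,0,0,-3],
     [-2,-2,2,2,6,-3,-3,1]], [Iso 4 [0,1,2,5,3,6,4,7,8], Sub 59 [0,2,6,4,7,8],
     Sub 20 [3,8,0,1,5,6], Sub 59 [0,1,7,3,6,8], Sub 20 [4,8,0,2,5,7], Sub 20 [4,7,0,3,6,8],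
     Sub 20 [3,6,0,4,7,8], Sub 55 [0,3,6,4,7,8]])]"

definition nodes9 :: "node list" where
  "nodes9 = [
   ([[T,T,T,F,T,T,T,F],[T,T,T,F,T,T,F],[T,T,T,F,T,F],[T,T,T,F,F],[F,F,F,F],[F,F,F],[F,F],[F],[]],
     (3, 5, 13, 21), [], []),
   ([[T,T,T,T,T,T,F,T],[T,T,T,T,T,T,F],[F,F,T,T,F,F],[T,F,T,F,F],[T,F,F,F],[F,F,F],[F,F],[F],[]],
     (3, 5, 13, 21), [], []),
   ([[T,T,T,T,T,T,T,T],[T,T,T,F,F,F,T],[T,T,F,F,T,F],[T,F,T,F,F],[T,F,F,F],[F,F,F],[F,F],[F],[]],
     (3, 5, 13, 21), [], []),
   ([[F,F,T,F,T,F,F,T],[T,F,T,F,F,F,T],[F,F,T,F,T,F],[T,F,F,T,F],[F,T,F,F],[T,F,F],[F,F],[F],[]],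
     (1, 1, 1, 1), [], []),
   ([[F,F,T,F,T,F,T,T],[T,F,T,F,F,T,T],[F,F,T,T,F,T],[T,F,T,F,T],[F,T,T,F],[T,T,F],[F,F],[F],[]],
     (1, 1, 1, 1), [], [])]"

text \<open>
  The graphs of \<open>nodes7\<close>, \<open>nodes8\<close> and \<open>nodes9\<close> that are not induced subgraphs of others, apart
  from the two with seven-fold symmetry. The first five have nine vertices; exactly one of them
  extends further, to the ten midpoints of the edges of a regular simplex.
\<close>

definition models :: "model list" where
  "models = [
   ([[T,T,T,F,T,T,T,F],[T,T,T,F,T,T,F],[T,T,T,F,T,F],[T,T,T,F,F],[F,F,F,F],[F,F,F],[F,F],[F],[]],
     80, (-40,40), [(-10,5),(0,1),(0,1),(-10,5)], [[(1,1),(1,1),(2,0),(4,2)],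
     [(4,2),(0,2),(0,0),(0,0)], [(-2,0),(0,2),(0,0),(0,0)], [(1,1),(1,1),(2,2),(0,0)],
     [(1,1),(-3,1),(-1,1),(3,1)], [(2,2),(0,0),(0,0),(0,0)], [(0,0),(0,0),(0,0),(0,0)],
     [(1,1),(-3,1),(4,0),(0,0)], [(1,1),(1,1),(2,0),(2,0)]]),
   ([[T,T,T,T,T,T,F,T],[T,T,T,T,T,T,F],[F,F,T,T,F,F],[T,F,T,F,F],[T,F,F,F],[F,F,F],[F,F],[F],[]],
     80, (-40,40), [(-10,5),(0,1),(0,1),(-10,5)], [[(1,1),(1,1),(2,0),(4,2)],
     [(-2,0),(-2,0),(1,-1),(3,1)], [(-2,0),(0,2),(0,0),(0,0)], [(1,1),(1,1),(2,-2),(0,0)],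
     [(-2,0),(2,0),(4,0),(0,0)], [(2,2),(0,0),(0,0),(0,0)], [(1,1),(-3,1),(4,0),(0,0)],
     [(1,1),(1,1),(2,0),(2,0)], [(0,0),(0,0),(0,0),(0,0)]]),
   ([[T,T,T,T,T,T,T,T],[T,T,T,F,F,F,T],[T,T,F,F,T,F],[T,F,T,F,F],[T,F,F,F],[F,F,F],[F,F],[F],[]],
     80, (-40,40), [(-10,5),(0,1),(0,1),(-10,5)], [[(1,1),(1,1),(2,0),(4,2)],
     [(4,2),(0,2),(0,0),(0,0)], [(-2,0),(0,2),(0,0),(0,0)], [(1,1),(-3,1),(-1,-1),(1,1)],
     [(1,1),(-3,1),(4,0),(0,0)], [(1,1),(1,1),(2,-2),(0,0)], [(1,1),(1,1),(2,0),(-2,0)],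
     [(2,2),(0,0),(0,0),(0,0)], [(0,0),(0,0),(0,0),(0,0)]]),
   ([[F,F,T,F,T,F,F,T],[T,F,T,F,F,F,T],[F,F,T,F,T,F],[T,F,F,T,F],[F,T,F,F],[T,F,F],[F,F],[F],[]],
     8, (8,0), [(2,0),(2,0),(1,0),(5,0)], [[(2,0),(1,0),(1,0),(1,0)], [(2,0),(2,0),(0,0),(0,0)],
     [(0,0),(1,0),(1,0),(1,0)], [(0,0),(2,0),(0,0),(0,0)], [(1,0),(0,0),(-1,0),(1,0)],
     [(1,0),(1,0),(-2,0),(0,0)], [(1,0),(1,0),(2,0),(0,0)], [(2,0),(0,0),(0,0),(0,0)],
     [(0,0),(0,0),(0,0),(0,0)]]),
   ([[F,F,T,F,T,F,T,T],[T,F,T,F,F,T,T],[F,F,T,T,F,T],[T,F,T,F,T],[F,T,T,F],[T,T,F],[F,F],[F],[]],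
     4, (4,0), [(1,0),(3,0),(1,0),(3,0)], [[(1,0),(1,0),(1,0),(1,0)], [(1,0),(1,0),(2,0),(0,0)],
     [(2,0),(0,0),(1,0),(1,0)], [(2,0),(0,0),(2,0),(0,0)], [(0,0),(0,0),(1,0),(1,0)],
     [(0,0),(0,0),(2,0),(0,0)], [(1,0),(1,0),(0,0),(0,0)], [(2,0),(0,0),(0,0),(0,0)],
     [(0,0),(0,0),(0,0),(0,0)]]),
   ([[T,T,T,T,F,F,T],[T,T,T,F,T,F],[T,T,T,F,F],[F,F,F,F],[F,F,F],[F,F],[F],[]], 80, (-40,40),
     [(-10,5),(0,1),(0,1),(-10,10)], [[(6,2),(0,0),(0,0),(0,0)], [(2,0),(0,-2),(0,0),(0,0)],
     [(2,0),(2,0),(-4,0),(0,0)], [(2,0),(2,0),(1,1),(1,0)], [(2,0),(2,0),(1,1),(-1,0)],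
     [(3,1),(1,-1),(-2,2),(0,0)], [(3,1),(5,-1),(0,0),(0,0)], [(0,0),(0,0),(0,0),(0,0)]]),
   ([[F,F,F,F,F,F,T],[F,F,F,F,T,F],[F,F,T,F,F],[T,F,F,F],[F,F,F],[F,F],[F],[]], 4, (4,0),
     [(1,0),(1,0),(2,0),(2,0)], [[(2,0),(2,0),(0,0),(0,0)], [(2,0),(0,0),(0,0),(0,0)],
     [(1,0),(1,0),(0,0),(1,0)], [(1,0),(1,0),(-1,0),(0,0)], [(1,0),(1,0),(1,0),(0,0)],
     [(1,0),(1,0),(0,0),(-1,0)], [(0,0),(2,0),(0,0),(0,0)], [(0,0),(0,0),(0,0),(0,0)]]),
   ([[T,T,T,T,T,T,T],[F,F,T,T,F,F],[T,F,T,F,F],[T,F,F,F],[F,F,F],[F,F],[F],[]], 80, (-40,40),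
     [(-10,5),(0,1),(0,4),(40,20)], [[(1,1),(1,1),(1,0),(1,0)], [(4,2),(2,0),(2,0),(0,0)],
     [(4,2),(0,2),(0,0),(0,0)], [(1,1),(-3,1),(2,0),(0,0)], [(1,1),(1,1),(1,-1),(0,0)],
     [(0,0),(0,0),(0,0),(0,0)], [(1,1),(1,1),(1,0),(2,-1)], [(2,2),(0,0),(0,0),(0,0)]]),
   ([[T,T,T,T,T,T,F],[T,T,F,F,T,F],[T,F,T,F,F],[T,F,F,F],[F,F,F],[F,F],[F],[]], 160, (-80,80),
     [(-20,10),(0,2),(0,2),(5,5)], [[(6,2),(0,0),(0,0),(0,0)], [(2,0),(0,2),(0,0),(0,0)],
     [(3,1),(-1,1),(2,2),(0,0)], [(2,0),(-2,0),(-1,1),(2,0)], [(2,0),(2,0),(1,1),(1,-1)],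
     [(0,0),(0,0),(0,0),(0,0)], [(2,0),(-2,0),(4,0),(0,0)], [(3,1),(-1,1),(2,0),(3,-1)]]),
   ([[T,T,T,T,F,T,T],[T,T,T,T,F,T],[T,T,T,T,F],[T,F,F,F],[F,F,F],[F,F],[F],[]], 80, (-40,40),
     [(-10,5),(0,1),(0,1),(10,10)], [[(6,2),(0,0),(0,0),(0,0)], [(2,0),(0,-2),(0,0),(0,0)],
     [(3,1),(1,-1),(2,2),(0,0)], [(2,0),(2,0),(-1,1),(1,0)], [(2,0),(2,0),(-1,1),(-1,0)],
     [(3,1),(5,-1),(0,0),(0,0)], [(0,0),(0,0),(0,0),(0,0)], [(2,0),(2,0),(4,0),(0,0)]]),
   ([[T,T,T,T,T,T,T],[T,T,F,T,T,F],[T,T,F,T,F],[T,T,F,F],[F,F,F],[F,F],[F],[]], 80, (-40,40),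
     [(-10,5),(0,1),(0,1),(-10,5)], [[(1,1),(1,1),(-2,0),(4,2)], [(1,1),(1,1),(3,1),(3,1)],
     [(4,2),(0,2),(0,0),(0,0)], [(-2,0),(0,2),(0,0),(0,0)], [(1,1),(-3,1),(1,1),(1,1)],
     [(2,2),(0,0),(0,0),(0,0)], [(0,0),(0,0),(0,0),(0,0)], [(1,1),(1,1),(-2,2),(0,0)]]),
   ([[F,F,F,F,T,T,T],[F,F,T,F,T,T],[F,T,T,F,T],[T,T,T,F],[F,F,F],[F,F],[F],[]], 12, (12,0),
     [(3,0),(1,0),(8,0),(12,0)], [[(1,0),(1,0),(1,0),(1,0)], [(1,0),(3,0),(0,0),(1,0)],
     [(2,0),(0,0),(0,0),(1,0)], [(0,0),(0,0),(0,0),(1,0)], [(1,0),(1,0),(1,0),(0,0)],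
     [(1,0),(3,0),(0,0),(0,0)], [(2,0),(0,0),(0,0),(0,0)], [(0,0),(0,0),(0,0),(0,0)]]),
   ([[T,T,T,T,T,T,F],[T,T,T,T,T,F],[F,F,T,T,F],[T,F,T,F],[T,F,F],[F,F],[F],[]], 80, (-40,40),
     [(-10,5),(0,1),(0,1),(10,10)], [[(1,1),(1,1),(3,1),(1,0)], [(1,1),(1,1),(3,1),(-1,0)],
     [(1,1),(5,1),(0,0),(0,0)], [(4,2),(0,2),(0,0),(0,0)], [(-2,0),(0,2),(0,0),(0,0)],
     [(2,2),(0,0),(0,0),(0,0)], [(0,0),(0,0),(0,0),(0,0)], [(1,1),(1,1),(-2,2),(0,0)]]),
   ([[T,T,T,T,T,T],[F,F,F,F,T],[F,F,T,F],[T,F,F],[F,F],[F],[]], 4, (4,0),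
     [(1,0),(1,0),(2,0),(6,0)], [[(1,0),(1,0),(0,0),(1,0)], [(2,0),(2,0),(0,0),(0,0)],
     [(0,0),(2,0),(0,0),(0,0)], [(1,0),(1,0),(-1,0),(0,0)], [(1,0),(1,0),(1,0),(0,0)],
     [(2,0),(0,0),(0,0),(0,0)], [(0,0),(0,0),(0,0),(0,0)]]),
   ([[T,T,T,T,T,T],[F,F,F,T,T],[F,T,F,T],[T,T,F],[F,F],[F],[]], 12, (12,0),
     [(3,0),(1,0),(3,0),(17,0)], [[(1,0),(1,0),(1,0),(1,0)], [(1,0),(3,0),(2,0),(0,0)],
     [(2,0),(0,0),(2,0),(0,0)], [(0,0),(0,0),(2,0),(0,0)], [(1,0),(3,0),(0,0),(0,0)],
     [(2,0),(0,0),(0,0),(0,0)], [(0,0),(0,0),(0,0),(0,0)]]),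
   ([[F,T,T,T,T,T],[T,T,T,T,T],[F,F,T,T],[T,F,T],[T,F],[F],[]], 80, (-40,40),
     [(-10,5),(0,1),(0,1),(110,-30)], [[(1,1),(1,1),(7,-1),(1,0)], [(1,1),(1,1),(2,2),(0,0)],
     [(1,1),(5,1),(0,0),(0,0)], [(4,2),(0,2),(0,0),(0,0)], [(-2,0),(0,2),(0,0),(0,0)],
     [(2,2),(0,0),(0,0),(0,0)], [(0,0),(0,0),(0,0),(0,0)]])]"

definition realized_graphs :: "graph list" where
  "realized_graphs = map fst models @
    [[[F, T, F, F, T, F], [F, T, F, F, T], [F, T, F, F], [F, T, F], [F, T], [F], []],
     [[F, T, T, T, T, F], [F, T, T, T, T], [F, T, T, T], [F, T, T], [F, T], [F], []]]"

text \<open>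
  Where the graphs of the three lists sit in \<open>realized_graphs\<close>: the number of the larger graph
  and the vertices that induce the smaller one.
\<close>

definition places7 :: "(nat \<times> nat list) list" where
  "places7 =
    [(0,[2,3,4,5,6,7,8]), (6,[1,2,3,4,5,6,7]), (1,[2,3,4,5,6,7,8]), (2,[2,3,4,5,6,7,8]),
    (1,[1,3,4,5,6,7,8]), (2,[0,3,4,5,6,7,8]), (1,[0,1,4,5,6,7,8]), (3,[2,3,6,4,5,7,8]),
    (0,[1,2,3,5,6,7,8]), (0,[0,2,3,5,6,7,8]), (2,[1,2,3,4,6,7,8]), (2,[0,2,3,4,6,7,8]),
    (1,[0,1,2,5,6,7,8]), (0,[1,2,3,4,5,6,7]), (3,[0,3,4,5,6,7,8]), (3,[4,1,3,6,5,7,8]),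
    (13,[0,1,2,3,4,5,6]), (1,[1,2,3,4,5,6,8]), (1,[0,2,3,4,5,6,8]), (0,[0,1,2,3,6,7,8]),
    (1,[0,1,3,4,5,6,8]), (2,[0,1,2,3,6,7,8]), (16,[1,4,5,0,2,3,6]), (2,[0,1,2,3,4,7,8]),
    (4,[0,3,4,5,6,7,8]), (11,[4,1,2,3,5,6,7]), (14,[0,1,2,3,4,5,6]), (0,[0,1,2,3,5,6,7]),
    (4,[6,2,3,4,5,7,8]), (3,[0,2,5,1,7,3,8]), (15,[0,1,2,3,4,5,6]), (1,[0,1,2,3,4,5,6]),
    (17,[2,3,1,4,0,5,6])]"

definition places8 :: "(nat \<times> nat list) list" where
  "places8 =
    [(0,[1,2,3,4,5,6,7,8]), (5,[0,1,2,3,4,5,6,7]), (6,[0,1,2,3,4,5,6,7]), (1,[1,2,3,4,5,6,7,8]),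
    (7,[0,1,2,3,4,5,6,7]), (8,[0,1,2,3,4,5,6,7]), (2,[1,2,3,4,5,6,7,8]), (2,[0,2,3,4,5,6,7,8]),
    (1,[0,1,3,4,5,6,7,8]), (9,[0,1,2,3,4,5,6,7]), (3,[0,1,2,3,7,4,5,8]), (0,[0,1,2,3,5,6,7,8]),
    (10,[0,1,2,3,4,5,6,7]), (2,[0,1,2,3,4,6,7,8]), (11,[0,1,2,3,4,5,6,7]), (0,[0,1,2,3,4,5,6,7]),
    (3,[2,4,1,3,6,5,7,8]), (12,[0,1,2,3,4,5,6,7]), (1,[0,1,2,3,4,5,6,8]), (4,[1,2,4,6,3,5,7,8])]"

definition places9 :: "(nat \<times> nat list) list" where
  "places9 =
    [(0,[0,1,2,3,4,5,6,7,8]), (1,[0,1,2,3,4,5,6,7,8]), (2,[0,1,2,3,4,5,6,7,8]),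
    (3,[0,1,2,3,4,5,6,7,8]), (4,[0,1,2,3,4,5,6,7,8])]"

fun placed :: "graph list \<Rightarrow> graph \<times> range \<Rightarrow> nat \<times> nat list \<Rightarrow> bool" where
  "placed R (G, _) (m, p) \<longleftrightarrow> m < length R \<and> distinct p \<and>
     list_all (\<lambda>i. i < length (R ! m)) p \<and> relabel (R ! m) p = G"

definition suitable :: "nat \<Rightarrow> (graph \<times> range) list \<Rightarrow> bool" where
  "suitable n L \<longleftrightarrow> list_all (\<lambda>(G, _). mixed G \<and> length G = n) L \<and>
     distinct (map (invariant \<circ> fst) L)"

section \<open>The classification\<close>

lemma valid_nodes:
  "list_all (valid_node [] (bare nodes2)) nodes1"
  "list_all (valid_node [] (bare nodes3)) nodes2"
  "list_all (valid_node [] (bare nodes4)) nodes3"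
  "list_all (valid_node [] (bare nodes5)) nodes4"
  "list_all (valid_node [] (unbounded nodes6)) nodes5"
  by code_simp+

lemma valid_nodes6: "list_all (valid_node (bare nodes6) (bare nodes7)) nodes6"
  by code_simp

lemma valid_nodes7: "list_all (valid_node (bare nodes6) (bare nodes8)) nodes7"
  by code_simp

lemma valid_nodes8: "list_all (valid_node (bare nodes6) (bare nodes9)) nodes8"
  by code_simp

lemma valid_ranges: "list_all2 valid_range (bare nodes6) low_vectors"
  by code_simp

lemma covers_7_8_9: "covers 7 (bare nodes7)" "covers 8 (bare nodes8)" "covers 9 (bare nodes9)"
proof -
  have "bare nodes1 = [([[]], (0, 1, 1, 0))]" by (simp add: bare_def nodes1_def)
  then have "covers 1 (bare nodes1)" using covers_1 by simp
  then have "covers 2 (bare nodes2)"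
    using covers_Suc[OF _ _ valid_nodes(1), of 1] by (simp add: numeral_2_eq_2)
  then have "covers 3 (bare nodes3)"
    using covers_Suc[OF _ _ valid_nodes(2), of 2] by simp
  then have "covers 4 (bare nodes4)"
    using covers_Suc[OF _ _ valid_nodes(3), of 3] by simp
  then have "covers 5 (bare nodes5)"
    using covers_Suc[OF _ _ valid_nodes(4), of 4] by simp
  then have "covers 6 (unbounded nodes6)"
    using covers_Suc[OF _ _ valid_nodes(5), of 5] by simp
  note six = covers_refine[OF this valid_ranges]
  show 7: "covers 7 (bare nodes7)"
    using covers_Suc[OF six(1) six(2) valid_nodes6] by simp
  show 8: "covers 8 (bare nodes8)"
    using covers_Suc[OF 7 six(2) valid_nodes7] by simp
  show "covers 9 (bare nodes9)"
    using covers_Suc[OF 8 six(2) valid_nodes8] by simp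
qed

lemma valid_models: "list_all valid_model models"
  by code_simp

lemma realized_graphs_realizable: "G \<in> set realized_graphs \<Longrightarrow> realizable G"
  using valid_models valid_model_realizable heptagons_realizable
  by (auto simp: realized_graphs_def list_all_iff)

lemma placed_realizable:
  assumes "list_all2 (placed realized_graphs) L ps" "G \<in> fst ` set L"
  shows "realizable G"
proof -
  obtain I where "(G, I) \<in> set L" using assms(2) by auto
  then obtain m p where "placed realized_graphs (G, I) (m, p)"
    using assms(1) by (metis in_set_conv_nth list_all2_conv_all_nth prod.exhaust)
  then have p: "realized_graphs ! m \<in> set realized_graphs" "distinct p"
    "\<forall>i\<in>set p. i < length (realized_graphs ! m)" "relabel (realized_graphs ! m) p = G"
    by (auto simp: list_all_iff)
  show ?thesis
    using realizable_relabel[OF realized_graphs_realizable[OF p(1)] p(2,3)] p(4) by simp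
qed

lemma placed_nodes:
  "list_all2 (placed realized_graphs) (bare nodes7) places7"
  "list_all2 (placed realized_graphs) (bare nodes8) places8"
  "list_all2 (placed realized_graphs) (bare nodes9) places9"
  by code_simp+

lemma suitable_nodes:
  "suitable 7 (bare nodes7)" "suitable 8 (bare nodes8)" "suitable 9 (bare nodes9)"
  by code_simp+

lemma length_nodes:
  "length (bare nodes7) = 33" "length (bare nodes8) = 20" "length (bare nodes9) = 5"
  by code_simp+

lemma card_classes_of_list:
  assumes "covers n L" "6 \<le> n" "list_all2 (placed realized_graphs) L ps" "suitable n L"
  shows "card (two_distance_classes n :: (real ^ 4) set set set) = length L"
proof (rule card_two_distance_classes[OF assms(1,2)])
  show "realizable G \<and> mixed G \<and> length G = n" if "G \<in> fst ` set L" for G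
    using placed_realizable[OF assms(3) that] that assms(4)
    by (auto simp: suitable_def list_all_iff)
  show "distinct (map (invariant \<circ> fst) L)"
    using assms(4) by (simp add: suitable_def)
qed

theorem theorem1:
  shows "card (two_distance_classes 7 :: (real ^ 4) set set set) = 33
    \<and> card (two_distance_classes 8 :: (real ^ 4) set set set) = 20
    \<and> card (two_distance_classes 9 :: (real ^ 4) set set set) = 5"
  using card_classes_of_list[OF covers_7_8_9(1) _ placed_nodes(1) suitable_nodes(1)]
    card_classes_of_list[OF covers_7_8_9(2) _ placed_nodes(2) suitable_nodes(2)]
    card_classes_of_list[OF covers_7_8_9(3) _ placed_nodes(3) suitable_nodes(3)] length_nodes
  by simp

end
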